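(* There exists an absolute constant $k\in\mathbb Z_{+}$ with the following property. For each $n$, let $\lambda_{(1)},\dots,\lambda_{(k)}$ be random irreducible representations of $S_n$ defined on a common probability space with an arbitrary joint distribution (arbitrary coupling), such that either every $\lambda_{(i)}$ has marginal law the Plancherel measure on partitions of $n$, or every $\lambda_{(i)}$ has marginal law the uniform measure on partitions of $n$. Then the probability that the tensor product $\bigotimes_{i=1}^k \lambda_{(i)}$ covers $\mathrm{Irrep}(S_n)$ is $1-o_n(1)$ as $n\to\infty$.
   Context: Irreducible complex representations of the symmetric group $S_n$ are identified with partitions (Young diagrams) $\lambda\vdash n$. Tensor products of $S_n$-representations are again regarded as $S_n$-representations via the diagonal action. A representation $V$ of $S_n$ covers $\mathrm{Irrep}(S_n)$ if every irreducible representation of $S_n$ occurs as a subrepresentation of $V$. The Plancherel measure on partitions of $n$ assigns probability $(\dim\lambda)^2/n!$ to $\lambda\vdash n$; the uniform measure assigns equal probability to all partitions of $n$. *)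

theory Defs
  imports
    "HOL-Probability.Probability"
    "HOL-Algebra.Sym_Groups"
    "HOL-Library.Function_Algebras"
    "Jordan_Normal_Form.VS_Connect"
begin

section \<open>Complex matrix representations of symmetric groups\<close>

text \<open>
  Representations are finite-dimensional and given by matrices; every irreducible complex
  representation of a finite group is isomorphic to one of this form.  Values of a
  representation outside the group are irrelevant.
\<close>

type_synonym matrep = "(nat \<Rightarrow> nat) \<Rightarrow> complex mat"

abbreviation Sym :: "nat \<Rightarrow> (nat \<Rightarrow> nat) set" where
  "Sym n \<equiv> carrier (sym_group n)"

definition rep_degree :: "matrep \<Rightarrow> nat" where
  "rep_degree \<rho> = dim_row (\<rho> id)"

abbreviation GL :: "nat \<Rightarrow> complex mat monoid" where
  "GL d \<equiv> units_of (ring_mat TYPE(complex) d ())"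

definition representation :: "nat \<Rightarrow> matrep \<Rightarrow> bool" where
  "representation n \<rho> \<longleftrightarrow> \<rho> \<in> hom (sym_group n) (GL (rep_degree \<rho>))"

definition invariant_subspace :: "nat \<Rightarrow> matrep \<Rightarrow> complex vec set \<Rightarrow> bool" where
  "invariant_subspace n \<rho> W \<longleftrightarrow>
     VectorSpace.subspace class_ring W (module_vec TYPE(complex) (rep_degree \<rho>)) \<and>
     (\<forall>g\<in>Sym n. \<forall>w\<in>W. \<rho> g *\<^sub>v w \<in> W)"

definition irreducible_rep :: "nat \<Rightarrow> matrep \<Rightarrow> bool" where
  "irreducible_rep n \<rho> \<longleftrightarrow>
     representation n \<rho> \<and> rep_degree \<rho> > 0 \<and>
     (\<forall>W. invariant_subspace n \<rho> W \<longrightarrow>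
        W = {0\<^sub>v (rep_degree \<rho>)} \<or> W = carrier_vec (rep_degree \<rho>))"

text \<open>
  \<open>\<sigma>\<close> occurs as a subrepresentation of \<open>\<rho>\<close>: \<open>A\<close> is an isomorphism of \<open>\<sigma>\<close> onto the
  invariant subspace \<open>W\<close> of \<open>\<rho>\<close>.
\<close>

definition occurs_in :: "nat \<Rightarrow> matrep \<Rightarrow> matrep \<Rightarrow> bool" where
  "occurs_in n \<sigma> \<rho> \<longleftrightarrow>
     (\<exists>W A. invariant_subspace n \<rho> W \<and>
        A \<in> carrier_mat (rep_degree \<rho>) (rep_degree \<sigma>) \<and>
        bij_betw (\<lambda>v. A *\<^sub>v v) (carrier_vec (rep_degree \<sigma>)) W \<and>
        (\<forall>g\<in>Sym n. \<forall>v\<in>carrier_vec (rep_degree \<sigma>). A *\<^sub>v (\<sigma> g *\<^sub>v v) = \<rho> g *\<^sub>v (A *\<^sub>v v)))"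

definition covers_Irrep :: "nat \<Rightarrow> matrep \<Rightarrow> bool" where
  "covers_Irrep n \<rho> \<longleftrightarrow> (\<forall>\<sigma>. irreducible_rep n \<sigma> \<longrightarrow> occurs_in n \<sigma> \<rho>)"

definition kronecker :: "complex mat \<Rightarrow> complex mat \<Rightarrow> complex mat" where
  "kronecker A B =
     mat (dim_row A * dim_row B) (dim_col A * dim_col B)
       (\<lambda>(i, j). A $$ (i div dim_row B, j div dim_col B) * B $$ (i mod dim_row B, j mod dim_col B))"

definition tensor_rep :: "matrep list \<Rightarrow> matrep" where
  "tensor_rep \<rho>s = (\<lambda>g. foldr (\<lambda>\<rho> M. kronecker (\<rho> g) M) \<rho>s (1\<^sub>m 1))"


section \<open>Partitions and Specht modules\<close>

definition partitions :: "nat \<Rightarrow> nat list set" where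
  "partitions n = {\<mu>. sorted_wrt (\<ge>) \<mu> \<and> 0 \<notin> set \<mu> \<and> sum_list \<mu> = n}"

text \<open>
  The tableau of shape \<open>\<mu>\<close> with entries \<open>1, 2, \<dots>\<close> in reading order.  Rows and columns are
  indexed from \<open>0\<close>.
\<close>

definition tab_entry :: "nat list \<Rightarrow> nat \<Rightarrow> nat \<Rightarrow> nat" where
  "tab_entry \<mu> r c = sum_list (take r \<mu>) + c + 1"

definition tab_row :: "nat list \<Rightarrow> nat \<Rightarrow> nat set" where
  "tab_row \<mu> r = {tab_entry \<mu> r c | c. r < length \<mu> \<and> c < \<mu> ! r}"

definition tab_col :: "nat list \<Rightarrow> nat \<Rightarrow> nat set" where
  "tab_col \<mu> c = {tab_entry \<mu> r c | r. r < length \<mu> \<and> c < \<mu> ! r}"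

definition row_group :: "nat list \<Rightarrow> (nat \<Rightarrow> nat) set" where
  "row_group \<mu> = {p \<in> Sym (sum_list \<mu>). \<forall>r. p ` tab_row \<mu> r = tab_row \<mu> r}"

definition col_group :: "nat list \<Rightarrow> (nat \<Rightarrow> nat) set" where
  "col_group \<mu> = {p \<in> Sym (sum_list \<mu>). \<forall>c. p ` tab_col \<mu> c = tab_col \<mu> c}"

text \<open>
  Elements of the group algebra of \<open>S\<^sub>n\<close> are the complex functions that vanish outside
  \<open>Sym n\<close>; the product is convolution and the action of \<open>S\<^sub>n\<close> is left translation.
\<close>

type_synonym galg = "(nat \<Rightarrow> nat) \<Rightarrow> complex"

definition group_algebra :: "nat \<Rightarrow> galg set" where
  "group_algebra n = {x. \<forall>p. p \<notin> Sym n \<longrightarrow> x p = 0}"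

definition conv :: "nat \<Rightarrow> galg \<Rightarrow> galg \<Rightarrow> galg" where
  "conv n x y = (\<lambda>p. \<Sum>q\<in>Sym n. x q * y (inv_into UNIV q \<circ> p))"

definition translate :: "(nat \<Rightarrow> nat) \<Rightarrow> galg \<Rightarrow> galg" where
  "translate g x = (\<lambda>p. x (inv_into UNIV g \<circ> p))"

definition young_symmetrizer :: "nat list \<Rightarrow> galg" where
  "young_symmetrizer \<mu> =
     conv (sum_list \<mu>)
       (\<lambda>p. if p \<in> row_group \<mu> then 1 else 0)
       (\<lambda>q. if q \<in> col_group \<mu> then of_int (sign q) else 0)"

text \<open>With this convention \<open>[n]\<close> gives the trivial and \<open>[1, \<dots>, 1]\<close> the sign representation.\<close>

definition specht_module :: "nat list \<Rightarrow> galg set" where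
  "specht_module \<mu> =
     (\<lambda>x. conv (sum_list \<mu>) x (young_symmetrizer \<mu>)) ` group_algebra (sum_list \<mu>)"

definition fun_scale :: "complex \<Rightarrow> galg \<Rightarrow> galg" where
  "fun_scale c x = (\<lambda>p. c * x p)"

global_interpretation galg: vector_space fun_scale
  by unfold_locales (auto simp: fun_scale_def fun_eq_iff algebra_simps)

text \<open>\<open>\<rho>\<close> is the matrix form of the left translation action on \<open>V\<close> in some basis of \<open>V\<close>.\<close>

definition matrix_form :: "nat \<Rightarrow> galg set \<Rightarrow> matrep \<Rightarrow> bool" where
  "matrix_form n V \<rho> \<longleftrightarrow>
     (\<exists>bs. distinct bs \<and> galg.independent (set bs) \<and> galg.span (set bs) = V \<and>
        (\<forall>g\<in>Sym n. \<rho> g \<in> carrier_mat (length bs) (length bs) \<and>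
           (\<forall>j<length bs. translate g (bs ! j) =
              (\<Sum>i<length bs. fun_scale (\<rho> g $$ (i, j)) (bs ! i)))))"

text \<open>The irreducible representation attached to \<open>\<mu>\<close>, well defined up to isomorphism.\<close>

definition specht_rep :: "nat list \<Rightarrow> matrep" where
  "specht_rep \<mu> = (SOME \<rho>. matrix_form (sum_list \<mu>) (specht_module \<mu>) \<rho>)"

text \<open>The choice in \<open>specht_rep\<close> is never vacuous.\<close>

lemma sum_galg_apply: "(\<Sum>i\<in>A. f i) x = (\<Sum>i\<in>A. (f i x))" for f :: "'b \<Rightarrow> galg"
  by (induction A rule: infinite_finite_induct) auto

lemma finite_Sym: "finite (Sym n)" by (simp add: sym_group_def finite_permutations)

lemma specht_rep_matrix_form:
  "matrix_form (sum_list \<mu>) (specht_module \<mu>) (specht_rep \<mu>)"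
proof -
  define n where "n = sum_list \<mu>"
  define c where "c = young_symmetrizer \<mu>"
  define V where "V = specht_module \<mu>"
  have V: "V = (\<lambda>x. conv n x c) ` group_algebra n" by (simp add: V_def specht_module_def n_def c_def)
  have sub: "galg.subspace V"
  proof (rule galg.subspaceI)
    have "conv n 0 c = 0" by (simp add: conv_def fun_eq_iff)
    moreover have "0 \<in> group_algebra n" by (simp add: group_algebra_def)
    ultimately show "0 \<in> V" unfolding V by (metis image_eqI)
  next
    fix x y assume "x \<in> V" "y \<in> V"
    then obtain u v where uv: "u \<in> group_algebra n" "v \<in> group_algebra n" "x = conv n u c" "y = conv n v c"
      unfolding V by auto
    have "conv n (u + v) c = x + y" using uv by (simp add: conv_def fun_eq_iff algebra_simps sum.distrib)
    moreover have "u + v \<in> group_algebra n" using uv by (simp add: group_algebra_def)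
    ultimately show "x + y \<in> V" unfolding V by (metis image_eqI)
  next
    fix k x assume "x \<in> V"
    then obtain u where uv: "u \<in> group_algebra n" "x = conv n u c" unfolding V by auto
    have "conv n (fun_scale k u) c = fun_scale k x" using uv 
      by (simp add: conv_def fun_eq_iff fun_scale_def sum_distrib_left mult.assoc)
    moreover have "fun_scale k u \<in> group_algebra n" using uv by (simp add: group_algebra_def fun_scale_def)
    ultimately show "fun_scale k x \<in> V" unfolding V by (metis image_eqI)
  qed
  define D where "D = (\<lambda>q. (\<lambda>p. c (inv_into UNIV q \<circ> p))) ` Sym n"
  have finD: "finite D" by (simp add: D_def finite_Sym)
  have "V \<subseteq> galg.span D"
  proof
    fix x assume "x \<in> V"
    then obtain u where u: "x = conv n u c" unfolding V by auto
    have "x = (\<Sum>q\<in>Sym n. fun_scale (u q) (\<lambda>p. c (inv_into UNIV q \<circ> p)))"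
      by (simp add: u conv_def fun_eq_iff sum_galg_apply fun_scale_def)
    moreover have "\<dots> \<in> galg.span D" by (rule galg.span_sum, rule galg.span_scale, rule galg.span_base) (auto simp: D_def)
    ultimately show "x \<in> galg.span D" by simp
  qed
  obtain B where B: "B \<subseteq> V" "galg.independent B" "V \<subseteq> galg.span B" 
    using galg.basis_exists[of V] by metis
  have spB: "galg.span B = V" using B sub by (metis galg.span_minimal subset_antisym)
  have "finite B"
    using galg.independent_span_bound[OF finD B(2)] B(1) \<open>V \<subseteq> galg.span D\<close> by blast
  then obtain bs where bs: "set bs = B" "distinct bs" using finite_distinct_list by blast
  have act: "translate g x \<in> V" if g: "g \<in> Sym n" and x: "x \<in> V" for g x
  proof -
    obtain u where u: "u \<in> group_algebra n" "x = conv n u c" using x unfolding V by auto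
    have gp: "g permutes {1..n}" using g by (simp add: sym_group_def)
    have ex: "translate g u \<in> group_algebra n"
      unfolding group_algebra_def translate_def
    proof (clarify)
      fix p assume "p \<notin> Sym n"
      then have "inv_into UNIV g \<circ> p \<notin> Sym n" 
        using gp permutes_compose[of "inv_into UNIV g \<circ> p" "{1..n}" g]
        by (auto simp: sym_group_def o_assoc permutes_inv_o)
      then show "u (inv_into UNIV g \<circ> p) = 0" using u by (simp add: group_algebra_def)
    qed
    have "conv n (translate g u) c = translate g x"
    proof
      fix p
      have bij: "bij_betw (\<lambda>q. g \<circ> q) (Sym n) (Sym n)"
        using gp by (intro bij_betwI[of _ _ _ "\<lambda>q. inv_into UNIV g \<circ> q"])
          (auto simp: sym_group_def o_assoc permutes_inv_o permutes_compose permutes_inv)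
      have "conv n (translate g u) c p = (\<Sum>q\<in>Sym n. translate g u (g \<circ> q) * c (inv_into UNIV (g \<circ> q) \<circ> p))"
        unfolding conv_def by (rule sum.reindex_bij_betw[OF bij, symmetric])
      also have "\<dots> = translate g x p"
        unfolding u translate_def conv_def
      proof (rule sum.cong[OF refl])
        fix q assume "q \<in> Sym n"
        then have "q permutes {1..n}" by (simp add: sym_group_def)
        then have "inv_into UNIV (g \<circ> q) = inv_into UNIV q \<circ> inv_into UNIV g"
          using gp by (intro o_inv_distrib) (auto simp: permutes_bij)
        then show "u (inv_into UNIV g \<circ> (g \<circ> q)) * c (inv_into UNIV (g \<circ> q) \<circ> p) =
          u q * c (inv_into UNIV q \<circ> (inv_into UNIV g \<circ> p))"
          using gp by (simp add: o_assoc permutes_inv_o)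
      qed
      finally show "conv n (translate g u) c p = translate g x p" .
    qed
    then show ?thesis using ex unfolding V by (metis image_eqI)
  qed
  define \<rho> :: matrep where "\<rho> = (\<lambda>g. mat (length bs) (length bs) 
     (\<lambda>(i,j). galg.representation B (translate g (bs ! j)) (bs ! i)))"
  have "matrix_form n V \<rho>"
    unfolding matrix_form_def
  proof (intro exI[of _ bs] conjI ballI allI impI)
    fix g j assume g: "g \<in> Sym n" and j: "j < length bs"
    have "translate g (bs ! j) \<in> galg.span B" using act[OF g] spB bs j galg.span_base by (metis nth_mem)
    then have "translate g (bs ! j) = (\<Sum>b\<in>B. fun_scale (galg.representation B (translate g (bs ! j)) b) b)"
      using galg.sum_representation_eq[OF B(2) _ \<open>finite B\<close>] by simp
    also have "\<dots> = (\<Sum>i<length bs. fun_scale (galg.representation B (translate g (bs ! j)) (bs!i)) (bs!i))"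
      using bs by (intro sum.reindex_bij_betw[symmetric] bij_betw_nth) auto
    finally show "translate g (bs ! j) = (\<Sum>i<length bs. fun_scale (\<rho> g $$ (i, j)) (bs ! i))"
      using j by (simp add: \<rho>_def)
  qed (use bs B spB in \<open>auto simp: \<rho>_def\<close>)
  then show ?thesis unfolding specht_rep_def V_def n_def
    by (rule someI[where P = "matrix_form (sum_list \<mu>) (specht_module \<mu>)"])
qed

definition specht_dim :: "nat list \<Rightarrow> nat" where
  "specht_dim \<mu> = galg.dim (specht_module \<mu>)"


section \<open>Random partitions\<close>

lemma finite_nonempty_partitions: "finite (partitions n) \<and> partitions n \<noteq> {}"
proof
  have "partitions n \<subseteq> {xs. set xs \<subseteq> {..n} \<and> length xs \<le> n}"
  proof clarify
    fix xs assume "xs \<in> partitions n"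
    then have a: "0 \<notin> set xs" "sum_list xs = n" by (auto simp: partitions_def)
    have "length xs \<le> sum_list xs" using a(1) by (induction xs) auto
    then show "set xs \<subseteq> {..n} \<and> length xs \<le> n" using a member_le_sum_list by auto
  qed
  then show "finite (partitions n)" using finite_lists_length_le[of "{..n}" n] finite_subset by blast
  have "replicate n 1 \<in> partitions n" by (simp add: partitions_def sum_list_replicate sorted_wrt_iff_nth_less)
  then show "partitions n \<noteq> {}" by blast
qed

definition plancherel_law :: "nat \<Rightarrow> nat list pmf \<Rightarrow> bool" where
  "plancherel_law n P \<longleftrightarrow>
     (\<forall>\<mu>. pmf P \<mu> = (if \<mu> \<in> partitions n then real (specht_dim \<mu>) ^ 2 / fact n else 0))"

definition uniform_law :: "nat \<Rightarrow> nat list pmf \<Rightarrow> bool" where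
  "uniform_law n P \<longleftrightarrow> P = pmf_of_set (partitions n)"

text \<open>
  A coupling of \<open>k\<close> random partitions is given by its joint law: a probability mass function
  on lists \<open>[\<mu>\<^sub>1, \<dots>, \<mu>\<^sub>k]\<close>, whose marginal laws all satisfy \<open>law\<close>.
\<close>

definition coupling :: "nat \<Rightarrow> (nat list pmf \<Rightarrow> bool) \<Rightarrow> nat list list pmf \<Rightarrow> bool" where
  "coupling k law J \<longleftrightarrow>
     (\<forall>ls\<in>set_pmf J. length ls = k) \<and> (\<forall>i<k. law (map_pmf (\<lambda>ls. ls ! i) J))"

end

theory Submission
  imports Defs "HOL-Combinatorics.Orbits" "HOL-Real_Asymp.Real_Asymp"
begin

text \<open>
  Let \<open>\<psi>(g)\<close> be the normalized character of a partition: the average of the Young symmetrizer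
  over the conjugates of \<open>g\<close>.  If the sum over \<open>g \<noteq> 1\<close> of the products \<open>\<Prod>\<bar>\<psi>\<^sub>i(g)\<bar>\<close> is less than \<open>1\<close>, then the
  tensor product contains every irreducible representation.  As there are at most \<open>n\<^bsup>2m\<^esup>\<close>
  permutations with support of size \<open>m\<close>, a bound \<open>\<bar>\<psi>(g)\<bar> \<le> n\<^bsup>-\<epsilon>m\<^esup>\<close> for a typical partition suffices, and
  the union bound makes the coupling irrelevant.

  For the Plancherel measure, \<open>\<psi>(g)\<^sup>2\<close> has mean \<open>1/\<bar>C\<bar>\<close>, where \<open>C\<close> is the class of \<open>g\<close>, and Markov's
  inequality with a union over classes is enough.  For the uniform measure, all rows and columns
  are typically at most \<open>n\<^bsup>1/2+\<delta>\<^esup>\<close>.  If \<open>m\<close> is small, \<open>\<bar>\<psi>(g)\<bar>\<close> is at most the probability that a random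
  conjugate of \<open>g\<close> is a row permutation times a column permutation, which forces many coincidences
  between the positions of moved points.  If \<open>m\<close> is large, conjugate \<open>g\<close> into \<open>S\<^sub>m\<close> and restrict: the
  constituents again have short rows and columns, hence dimension at least \<open>(m/2eL)\<^sup>m\<close> (the
  group preserving the antidiagonals meets the row-times-column permutations trivially), while
  their character values at a fixed point free element are at most \<open>m\<^bsup>m/3\<^esup>\<close> by column orthogonality.
\<close>

text \<open>All character theory here grows from one extremal fact: a function on the group that is
  invariant under row permutations on the left and alternates under column permutations on the right
  is a multiple of the Young symmetrizer c. So every product c x c is a scalar times c, and
  orthogonality, the trace and the dimension of a Specht module follow by computing scalars. An
  irreducible representation enters as an arbitrary family of matrices that has to be embedded by an
  intertwiner.

  The obstacle is the uniform law, where no second moment of the character is at hand: a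
  deterministic bound must hold for every shape with short rows and columns. If these are at most L
  = n^a, the coincidence count works for supports of size m below n^(2 - 2a), where m L^2 / n^2 is
  small, and the dimension bound works above n^(3a/2), where L is below m^(2/3). These ranges
  overlap for a < 4/7, while the typical length of the longest row, slightly above n^(1/2), forces a
  > 1/2. The decay rate 1/100 is a convenient value inside the resulting margin.\<close>

declare One_nat_def [simp del]

section \<open>Young symmetrizers of tableaux\<close>

text \<open>One construction serves three times: applied to the row numbers it is the row group, to
  the column numbers the column group, and to their sum the group preserving the
  antidiagonals.\<close>

definition fibre_group :: "nat \<Rightarrow> (nat \<Rightarrow> nat) \<Rightarrow> (nat \<Rightarrow> nat) set" where
  "fibre_group n f = {p. p permutes {1..n} \<and> (\<forall>x\<in>{1..n}. f (p x) = f x)}"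

definition col_sign :: "nat \<Rightarrow> (nat \<Rightarrow> nat) \<Rightarrow> (nat \<Rightarrow> nat) \<Rightarrow> complex" where
  "col_sign n cl q = (if q \<in> fibre_group n cl then of_int (sign q) else 0)"

text \<open>The coefficient at g of the row sum times the signed column sum, for arbitrary
  labellings \<open>rw\<close> and \<open>cl\<close>. For the tableau in reading order it is the
  given Young symmetrizer, by \<open>young_symmetrizer_eq\<close>.\<close>

definition ysym :: "nat \<Rightarrow> (nat \<Rightarrow> nat) \<Rightarrow> (nat \<Rightarrow> nat) \<Rightarrow> (nat \<Rightarrow> nat) \<Rightarrow> complex" where
  "ysym n rw cl g = (\<Sum>r\<in>fibre_group n rw. col_sign n cl (inv' r \<circ> g))"

abbreviation perms :: "nat \<Rightarrow> (nat \<Rightarrow> nat) set" where "perms n \<equiv> {p. p permutes {1..n}}"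

lemma fibre_group_permutes: "p \<in> fibre_group n f \<Longrightarrow> p permutes {1..n}"
  by (simp add: fibre_group_def)

lemma fibre_group_fibre: "p \<in> fibre_group n f \<Longrightarrow> f (p x) = f x"
  by (cases "x \<in> {1..n}") (auto simp: fibre_group_def permutes_not_in)

lemma fibre_group_id: "id \<in> fibre_group n f"
  by (simp add: fibre_group_def permutes_id)

lemma fibre_group_comp: "p \<in> fibre_group n f \<Longrightarrow> q \<in> fibre_group n f \<Longrightarrow> p \<circ> q \<in> fibre_group n f"
  by (subst fibre_group_def) (auto simp: fibre_group_fibre intro!: permutes_compose dest: fibre_group_permutes)

lemma fibre_group_inv: 
  assumes p: "p \<in> fibre_group n f" shows "inv' p \<in> fibre_group n f"
proof -
  have "f (inv' p x) = f x" for x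
    using fibre_group_fibre[OF p, of "inv' p x"] permutes_inverses(1)[OF fibre_group_permutes[OF p]] by simp
  then show ?thesis using permutes_inv[OF fibre_group_permutes[OF p]] by (simp add: fibre_group_def)
qed

lemma finite_perms: "finite (perms n)" by (simp add: finite_permutations)

lemma finite_fibre_group: "finite (fibre_group n f)"
  by (rule finite_subset[OF _ finite_perms[of n]]) (auto simp: fibre_group_def)

lemma transpose_fibre_group:
  "a \<in> {1..n} \<Longrightarrow> b \<in> {1..n} \<Longrightarrow> f a = f b \<Longrightarrow> Transposition.transpose a b \<in> fibre_group n f"
  by (auto simp: fibre_group_def permutes_swap_id Transposition.transpose_def)

lemma fibre_group_comp_iff:
  assumes "p \<in> fibre_group n f"
  shows "p \<circ> q \<in> fibre_group n f \<longleftrightarrow> q \<in> fibre_group n f" "q \<circ> p \<in> fibre_group n f \<longleftrightarrow> q \<in> fibre_group n f"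
proof -
  have a: "inv' p \<circ> (p \<circ> q) = q" "(q \<circ> p) \<circ> inv' p = q"
    using permutes_inv_o[OF fibre_group_permutes[OF assms]] by (simp add: o_assoc, simp add: comp_assoc)
  show "p \<circ> q \<in> fibre_group n f \<longleftrightarrow> q \<in> fibre_group n f" "q \<circ> p \<in> fibre_group n f \<longleftrightarrow> q \<in> fibre_group n f"
    using a assms fibre_group_comp fibre_group_inv by metis+
qed

lemma sum_perms_left: "h permutes {1..n} \<Longrightarrow> (\<Sum>g\<in>perms n. F (h \<circ> g)) = (\<Sum>g\<in>perms n. F g)"
  using setum_permutations_compose_left[of h "{1..n}" F] by simp

lemma sum_perms_right: "h permutes {1..n} \<Longrightarrow> (\<Sum>g\<in>perms n. F (g \<circ> h)) = (\<Sum>g\<in>perms n. F g)"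
  using sum_permutations_compose_right[of h "{1..n}" F] by simp

lemma sum_perms_inv: "(\<Sum>g\<in>perms n. F (inv' g)) = (\<Sum>g\<in>perms n. F g)"
  using sum_permutations_inverse[of F "{1..n}"] by simp

lemma comp_cancel:
  assumes "p permutes A"
  shows "p \<circ> inv' p = id" "inv' p \<circ> p = id" "p \<circ> (inv' p \<circ> x) = x" "inv' p \<circ> (p \<circ> x) = x"
    "inv' (inv' p) = p" "p (inv' p y) = y" "inv' p (p y) = y"
  using assms permutes_inv_o[OF assms] permutes_inv_inv[OF assms] permutes_inverses[OF assms]
  by (auto simp: fun_eq_iff)

lemma inv_comp:
  assumes "p permutes A" "q permutes B"
  shows "inv' (p \<circ> q) = inv' q \<circ> inv' p"
  using assms by (intro o_inv_distrib) (auto simp: permutes_bij)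

lemma sum_fibre_left:
  assumes h: "h \<in> fibre_group n f"
  shows "(\<Sum>g\<in>fibre_group n f. F (h \<circ> g)) = (\<Sum>g\<in>fibre_group n f. F g)"
  by (rule sum.reindex_bij_witness[of _ "\<lambda>g. inv' h \<circ> g" "\<lambda>g. h \<circ> g"])
     (use h fibre_group_permutes[OF h] in \<open>auto simp: comp_cancel fibre_group_comp fibre_group_inv\<close>)

lemma sum_perms_conj:
  assumes h: "h permutes {1..n}"
  shows "(\<Sum>g\<in>perms n. F (h \<circ> g \<circ> inv' h)) = (\<Sum>g\<in>perms n. F g)"
  using sum_perms_left[OF h, of "\<lambda>g. F (g \<circ> inv' h)"] sum_perms_right[OF permutes_inv[OF h], of F]
  by simp

lemma col_sign_right:
  assumes "q \<in> fibre_group n cl" 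
  shows "col_sign n cl (g \<circ> q) = of_int (sign q) * col_sign n cl g"
proof (cases "g \<in> fibre_group n cl")
  case True
  have "permutation g" "permutation q" using True assms 
    by (meson fibre_group_permutes finite_atLeastAtMost permutation_permutes)+
  then show ?thesis using True assms by (simp add: col_sign_def fibre_group_comp sign_compose)
next
  case False
  then show ?thesis using assms by (simp add: col_sign_def fibre_group_comp_iff)
qed

lemma col_sign_left:
  assumes "q \<in> fibre_group n cl" 
  shows "col_sign n cl (q \<circ> g) = of_int (sign q) * col_sign n cl g"
proof (cases "g \<in> fibre_group n cl")
  case True
  have "permutation g" "permutation q" using True assms 
    by (meson fibre_group_permutes finite_atLeastAtMost permutation_permutes)+
  then show ?thesis using True assms by (simp add: col_sign_def fibre_group_comp sign_compose)
next
  case False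
  then show ?thesis using assms by (simp add: col_sign_def fibre_group_comp_iff)
qed

lemma ysym_left:
  assumes p: "p \<in> fibre_group n rw"
  shows "ysym n rw cl (p \<circ> g) = ysym n rw cl g"
proof -
  have "ysym n rw cl (p \<circ> g) = (\<Sum>r\<in>fibre_group n rw. col_sign n cl (inv' (p \<circ> r) \<circ> (p \<circ> g)))"
    unfolding ysym_def by (rule sum_fibre_left[OF p, symmetric])
  also have "\<dots> = (\<Sum>r\<in>fibre_group n rw. col_sign n cl (inv' r \<circ> g))"
    using fibre_group_permutes[OF p] 
    by (intro sum.cong refl) (simp add: inv_comp[OF _ fibre_group_permutes] comp_assoc comp_cancel)
  finally show ?thesis by (simp add: ysym_def)
qed

lemma ysym_right:
  assumes q: "q \<in> fibre_group n cl"
  shows "ysym n rw cl (g \<circ> q) = of_int (sign q) * ysym n rw cl g"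
  by (simp add: ysym_def o_assoc col_sign_right[OF q] sum_distrib_left)

section \<open>Row numbers in a column, and factorization into row and column permutations\<close>

lemma sum_lessThan_le_aux:
  "finite A \<Longrightarrow> card A = k \<Longrightarrow> \<Sum>{..<k} \<le> \<Sum>A \<and> (\<Sum>A \<le> \<Sum>{..<k} \<longrightarrow> A = {..<k})" for A :: "nat set"
proof (induction k arbitrary: A)
  case 0 then show ?case by simp
next
  case (Suc k)
  define m where "m = Max A"
  have "A \<noteq> {}" using Suc.prems by auto
  then have mA: "m \<in> A" using Suc.prems by (simp add: m_def)
  have sub: "A \<subseteq> {..m}" using Suc.prems by (auto simp: m_def)
  have "card A \<le> Suc m" using card_mono[OF _ sub] by simp
  then have mk: "k \<le> m" using Suc.prems by simp
  have cB: "card (A - {m}) = k" using Suc.prems mA by simp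
  have IH: "\<Sum>{..<k} \<le> \<Sum>(A - {m})" "\<Sum>(A - {m}) \<le> \<Sum>{..<k} \<Longrightarrow> A - {m} = {..<k}"
    using Suc.IH[OF finite_Diff[OF Suc.prems(1)] cB] by (rule conjunct1, intro mp[OF conjunct2[OF Suc.IH[OF finite_Diff[OF Suc.prems(1)] cB]]])
  have s: "\<Sum>A = m + \<Sum>(A - {m})" by (rule sum.remove[OF Suc.prems(1) mA])
  have le: "\<Sum>{..<Suc k} \<le> \<Sum>A" using IH(1) mk unfolding s sum.lessThan_Suc by linarith
  have "A = {..<Suc k}" if "\<Sum>A \<le> \<Sum>{..<Suc k}"
  proof -
    have mk': "m = k" and l: "\<Sum>(A - {m}) \<le> \<Sum>{..<k}"
      using s IH(1) mk that by (simp_all del: sum_diff1_nat)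
    have "A = insert m (A - {m})" using mA by (rule insert_Diff[symmetric])
    then show ?thesis unfolding IH(2)[OF l] lessThan_Suc using mk' by metis
  qed
  then show ?case using le by blast
qed

lemmas sum_lessThan_le = sum_lessThan_le_aux[OF _ refl]

text \<open>A filling of a Young diagram, stored as the row and the column of each entry;
  \<open>young\<close> closes the set of occupied cells under moving up and left. Row lengths stay
  implicit, so that shapes are compared through their entries alone.\<close>

locale tableau =
  fixes n :: nat and rw cl :: "nat \<Rightarrow> nat"
  assumes inj: "inj_on (\<lambda>x. (rw x, cl x)) {1..n}"
    and young: "\<And>x i j. x \<in> {1..n} \<Longrightarrow> i \<le> rw x \<Longrightarrow> j \<le> cl x \<Longrightarrow> \<exists>y\<in>{1..n}. rw y = i \<and> cl y = j"
begin

lemma column_rows: "rw ` {x\<in>{1..n}. cl x = j} = {..<card {x\<in>{1..n}. cl x = j}}"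
proof -
  let ?F = "{x\<in>{1..n}. cl x = j}"
  have injF: "inj_on rw ?F" by (rule inj_onI, rule inj_onD[OF inj]) auto
  have down: "i' \<in> rw ` ?F" if i: "i \<in> rw ` ?F" "i' \<le> i" for i i'
  proof -
    obtain x where x: "x \<in> {1..n}" "cl x = j" "i = rw x" using i(1) by blast
    obtain y where "y \<in> {1..n}" "rw y = i'" "cl y = j" using young[OF x(1), of i' j] x i(2) by blast
    then show ?thesis by blast
  qed
  define h where "h = (LEAST i. i \<notin> rw ` ?F)"
  have fin: "finite (rw ` ?F)" by simp
  have hn: "h \<notin> rw ` ?F" unfolding h_def by (rule LeastI_ex) (use fin ex_new_if_finite infinite_UNIV_nat in blast)
  have "rw ` ?F = {..<h}"
  proof (intro equalityI subsetI)
    fix i assume "i \<in> rw ` ?F" then show "i \<in> {..<h}" using down[of i h] hn by (cases "h \<le> i") auto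
  next
    fix i assume "i \<in> {..<h}" then show "i \<in> rw ` ?F" using not_less_Least[of i] h_def by blast
  qed
  moreover from this have "h = card ?F" using card_image[OF injF] by simp
  ultimately show ?thesis by simp
qed

lemma sum_by_columns: "(\<Sum>x\<in>{1..n}. f x) = (\<Sum>j\<in>cl ` {1..n}. \<Sum>x\<in>{x\<in>{1..n}. cl x = j}. f x)"
  for f :: "nat \<Rightarrow> nat"
  by (rule sum.image_gen) simp

text \<open>In each column \<open>rw\<close> takes the values of an initial segment, and k distinct
  numbers have the least sum exactly when they are 0, ..., k - 1. So a labelling \<rho> that is
  injective on columns has at least the total of \<open>rw\<close>, and equal totals force the same
  values in every column.\<close>

lemma sum_rows_le:
  assumes "inj_on (\<lambda>x. (\<rho> x, cl x)) {1..n}"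
  shows "(\<Sum>x\<in>{1..n}. rw x) \<le> (\<Sum>x\<in>{1..n}. \<rho> x)"
    and "(\<Sum>x\<in>{1..n}. \<rho> x) \<le> (\<Sum>x\<in>{1..n}. rw x) \<Longrightarrow>
      (\<lambda>x. (\<rho> x, cl x)) ` {1..n} = (\<lambda>x. (rw x, cl x)) ` {1..n}"
proof -
  let ?F = "\<lambda>j. {x\<in>{1..n}. cl x = j}"
  have inj1: "inj_on rw (?F j)" "inj_on \<rho> (?F j)" for j
    by (rule inj_onI, rule inj_onD[OF inj]; simp) (rule inj_onI, rule inj_onD[OF assms]; simp)
  have r: "(\<Sum>x\<in>?F j. rw x) = \<Sum>{..<card (?F j)}" for j
    using sum.reindex[OF inj1(1)[of j], of "\<lambda>x. x"] column_rows[of j] by simp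
  have s: "(\<Sum>x\<in>?F j. \<rho> x) = \<Sum>(\<rho> ` ?F j)" for j
    using sum.reindex[OF inj1(2)[of j], of "\<lambda>x. x"] by simp
  have c: "card (\<rho> ` ?F j) = card (?F j)" for j by (rule card_image[OF inj1(2)])
  have le: "(\<Sum>x\<in>?F j. rw x) \<le> (\<Sum>x\<in>?F j. \<rho> x)" for j
    using sum_lessThan_le[of "\<rho> ` ?F j"] by (simp only: r s c) simp
  show "(\<Sum>x\<in>{1..n}. rw x) \<le> (\<Sum>x\<in>{1..n}. \<rho> x)"
    unfolding sum_by_columns by (rule sum_mono) (rule le)
  assume "(\<Sum>x\<in>{1..n}. \<rho> x) \<le> (\<Sum>x\<in>{1..n}. rw x)"
  then have eqs: "(\<Sum>j\<in>cl ` {1..n}. \<Sum>x\<in>?F j. \<rho> x) \<le> (\<Sum>j\<in>cl ` {1..n}. \<Sum>x\<in>?F j. rw x)"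
    unfolding sum_by_columns .
  have "\<rho> ` ?F j = rw ` ?F j" if "j \<in> cl ` {1..n}" for j
  proof -
    have "(\<Sum>x\<in>?F j. \<rho> x) \<le> (\<Sum>x\<in>?F j. rw x)"
    proof (rule ccontr)
      assume gt: "\<not> (\<Sum>x\<in>?F j. \<rho> x) \<le> (\<Sum>x\<in>?F j. rw x)"
      have "(\<Sum>j\<in>cl ` {1..n}. \<Sum>x\<in>?F j. rw x) < (\<Sum>j\<in>cl ` {1..n}. \<Sum>x\<in>?F j. \<rho> x)"
      proof (rule sum_strict_mono_ex1)
        show "\<forall>j\<in>cl ` {1..n}. (\<Sum>x\<in>?F j. rw x) \<le> (\<Sum>x\<in>?F j. \<rho> x)" by (rule ballI) (rule le)
        show "\<exists>j\<in>cl ` {1..n}. (\<Sum>x\<in>?F j. rw x) < (\<Sum>x\<in>?F j. \<rho> x)"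
          using gt by (intro bexI[OF _ that]) (simp only: not_le)
      qed simp
      then show False using eqs by simp
    qed
    then have "\<rho> ` ?F j = {..<card (\<rho> ` ?F j)}"
      using sum_lessThan_le[of "\<rho> ` ?F j"] by (simp only: r s c) simp
    then show ?thesis using column_rows c by metis
  qed
  then have im: "\<rho> ` ?F j = rw ` ?F j" for j by (cases "j \<in> cl ` {1..n}") auto
  have "(\<lambda>x. (f x, cl x)) ` {1..n} = (\<Union>j. (\<lambda>i. (i, j)) ` f ` ?F j)" for f by (auto simp: image_iff)
  from this[of \<rho>] this[of rw] show "(\<lambda>x. (\<rho> x, cl x)) ` {1..n} = (\<lambda>x. (rw x, cl x)) ` {1..n}"
    by (simp only: im)
qed

lemma fibre_groups_trivial:
  assumes "p \<in> fibre_group n rw" "p \<in> fibre_group n cl" shows "p = id"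
proof
  fix x
  have "p permutes {1..n}" using assms fibre_group_permutes by blast
  then show "p x = id x"
    using inj_onD[OF inj, of "p x" x] fibre_group_fibre[OF assms(1), of x] fibre_group_fibre[OF assms(2), of x]
      permutes_in_image[of p "{1..n}" x] permutes_not_in[of p "{1..n}" x]
    by (cases "x \<in> {1..n}") (simp_all del: atLeastAtMost_iff)
qed

text \<open>As g permutes the points, \<open>rw (g x)\<close> and \<open>rw x\<close> have the same
  total, and the equality case of \<open>sum_rows_le\<close> shows that every pair (row of g x,
  column of x) is a cell of the shape. Sending x to the entry of that cell gives q, and p = g q^-1
  preserves rows.\<close>

lemma factorize:
  assumes g: "g permutes {1..n}" and ig: "inj_on (\<lambda>x. (rw (g x), cl x)) {1..n}"
  obtains p q where "p \<in> fibre_group n rw" "q \<in> fibre_group n cl" "g = p \<circ> q"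
proof -
  have "(\<Sum>x\<in>{1..n}. rw (g x)) = (\<Sum>x\<in>{1..n}. rw x)"
    using sum.permute[OF g, of rw] by (simp add: comp_def)
  then have im: "(\<lambda>x. (rw (g x), cl x)) ` {1..n} = (\<lambda>x. (rw x, cl x)) ` {1..n}"
    using sum_rows_le(2)[OF ig] by simp
  define e where "e = inv_into {1..n} (\<lambda>x. (rw x, cl x))"
  define q where "q x = (if x \<in> {1..n} then e (rw (g x), cl x) else x)" for x
  have q: "q x \<in> {1..n}" "rw (q x) = rw (g x)" "cl (q x) = cl x" if "x \<in> {1..n}" for x
  proof -
    have m: "(rw (g x), cl x) \<in> (\<lambda>x. (rw x, cl x)) ` {1..n}" using im that by blast
    show "q x \<in> {1..n}" using inv_into_into[OF m] that by (simp add: q_def e_def)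
    show "rw (q x) = rw (g x)" "cl (q x) = cl x" using f_inv_into_f[OF m] that by (simp_all add: q_def e_def)
  qed
  have "inj_on q {1..n}" 
  proof (rule inj_onI)
    fix x y assume "x \<in> {1..n}" "y \<in> {1..n}" "q x = q y"
    then show "x = y" using q[of x] q[of y] inj_onD[OF ig, of x y] by auto
  qed
  then have qp: "q permutes {1..n}" 
    by (intro inj_imp_permutes) (use q in \<open>auto simp: q_def\<close>)
  have qC: "q \<in> fibre_group n cl" using q qp by (auto simp: fibre_group_def)
  define p where "p = g \<circ> inv' q"
  have "rw (p y) = rw y" if "y \<in> {1..n}" for y
  proof -
    have "inv' q y \<in> {1..n}" using permutes_in_image[OF permutes_inv[OF qp]] that by blast
    then show ?thesis using q(2)[of "inv' q y"] by (simp add: p_def comp_cancel(6)[OF qp])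
  qed
  then have "p \<in> fibre_group n rw" using permutes_compose[OF permutes_inv[OF qp] g] by (simp add: fibre_group_def p_def)
  moreover have "g = p \<circ> q" by (simp add: p_def comp_assoc comp_cancel[OF qp])
  ultimately show ?thesis using that qC by blast
qed

text \<open>A permutation preserving rows and columns is the identity, so the coefficient at the
  identity comes from a single summand and is 1. The two symmetries carry this value to p q.\<close>

lemma ysym_prod:
  assumes p: "p \<in> fibre_group n rw" and q: "q \<in> fibre_group n cl"
  shows "ysym n rw cl (p \<circ> q) = of_int (sign q)"
proof -
  have "ysym n rw cl id = (\<Sum>r\<in>fibre_group n rw. if r = id then 1 else 0)"
    unfolding ysym_def
  proof (intro sum.cong refl)
    fix r assume r: "r \<in> fibre_group n rw"
    have "inv' r = id \<Longrightarrow> r = id" using comp_cancel(5)[OF fibre_group_permutes[OF r]] inv_id by metis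
    then show "col_sign n cl (inv' r \<circ> id) = (if r = id then 1 else 0)"
      using fibre_groups_trivial[OF fibre_group_inv[OF r]] by (auto simp: col_sign_def inv_id fibre_group_id)
  qed
  also have "\<dots> = 1" by (simp add: sum.delta finite_fibre_group fibre_group_id)
  finally have "ysym n rw cl id = 1" .
  then show ?thesis using ysym_left[OF p] ysym_right[OF q, of rw id] by simp
qed

lemma ysym_id: "ysym n rw cl id = 1"
  using ysym_prod[OF fibre_group_id fibre_group_id] by simp

lemma ysym_nonzero:
  assumes "ysym n rw cl g \<noteq> 0"
  obtains p q where "p \<in> fibre_group n rw" "q \<in> fibre_group n cl" "g = p \<circ> q"
proof -
  obtain r where r: "r \<in> fibre_group n rw" "col_sign n cl (inv' r \<circ> g) \<noteq> 0"
    using assms unfolding ysym_def by (meson sum.not_neutral_contains_not_neutral)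
  then have "inv' r \<circ> g \<in> fibre_group n cl" by (auto simp: col_sign_def split: if_splits)
  moreover have "g = r \<circ> (inv' r \<circ> g)" by (rule comp_cancel(3)[OF fibre_group_permutes[OF r(1)], symmetric])
  ultimately show ?thesis using that r(1) by blast
qed

lemma ysym_cases: "ysym n rw cl g \<in> {0, 1, -1}"
proof (cases "ysym n rw cl g = 0")
  case False
  then obtain p q where "p \<in> fibre_group n rw" "q \<in> fibre_group n cl" "g = p \<circ> q" by (rule ysym_nonzero)
  then show ?thesis using ysym_prod by (cases q rule: sign_cases) auto
qed simp

end

text \<open>Two points of one column that \<open>g\<close> sends to one row give a transposition under which \<open>f g\<close> is
  both even and odd.\<close>

lemma symmetrized_eq_0:
  fixes f :: "(nat \<Rightarrow> nat) \<Rightarrow> complex"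
  assumes l: "\<And>p g. p \<in> fibre_group n rw \<Longrightarrow> f (p \<circ> g) = f g"
    and r: "\<And>q g. q \<in> fibre_group n cl \<Longrightarrow> f (g \<circ> q) = of_int (sign q) * f g"
    and g: "g permutes {1..n}" and ni: "\<not> inj_on (\<lambda>x. (rw (g x), cl x)) {1..n}"
  shows "f g = 0"
proof -
  obtain x y where xy: "x \<in> {1..n}" "y \<in> {1..n}" "x \<noteq> y" "rw (g x) = rw (g y)" "cl x = cl y"
    using ni by (auto simp: inj_on_def)
  have "g \<circ> Transposition.transpose x y = Transposition.transpose (g x) (g y) \<circ> g"
    using permutes_inj[OF g] by (auto simp: fun_eq_iff Transposition.transpose_def inj_eq)
  then have "f (g \<circ> Transposition.transpose x y) = f g"
    using l[OF transpose_fibre_group[of "g x" n "g y" rw]] xy permutes_in_image[OF g] by simp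
  moreover have "f (g \<circ> Transposition.transpose x y) = - f g"
    using r[OF transpose_fibre_group[OF xy(1,2,5)]] xy(3) by (simp add: sign_swap_id)
  ultimately show ?thesis by simp
qed

text \<open>The classical lemma behind Young symmetrizers: functions with this two-sided symmetry
  form a line. On a product p q they are determined by their value at the identity; at all other
  permutations both f and the symmetrizer vanish by \<open>symmetrized_eq_0\<close>.\<close>

lemma (in tableau) symmetrized_eq:
  fixes f :: "(nat \<Rightarrow> nat) \<Rightarrow> complex"
  assumes l: "\<And>p g. p \<in> fibre_group n rw \<Longrightarrow> f (p \<circ> g) = f g"
    and r: "\<And>q g. q \<in> fibre_group n cl \<Longrightarrow> f (g \<circ> q) = of_int (sign q) * f g"
    and g: "g permutes {1..n}"
  shows "f g = f id * ysym n rw cl g"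
proof (cases "inj_on (\<lambda>x. (rw (g x), cl x)) {1..n}")
  case True
  then obtain p q where pq: "p \<in> fibre_group n rw" "q \<in> fibre_group n cl" "g = p \<circ> q" by (rule factorize[OF g])
  then show ?thesis using ysym_prod[OF pq(1,2)] l[OF pq(1)] r[OF pq(2), of id] by simp
next
  case False
  have "f g = 0" by (rule symmetrized_eq_0[of n rw f cl, OF l r g False])
  moreover have "ysym n rw cl g = 0"
    by (rule symmetrized_eq_0[of n rw "ysym n rw cl" cl, OF ysym_left ysym_right g False])
  ultimately show ?thesis by simp
qed

section \<open>The central element attached to a Young symmetrizer\<close>

text \<open>By \<open>trace_scaled\<close> this is n! / dim times the character of the Specht
  module. Building it from the symmetrizer makes orthogonality between shapes accessible before any
  representation is chosen.\<close>

definition class_sum :: "nat \<Rightarrow> (nat \<Rightarrow> nat) \<Rightarrow> (nat \<Rightarrow> nat) \<Rightarrow> (nat \<Rightarrow> nat) \<Rightarrow> complex" where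
  "class_sum n rw cl g = (\<Sum>h\<in>perms n. ysym n rw cl (inv' h \<circ> g \<circ> h))"

text \<open>The value at the identity of the convolution square of the symmetrizer c, hence the
  scalar in c c = \<kappa> c. In \<open>scalar_eq\<close> it turns out to be n! / dim.\<close>

definition ysym_scalar :: "nat \<Rightarrow> (nat \<Rightarrow> nat) \<Rightarrow> (nat \<Rightarrow> nat) \<Rightarrow> complex" where
  "ysym_scalar n rw cl = (\<Sum>q\<in>perms n. ysym n rw cl q * ysym n rw cl (inv' q))"

lemma class_sum_conj:
  assumes h: "h permutes {1..n}"
  shows "class_sum n rw cl (h \<circ> g \<circ> inv' h) = class_sum n rw cl g"
proof -
  have "class_sum n rw cl (h \<circ> g \<circ> inv' h) = (\<Sum>k\<in>perms n. ysym n rw cl (inv' (h \<circ> k) \<circ> (h \<circ> g \<circ> inv' h) \<circ> (h \<circ> k)))"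
    unfolding class_sum_def by (rule sum_perms_left[OF h, symmetric])
  also have "\<dots> = class_sum n rw cl g"
    unfolding class_sum_def
    by (intro sum.cong refl) (simp add: inv_comp[OF h] comp_assoc comp_cancel[OF h])
  finally show ?thesis .
qed

lemma col_sign_inv:
  assumes "g permutes {1..n}"
  shows "col_sign n cl (inv' g) = col_sign n cl g"
proof -
  have "inv' g \<in> fibre_group n cl \<longleftrightarrow> g \<in> fibre_group n cl"
    using fibre_group_inv comp_cancel(5)[OF assms] by metis
  moreover have "sign (inv' g) = sign g"
    using assms by (intro sign_inverse) (auto simp: permutation_permutes)
  ultimately show ?thesis by (simp add: col_sign_def)
qed

text \<open>Inversion turns a row factor times a column factor into a column factor times a row
  factor. Conjugation by the row factor restores the order, and the sum over all h absorbs this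
  conjugation.\<close>

lemma class_sum_inv:
  assumes g: "g permutes {1..n}"
  shows "class_sum n rw cl (inv' g) = class_sum n rw cl g"
proof -
  let ?R = "fibre_group n rw"
  have "class_sum n rw cl (inv' g) = (\<Sum>h\<in>perms n. \<Sum>r\<in>?R. col_sign n cl (inv' r \<circ> (inv' h \<circ> inv' g \<circ> h)))"
    by (simp add: class_sum_def ysym_def)
  also have "\<dots> = (\<Sum>h\<in>perms n. \<Sum>r\<in>?R. col_sign n cl (inv' h \<circ> g \<circ> h \<circ> r))"
  proof (intro sum.cong refl)
    fix h r assume "h \<in> perms n" and r: "r \<in> ?R"
    then have h: "h permutes {1..n}" by simp
    note r = fibre_group_permutes[OF r]
    have x: "(inv' h \<circ> g \<circ> h \<circ> r) permutes {1..n}" by (intro permutes_compose permutes_inv g h r)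
    have "inv' (inv' h \<circ> g \<circ> h \<circ> r) = inv' r \<circ> (inv' h \<circ> inv' g \<circ> h)"
      using g h r by (simp add: inv_comp[of _ "{1..n}" _ "{1..n}"] permutes_compose permutes_inv comp_cancel[OF h] comp_assoc)
    then show "col_sign n cl (inv' r \<circ> (inv' h \<circ> inv' g \<circ> h)) = col_sign n cl (inv' h \<circ> g \<circ> h \<circ> r)"
      using col_sign_inv[OF x] by simp
  qed
  also have "\<dots> = (\<Sum>r\<in>?R. \<Sum>h\<in>perms n. col_sign n cl (inv' h \<circ> g \<circ> h \<circ> r))" by (rule sum.swap)
  also have "\<dots> = (\<Sum>r\<in>?R. \<Sum>h\<in>perms n. col_sign n cl (r \<circ> (inv' h \<circ> g \<circ> h)))"
  proof (rule sum.cong[OF refl])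
    fix r assume "r \<in> ?R"
    then have r: "r permutes {1..n}" by (rule fibre_group_permutes)
    have "(\<Sum>h\<in>perms n. col_sign n cl (r \<circ> (inv' h \<circ> g \<circ> h))) =
      (\<Sum>h\<in>perms n. col_sign n cl (r \<circ> (inv' (h \<circ> r) \<circ> g \<circ> (h \<circ> r))))"
      by (rule sum_perms_right[OF r, symmetric])
    also have "\<dots> = (\<Sum>h\<in>perms n. col_sign n cl (inv' h \<circ> g \<circ> h \<circ> r))"
      by (intro sum.cong refl) (simp add: inv_comp[OF _ r] comp_assoc comp_cancel[OF r])
    finally show "(\<Sum>h\<in>perms n. col_sign n cl (inv' h \<circ> g \<circ> h \<circ> r)) = 
      (\<Sum>h\<in>perms n. col_sign n cl (r \<circ> (inv' h \<circ> g \<circ> h)))" by simp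
  qed
  also have "\<dots> = (\<Sum>r\<in>?R. \<Sum>h\<in>perms n. col_sign n cl (inv' r \<circ> (inv' h \<circ> g \<circ> h)))"
    by (rule sum.reindex_bij_witness[of _ "inv'" "inv'"])
       (auto simp: fibre_group_inv comp_cancel(5)[OF fibre_group_permutes])
  also have "\<dots> = class_sum n rw cl g" unfolding class_sum_def ysym_def by (rule sum.swap)
  finally show ?thesis .
qed

context tableau begin

text \<open>The convolution of c with v inherits row invariance on the left from c and the column
  signs on the right from v; by \<open>symmetrized_eq\<close> it is a multiple of c.\<close>

lemma ysym_mult:
  assumes v: "\<And>q g. q \<in> fibre_group n cl \<Longrightarrow> v (g \<circ> q) = of_int (sign q) * (v g :: complex)"
    and p: "p permutes {1..n}"
  shows "(\<Sum>u\<in>perms n. ysym n rw cl u * v (inv' u \<circ> p)) = (\<Sum>u\<in>perms n. ysym n rw cl u * v (inv' u)) * ysym n rw cl p"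
proof -
  define f where "f p = (\<Sum>u\<in>perms n. ysym n rw cl u * v (inv' u \<circ> p))" for p
  have l: "f (r \<circ> g) = f g" if r: "r \<in> fibre_group n rw" for r g
  proof -
    note rp = fibre_group_permutes[OF r]
    have "f (r \<circ> g) = (\<Sum>u\<in>perms n. ysym n rw cl (r \<circ> u) * v (inv' (r \<circ> u) \<circ> (r \<circ> g)))"
      unfolding f_def by (rule sum_perms_left[OF rp, symmetric])
    also have "\<dots> = f g" unfolding f_def
      by (intro sum.cong refl) (simp add: inv_comp[OF rp] comp_assoc comp_cancel[OF rp] ysym_left[OF r])
    finally show ?thesis .
  qed
  have r: "f (g \<circ> q) = of_int (sign q) * f g" if q: "q \<in> fibre_group n cl" for q g
    by (simp add: f_def o_assoc v[OF q] sum_distrib_left mult_ac)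
  show ?thesis using symmetrized_eq[of f, OF l r p] by (simp add: f_def)
qed

lemma ysym_square:
  "p permutes {1..n} \<Longrightarrow>
   (\<Sum>u\<in>perms n. ysym n rw cl u * ysym n rw cl (inv' u \<circ> p)) = ysym_scalar n rw cl * ysym n rw cl p"
  unfolding ysym_scalar_def by (rule ysym_mult[OF ysym_right])

text \<open>With \<open>c\<close> the Young symmetrizer and \<open>c h c = k\<^sub>h c\<close>, the sum equals \<open>\<Sum> k\<^sub>h c(h) = (c c c)(1)\<close>.\<close>

lemma class_sum_ysym_id:
  "(\<Sum>q\<in>perms n. class_sum n rw cl q * ysym n rw cl (inv' q)) = (ysym_scalar n rw cl)\<^sup>2"
proof -
  let ?c = "ysym n rw cl" and ?P = "perms n"
  have "(\<Sum>q\<in>?P. class_sum n rw cl q * ?c (inv' q)) = (\<Sum>h\<in>?P. \<Sum>q\<in>?P. ?c (inv' h \<circ> q \<circ> h) * ?c (inv' q))"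
    unfolding class_sum_def sum_distrib_right by (rule sum.swap)
  also have "\<dots> = (\<Sum>h\<in>?P. \<Sum>u\<in>?P. ?c u * ?c (h \<circ> (inv' u \<circ> inv' h)))"
  proof (rule sum.cong[OF refl])
    fix h assume "h \<in> ?P" then have h: "h permutes {1..n}" by simp
    have "(\<Sum>q\<in>?P. ?c (inv' h \<circ> q \<circ> h) * ?c (inv' q)) =
      (\<Sum>u\<in>?P. ?c (inv' h \<circ> (h \<circ> u \<circ> inv' h) \<circ> h) * ?c (inv' (h \<circ> u \<circ> inv' h)))"
      by (rule sum_perms_conj[OF h, symmetric])
    also have "\<dots> = (\<Sum>u\<in>?P. ?c u * ?c (h \<circ> (inv' u \<circ> inv' h)))"
      by (intro sum.cong refl)
         (simp add: inv_comp[of _ "{1..n}" _ "{1..n}"] h permutes_compose permutes_inv comp_assoc comp_cancel[OF h])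
    finally show "(\<Sum>q\<in>?P. ?c (inv' h \<circ> q \<circ> h) * ?c (inv' q)) = (\<Sum>u\<in>?P. ?c u * ?c (h \<circ> (inv' u \<circ> inv' h)))" .
  qed
  \<comment> \<open>For fixed h the function x -> c (h x) still alternates under the columns on the
    right, so \<open>ysym_mult\<close> extracts the factor c (h^-1).\<close>
  also have "\<dots> = (\<Sum>h\<in>?P. (\<Sum>u\<in>?P. ?c u * ?c (h \<circ> inv' u)) * ?c (inv' h))"
  proof (intro sum.cong refl)
    fix h assume "h \<in> ?P" then have h: "h permutes {1..n}" by simp
    have s: "?c (h \<circ> (g \<circ> q)) = of_int (sign q) * ?c (h \<circ> g)" if "q \<in> fibre_group n cl" for q g
      using ysym_right[OF that, of rw "h \<circ> g"] by (simp add: comp_assoc)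
    show "(\<Sum>u\<in>?P. ?c u * ?c (h \<circ> (inv' u \<circ> inv' h))) = (\<Sum>u\<in>?P. ?c u * ?c (h \<circ> inv' u)) * ?c (inv' h)"
      by (rule ysym_mult[of "\<lambda>x. ?c (h \<circ> x)", OF s permutes_inv[OF h]])
  qed
  also have "\<dots> = (\<Sum>h\<in>?P. (\<Sum>u\<in>?P. ?c u * ?c (inv' h \<circ> inv' u)) * ?c h)"
    by (subst sum_perms_inv[symmetric]) (intro sum.cong refl, simp add: comp_cancel(5)[of _ "{1..n}"])
  also have "\<dots> = (\<Sum>u\<in>?P. ?c u * (\<Sum>h\<in>?P. ?c h * ?c (inv' h \<circ> inv' u)))"
    unfolding sum_distrib_right sum_distrib_left by (subst sum.swap) (simp add: mult_ac)
  also have "\<dots> = (\<Sum>u\<in>?P. ?c u * (ysym_scalar n rw cl * ?c (inv' u)))"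
    by (intro sum.cong refl arg_cong2[of _ _ _ _ "(*)"] ysym_square) (auto intro: permutes_inv)
  also have "\<dots> = (ysym_scalar n rw cl)\<^sup>2"
    by (simp add: power2_eq_square ysym_scalar_def sum_distrib_left mult_ac)
  finally show ?thesis .
qed

text \<open>Conjugation invariance of the class sum z moves a row permutation past it to c, so z c
  has both symmetries of c. Its value at the identity is the one computed in
  \<open>class_sum_ysym_id\<close>.\<close>

lemma class_sum_ysym:
  assumes p: "p permutes {1..n}"
  shows "(\<Sum>q\<in>perms n. class_sum n rw cl q * ysym n rw cl (inv' q \<circ> p)) = (ysym_scalar n rw cl)\<^sup>2 * ysym n rw cl p"
proof -
  let ?c = "ysym n rw cl" and ?z = "class_sum n rw cl"
  define f where "f p = (\<Sum>q\<in>perms n. ?z q * ?c (inv' q \<circ> p))" for p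
  have l: "f (r \<circ> g) = f g" if r: "r \<in> fibre_group n rw" for r g
  proof -
    note rp = fibre_group_permutes[OF r]
    have "f (r \<circ> g) = (\<Sum>u\<in>perms n. ?z (r \<circ> u \<circ> inv' r) * ?c (inv' (r \<circ> u \<circ> inv' r) \<circ> (r \<circ> g)))"
      unfolding f_def by (rule sum_perms_conj[OF rp, symmetric])
    also have "\<dots> = (\<Sum>u\<in>perms n. ?z u * ?c (r \<circ> (inv' u \<circ> g)))"
      by (intro sum.cong refl)
         (simp add: class_sum_conj[OF rp, unfolded comp_assoc] inv_comp[of _ "{1..n}" _ "{1..n}"] rp permutes_compose permutes_inv comp_assoc comp_cancel[OF rp])
    also have "\<dots> = f g" by (simp add: f_def ysym_left[OF r])
    finally show ?thesis .
  qed
  have r: "f (g \<circ> q) = of_int (sign q) * f g" if q: "q \<in> fibre_group n cl" for q g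
    by (simp add: f_def o_assoc ysym_right[OF q] sum_distrib_left mult_ac)
  show ?thesis using symmetrized_eq[of f, OF l r p] class_sum_ysym_id by (simp add: f_def)
qed

text \<open>The previous identity, conjugated by h and summed over h: divided by \<kappa>^2, the
  class sum is the central idempotent of the shape.\<close>

lemma class_sum_square:
  assumes p: "p permutes {1..n}"
  shows "(\<Sum>q\<in>perms n. class_sum n rw cl q * class_sum n rw cl (inv' q \<circ> p)) = (ysym_scalar n rw cl)\<^sup>2 * class_sum n rw cl p"
proof -
  let ?c = "ysym n rw cl" and ?z = "class_sum n rw cl" and ?P = "perms n"
  have "(\<Sum>q\<in>?P. ?z q * ?z (inv' q \<circ> p)) = (\<Sum>h\<in>?P. \<Sum>q\<in>?P. ?z q * ?c (inv' h \<circ> (inv' q \<circ> p) \<circ> h))"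
    by (subst (2) class_sum_def, unfold sum_distrib_left, rule sum.swap)
  also have "\<dots> = (\<Sum>h\<in>?P. (ysym_scalar n rw cl)\<^sup>2 * ?c (inv' h \<circ> p \<circ> h))"
  proof (intro sum.cong refl)
    fix h assume "h \<in> ?P" then have h: "h permutes {1..n}" by simp
    have "(\<Sum>q\<in>?P. ?z q * ?c (inv' h \<circ> (inv' q \<circ> p) \<circ> h)) = 
      (\<Sum>q\<in>?P. ?z (h \<circ> q \<circ> inv' h) * ?c (inv' h \<circ> (inv' (h \<circ> q \<circ> inv' h) \<circ> p) \<circ> h))"
      by (rule sum_perms_conj[OF h, symmetric])
    also have "\<dots> = (\<Sum>q\<in>?P. ?z q * ?c (inv' q \<circ> (inv' h \<circ> p \<circ> h)))"
      by (intro sum.cong refl)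
         (simp add: class_sum_conj[OF h, unfolded comp_assoc] inv_comp[of _ "{1..n}" _ "{1..n}"] h permutes_compose permutes_inv comp_assoc comp_cancel[OF h])
    also have "\<dots> = (ysym_scalar n rw cl)\<^sup>2 * ?c (inv' h \<circ> p \<circ> h)"
      by (rule class_sum_ysym) (intro permutes_compose permutes_inv h p)
    finally show "(\<Sum>q\<in>?P. ?z q * ?c (inv' h \<circ> (inv' q \<circ> p) \<circ> h)) = (ysym_scalar n rw cl)\<^sup>2 * ?c (inv' h \<circ> p \<circ> h)" .
  qed
  also have "\<dots> = (ysym_scalar n rw cl)\<^sup>2 * ?z p" by (simp add: class_sum_def sum_distrib_left)
  finally show ?thesis .
qed

end

text \<open>The two class sums multiply to products c1 x c2 of symmetrizers up to conjugation. Such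
  a product is invariant under the rows of the first labelling and alternates under the columns of
  the second, so by \<open>H\<close> it vanishes at every permutation.\<close>

lemma class_sum_orthogonal:
  assumes H: "\<And>g. g permutes {1..n} \<Longrightarrow> \<not> inj_on (\<lambda>x. (rw1 (g x), cl2 x)) {1..n}"
  shows "(\<Sum>q\<in>perms n. class_sum n rw1 cl1 q * class_sum n rw2 cl2 (inv' q)) = 0"
proof -
  let ?c1 = "ysym n rw1 cl1" and ?c2 = "ysym n rw2 cl2" and ?P = "perms n"
  have G: "(\<Sum>u\<in>?P. ?c1 u * ?c2 (h \<circ> (inv' u \<circ> p))) = 0" if p: "p permutes {1..n}" for h p
  proof -
    define f where "f p = (\<Sum>u\<in>?P. ?c1 u * ?c2 (h \<circ> (inv' u \<circ> p)))" for p
    have l: "f (r \<circ> g) = f g" if r: "r \<in> fibre_group n rw1" for r g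
    proof -
      note rp = fibre_group_permutes[OF r]
      have "f (r \<circ> g) = (\<Sum>u\<in>perms n. ?c1 (r \<circ> u) * ?c2 (h \<circ> (inv' (r \<circ> u) \<circ> (r \<circ> g))))"
        unfolding f_def by (rule sum_perms_left[OF rp, symmetric])
      also have "\<dots> = f g" unfolding f_def
        by (intro sum.cong refl) (simp add: inv_comp[OF rp] comp_assoc comp_cancel[OF rp] ysym_left[OF r])
      finally show ?thesis .
    qed
    have r: "f (g \<circ> q) = of_int (sign q) * f g" if q: "q \<in> fibre_group n cl2" for q g
      by (simp add: f_def o_assoc ysym_right[OF q] sum_distrib_left mult_ac)
    have "f p = 0" by (rule symmetrized_eq_0[of n rw1 f cl2, OF l r p H[OF p]])
    then show ?thesis by (simp add: f_def)
  qed
  have "(\<Sum>q\<in>?P. class_sum n rw1 cl1 q * class_sum n rw2 cl2 (inv' q)) =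
    (\<Sum>q\<in>?P. \<Sum>h\<in>?P. \<Sum>k\<in>?P. ?c1 (inv' h \<circ> q \<circ> h) * ?c2 (inv' k \<circ> inv' q \<circ> k))"
    by (simp add: class_sum_def sum_product)
  also have "\<dots> = (\<Sum>h\<in>?P. \<Sum>k\<in>?P. \<Sum>q\<in>?P. ?c1 (inv' h \<circ> q \<circ> h) * ?c2 (inv' k \<circ> inv' q \<circ> k))"
    by (subst sum.swap, rule sum.cong[OF refl], rule sum.swap)
  also have "\<dots> = 0"
  proof (rule sum.neutral, rule ballI, rule sum.neutral, rule ballI)
    fix h k assume "h \<in> ?P" "k \<in> ?P" then have h: "h permutes {1..n}" and k: "k permutes {1..n}" by auto
    have "(\<Sum>q\<in>?P. ?c1 (inv' h \<circ> q \<circ> h) * ?c2 (inv' k \<circ> inv' q \<circ> k)) =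
      (\<Sum>q\<in>?P. ?c1 (inv' h \<circ> (h \<circ> q \<circ> inv' h) \<circ> h) * ?c2 (inv' k \<circ> inv' (h \<circ> q \<circ> inv' h) \<circ> k))"
      by (rule sum_perms_conj[OF h, symmetric])
    also have "\<dots> = (\<Sum>q\<in>?P. ?c1 q * ?c2 ((inv' k \<circ> h) \<circ> (inv' q \<circ> (inv' h \<circ> k))))"
      by (intro sum.cong refl)
         (simp add: inv_comp[of _ "{1..n}" _ "{1..n}"] h permutes_compose permutes_inv comp_assoc comp_cancel[OF h])
    also have "\<dots> = 0" by (rule G) (intro permutes_compose permutes_inv h k)
    finally show "(\<Sum>q\<in>?P. ?c1 (inv' h \<circ> q \<circ> h) * ?c2 (inv' k \<circ> inv' q \<circ> k)) = 0" .
  qed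
  finally show ?thesis .
qed

text \<open>The total of the row numbers is a numerical companion of the dominance order that
  compares any two shapes. If \<rho> has no larger total than \<open>rw\<close> and some g separates
  the columns, the equality case of \<open>sum_rows_le\<close> makes the row lengths agree.
  Contraposed, this supplies the hypothesis of \<open>class_sum_orthogonal\<close> for distinct
  shapes.\<close>

lemma (in tableau) same_rows:
  assumes g: "g permutes {1..n}" and ig: "inj_on (\<lambda>x. (\<rho> (g x), cl x)) {1..n}"
    and le: "(\<Sum>x\<in>{1..n}. \<rho> x) \<le> (\<Sum>x\<in>{1..n}. rw x)"
  shows "card {x\<in>{1..n}. \<rho> x = i} = card {x\<in>{1..n}. rw x = i}"
proof -
  have "(\<Sum>x\<in>{1..n}. \<rho> (g x)) = (\<Sum>x\<in>{1..n}. \<rho> x)"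
    using sum.permute[OF g, of \<rho>] by (simp add: comp_def)
  then have im: "(\<lambda>x. (\<rho> (g x), cl x)) ` {1..n} = (\<lambda>x. (rw x, cl x)) ` {1..n}"
    using sum_rows_le(2)[OF ig] le by simp
  have *: "card {x\<in>{1..n}. r x = i} = card {c \<in> (\<lambda>x. (r x, cl x)) ` {1..n}. fst c = i}"
    if "inj_on (\<lambda>x. (r x, cl x)) {1..n}" for r
  proof -
    have "{c \<in> (\<lambda>x. (r x, cl x)) ` {1..n}. fst c = i} = (\<lambda>x. (r x, cl x)) ` {x\<in>{1..n}. r x = i}" by auto
    moreover have "inj_on (\<lambda>x. (r x, cl x)) {x\<in>{1..n}. r x = i}" by (rule inj_on_subset[OF that]) auto
    ultimately show ?thesis by (simp only: card_image)
  qed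
  have "g ` {x\<in>{1..n}. \<rho> (g x) = i} = {x\<in>{1..n}. \<rho> x = i}"
  proof (intro equalityI subsetI)
    fix y assume "y \<in> {x\<in>{1..n}. \<rho> x = i}"
    then have "inv' g y \<in> {x\<in>{1..n}. \<rho> (g x) = i}"
      by (simp only: mem_Collect_eq comp_cancel(6)[OF g] permutes_in_image[OF permutes_inv[OF g]])
    then show "y \<in> g ` {x\<in>{1..n}. \<rho> (g x) = i}" using comp_cancel(6)[OF g, of y] by (metis imageI)
  qed (use permutes_in_image[OF g] in auto)
  then have "card {x\<in>{1..n}. \<rho> x = i} = card {x\<in>{1..n}. \<rho> (g x) = i}"
    using card_image[OF inj_on_subset[OF permutes_inj[OF g] subset_UNIV], of "{x\<in>{1..n}. \<rho> (g x) = i}"] by simp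
  then show ?thesis using *[OF ig] *[OF inj] im by simp
qed

section \<open>Tableaux of partitions\<close>

definition row_of :: "nat list \<Rightarrow> nat \<Rightarrow> nat" where
  "row_of \<mu> x = (LEAST r. x \<le> sum_list (take (Suc r) \<mu>))"

definition col_of :: "nat list \<Rightarrow> nat \<Rightarrow> nat" where
  "col_of \<mu> x = x - 1 - sum_list (take (row_of \<mu> x) \<mu>)"

lemma Sym_eq: "Sym n = perms n" by (simp add: sym_group_def)

lemma sum_list_take_Suc: "r < length \<mu> \<Longrightarrow> sum_list (take (Suc r) \<mu>) = sum_list (take r \<mu>) + \<mu> ! r" for \<mu> :: "nat list"
  by (simp add: take_Suc_conv_app_nth)

lemma sum_list_take_mono: 
  fixes \<mu> :: "nat list"
  assumes "i \<le> j" shows "sum_list (take i \<mu>) \<le> sum_list (take j \<mu>)"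
proof -
  have "take j \<mu> = take i \<mu> @ take (j - i) (drop i \<mu>)" using assms by (metis le_add_diff_inverse take_add)
  then show ?thesis by simp
qed

lemma sum_list_take_le: "sum_list (take i \<mu>) \<le> sum_list \<mu>" for \<mu> :: "nat list"
  using sum_list_take_mono[of i "max i (length \<mu>)" \<mu>] by simp

lemma tab_entry_pos:
  assumes "r < length \<mu>" "c < \<mu> ! r"
  shows "row_of \<mu> (tab_entry \<mu> r c) = r" "col_of \<mu> (tab_entry \<mu> r c) = c" "tab_entry \<mu> r c \<in> {1..sum_list \<mu>}"
proof -
  show 1: "row_of \<mu> (tab_entry \<mu> r c) = r" unfolding row_of_def
  proof (rule Least_equality)
    show "tab_entry \<mu> r c \<le> sum_list (take (Suc r) \<mu>)"
      using assms by (simp only: sum_list_take_Suc tab_entry_def)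
    fix y assume y: "tab_entry \<mu> r c \<le> sum_list (take (Suc y) \<mu>)"
    show "r \<le> y"
    proof (rule ccontr)
      assume "\<not> r \<le> y"
      then have "sum_list (take (Suc y) \<mu>) \<le> sum_list (take r \<mu>)" by (intro sum_list_take_mono) simp
      then show False using y by (simp add: tab_entry_def)
    qed
  qed
  show "col_of \<mu> (tab_entry \<mu> r c) = c" unfolding col_of_def 1 by (simp add: tab_entry_def)
  have "sum_list (take r \<mu>) + \<mu> ! r \<le> sum_list \<mu>" using sum_list_take_le[of "Suc r" \<mu>] sum_list_take_Suc[OF assms(1)] by simp
  then show "tab_entry \<mu> r c \<in> {1..sum_list \<mu>}" using assms(2) by (simp add: tab_entry_def)
qed

lemma pos_tab_entry:
  assumes x: "x \<in> {1..sum_list \<mu>}"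
  shows "row_of \<mu> x < length \<mu>" "col_of \<mu> x < \<mu> ! row_of \<mu> x" "tab_entry \<mu> (row_of \<mu> x) (col_of \<mu> x) = x"
proof -
  let ?r = "row_of \<mu> x"
  have ne: "\<mu> \<noteq> []" using x by auto
  have ex: "x \<le> sum_list (take (Suc (length \<mu> - 1)) \<mu>)" using x ne by (simp add: Suc_diff_1)
  have le: "x \<le> sum_list (take (Suc ?r) \<mu>)" unfolding row_of_def by (rule LeastI[of "\<lambda>r. x \<le> sum_list (take (Suc r) \<mu>)", OF ex])
  have "?r \<le> length \<mu> - 1" unfolding row_of_def by (rule Least_le[of "\<lambda>r. x \<le> sum_list (take (Suc r) \<mu>)", OF ex])
  then show r: "?r < length \<mu>" using ne by (cases \<mu>) auto
  have gt: "sum_list (take ?r \<mu>) < x"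
  proof (cases ?r)
    case 0 then show ?thesis using x by simp
  next
    case (Suc k)
    then have "\<not> x \<le> sum_list (take (Suc k) \<mu>)"
      using not_less_Least[of k "\<lambda>r. x \<le> sum_list (take (Suc r) \<mu>)"] by (simp add: row_of_def)
    then show ?thesis using Suc by simp
  qed
  show "col_of \<mu> x < \<mu> ! ?r" "tab_entry \<mu> ?r (col_of \<mu> x) = x"
    using gt le r by (simp_all add: col_of_def tab_entry_def sum_list_take_Suc del: take_Suc)
qed

lemma tab_row_eq: "tab_row \<mu> r = {x\<in>{1..sum_list \<mu>}. row_of \<mu> x = r}"
proof (intro equalityI subsetI)
  fix x assume "x \<in> tab_row \<mu> r" then show "x \<in> {x\<in>{1..sum_list \<mu>}. row_of \<mu> x = r}"
    unfolding tab_row_def using tab_entry_pos by blast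
next
  fix x assume "x \<in> {x\<in>{1..sum_list \<mu>}. row_of \<mu> x = r}" then show "x \<in> tab_row \<mu> r"
    unfolding tab_row_def using pos_tab_entry[of x \<mu>] by (auto intro!: exI[of _ "col_of \<mu> x"])
qed

lemma tab_col_eq: "tab_col \<mu> c = {x\<in>{1..sum_list \<mu>}. col_of \<mu> x = c}"
proof (intro equalityI subsetI)
  fix x assume "x \<in> tab_col \<mu> c" then show "x \<in> {x\<in>{1..sum_list \<mu>}. col_of \<mu> x = c}"
    unfolding tab_col_def using tab_entry_pos by blast
next
  fix x assume "x \<in> {x\<in>{1..sum_list \<mu>}. col_of \<mu> x = c}" then show "x \<in> tab_col \<mu> c"
    unfolding tab_col_def using pos_tab_entry[of x \<mu>] by (auto intro!: exI[of _ "row_of \<mu> x"])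
qed

lemma fibre_group_eq: "{p \<in> Sym n. \<forall>r. p ` {x\<in>{1..n}. f x = r} = {x\<in>{1..n}. f x = r}} = fibre_group n f"
proof (intro equalityI subsetI)
  fix p assume p: "p \<in> {p \<in> Sym n. \<forall>r. p ` {x\<in>{1..n}. f x = r} = {x\<in>{1..n}. f x = r}}"
  have "f (p x) = f x" if "x \<in> {1..n}" for x
  proof -
    have "p x \<in> p ` {y\<in>{1..n}. f y = f x}" using that by blast
    then show ?thesis using p by blast
  qed
  then show "p \<in> fibre_group n f" using p by (simp add: fibre_group_def Sym_eq)
next
  fix p assume p: "p \<in> fibre_group n f"
  note pp = fibre_group_permutes[OF p]
  have "p ` {x\<in>{1..n}. f x = r} = {x\<in>{1..n}. f x = r}" for r
  proof (rule endo_inj_surj)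
    show "p ` {x\<in>{1..n}. f x = r} \<subseteq> {x\<in>{1..n}. f x = r}"
      using permutes_in_image[OF pp] fibre_group_fibre[OF p] by blast
    show "inj_on p {x\<in>{1..n}. f x = r}" using permutes_inj_on[OF pp] .
  qed simp
  then show "p \<in> {p \<in> Sym n. \<forall>r. p ` {x\<in>{1..n}. f x = r} = {x\<in>{1..n}. f x = r}}" using pp by (simp add: Sym_eq)
qed

lemma young_symmetrizer_eq:
  "young_symmetrizer \<mu> = ysym (sum_list \<mu>) (row_of \<mu>) (col_of \<mu>)"
proof
  fix p
  let ?n = "sum_list \<mu>"
  have rg: "row_group \<mu> = fibre_group ?n (row_of \<mu>)" and cg: "col_group \<mu> = fibre_group ?n (col_of \<mu>)"
    unfolding row_group_def col_group_def tab_row_eq tab_col_eq fibre_group_eq by (rule refl)+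
  have "young_symmetrizer \<mu> p = (\<Sum>q\<in>perms ?n. if q \<in> fibre_group ?n (row_of \<mu>) then col_sign ?n (col_of \<mu>) (inv' q \<circ> p) else 0)"
    unfolding young_symmetrizer_def conv_def rg cg Sym_eq col_sign_def by (intro sum.cong refl) simp
  also have "\<dots> = (\<Sum>q\<in>{q\<in>perms ?n. q \<in> fibre_group ?n (row_of \<mu>)}. col_sign ?n (col_of \<mu>) (inv' q \<circ> p))"
    by (rule sum.inter_filter[symmetric, OF finite_perms])
  also have "{q\<in>perms ?n. q \<in> fibre_group ?n (row_of \<mu>)} = fibre_group ?n (row_of \<mu>)" using fibre_group_permutes by auto
  finally show "young_symmetrizer \<mu> p = ysym ?n (row_of \<mu>) (col_of \<mu>) p" by (simp only: ysym_def)
qed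

lemma partition_tableau:
  assumes mu: "\<mu> \<in> partitions n"
  shows "tableau n (row_of \<mu>) (col_of \<mu>)"
proof -
  have n: "sum_list \<mu> = n" and s: "sorted_wrt (\<ge>) \<mu>" using mu by (auto simp: partitions_def)
  show ?thesis
  proof
    show "inj_on (\<lambda>x. (row_of \<mu> x, col_of \<mu> x)) {1..n}"
    proof (rule inj_onI)
      fix x y assume "x \<in> {1..n}" "y \<in> {1..n}" and e: "(row_of \<mu> x, col_of \<mu> x) = (row_of \<mu> y, col_of \<mu> y)"
      then have "tab_entry \<mu> (row_of \<mu> x) (col_of \<mu> x) = x" "tab_entry \<mu> (row_of \<mu> y) (col_of \<mu> y) = y"
        using pos_tab_entry(3)[of _ \<mu>, unfolded n] by blast+
      then show "x = y" using e by (metis prod.inject)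
    qed
    fix x i j assume x: "x \<in> {1..n}" and i: "i \<le> row_of \<mu> x" and j: "j \<le> col_of \<mu> x"
    have x': "row_of \<mu> x < length \<mu>" "col_of \<mu> x < \<mu> ! row_of \<mu> x" using pos_tab_entry[of x \<mu>] x n by (simp_all del: atLeastAtMost_iff)
    have "\<mu> ! row_of \<mu> x \<le> \<mu> ! i"
      using sorted_wrt_nth_less[OF s, of i "row_of \<mu> x"] i x' by (cases "i = row_of \<mu> x") auto
    then have ij: "i < length \<mu>" "j < \<mu> ! i" using i j x' by auto
    show "\<exists>y\<in>{1..n}. row_of \<mu> y = i \<and> col_of \<mu> y = j"
      using tab_entry_pos[OF ij] n by (intro bexI[of _ "tab_entry \<mu> i j"]) (simp_all del: atLeastAtMost_iff)
  qed
qed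

lemma card_row:
  assumes "sum_list \<mu> = n"
  shows "card {x\<in>{1..n}. row_of \<mu> x = i} = (if i < length \<mu> then \<mu> ! i else 0)"
proof (cases "i < length \<mu>")
  case True
  have "{x\<in>{1..n}. row_of \<mu> x = i} = tab_entry \<mu> i ` {..<\<mu> ! i}"
    unfolding assms[symmetric] tab_row_eq[symmetric] tab_row_def using True by auto
  moreover have "inj_on (tab_entry \<mu> i) {..<\<mu> ! i}" by (auto simp: inj_on_def tab_entry_def)
  ultimately show ?thesis using True by (simp only: card_image card_lessThan if_True)
next
  case False
  have "{x\<in>{1..n}. row_of \<mu> x = i} = {}" using pos_tab_entry(1)[of _ \<mu>] assms False by blast
  then show ?thesis using False by (simp only: card.empty if_False)
qed

lemma partitions_eqI:
  assumes l: "\<nu> \<in> partitions n" and m: "\<mu> \<in> partitions n"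
    and c: "\<And>i. card {x\<in>{1..n}. row_of \<nu> x = i} = card {x\<in>{1..n}. row_of \<mu> x = i}"
  shows "\<nu> = \<mu>"
proof -
  have e: "(if i < length \<nu> then \<nu> ! i else 0) = (if i < length \<mu> then \<mu> ! i else 0)" for i
    using c[of i] l m by (simp only: card_row partitions_def mem_Collect_eq)
  have pos: "i < length \<kappa> \<Longrightarrow> \<kappa> ! i > 0" if "\<kappa> \<in> partitions n" for \<kappa> i
    using that nth_mem[of i \<kappa>] by (cases "\<kappa> ! i") (auto simp: partitions_def)
  have iff: "i < length \<nu> \<longleftrightarrow> i < length \<mu>" for i
    using e[of i] pos[OF l, of i] pos[OF m, of i] by (auto split: if_splits)
  have len: "length \<nu> = length \<mu>" using iff[of "length \<nu>"] iff[of "length \<mu>"] by linarith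
  show ?thesis
  proof (rule nth_equalityI[OF len])
    fix i assume "i < length \<nu>" then show "\<nu> ! i = \<mu> ! i" using e[of i] len by simp
  qed
qed

lemma class_sum_partitions_orthogonal:
  assumes l: "\<nu> \<in> partitions n" and m: "\<mu> \<in> partitions n" and ne: "\<nu> \<noteq> \<mu>"
  shows "(\<Sum>q\<in>perms n. class_sum n (row_of \<nu>) (col_of \<nu>) q * class_sum n (row_of \<mu>) (col_of \<mu>) q) = 0"
proof -
  have *: "(\<Sum>q\<in>perms n. class_sum n (row_of \<nu>) (col_of \<nu>) q * class_sum n (row_of \<mu>) (col_of \<mu>) q) = 0"
    if l: "\<nu> \<in> partitions n" and m: "\<mu> \<in> partitions n" and ne: "\<nu> \<noteq> \<mu>"
      and le: "(\<Sum>x\<in>{1..n}. row_of \<nu> x) \<le> (\<Sum>x\<in>{1..n}. row_of \<mu> x)" for \<nu> \<mu>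
  proof -
    have "\<not> inj_on (\<lambda>x. (row_of \<nu> (g x), col_of \<mu> x)) {1..n}" if g: "g permutes {1..n}" for g
      using tableau.same_rows[OF partition_tableau[OF m] g _ le] partitions_eqI[OF l m] ne by blast
    from class_sum_orthogonal[of n "row_of \<nu>" "col_of \<mu>", OF this]
    have "(\<Sum>q\<in>perms n. class_sum n (row_of \<nu>) (col_of \<nu>) q * class_sum n (row_of \<mu>) (col_of \<mu>) (inv' q)) = 0" .
    then show ?thesis by (simp add: class_sum_inv)
  qed
  \<comment> \<open>The sum is symmetric in the two shapes, so the one with the smaller row total
    may be taken first.\<close>
  show ?thesis
    using *[OF l m ne] *[OF m l ne[symmetric]] by (cases "(\<Sum>x\<in>{1..n}. row_of \<nu> x) \<le> (\<Sum>x\<in>{1..n}. row_of \<mu> x)") (simp_all add: mult.commute)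
qed

section \<open>The trace of a Specht module\<close>

lemma comp_permutes_iff:
  assumes r: "r permutes A" shows "inv' r \<circ> p permutes A \<longleftrightarrow> p permutes A"
proof
  assume "inv' r \<circ> p permutes A"
  from permutes_compose[OF this r] show "p permutes A" by (simp only: comp_cancel(3)[OF r])
next
  assume "p permutes A"
  then show "inv' r \<circ> p permutes A" by (intro permutes_compose permutes_inv r)
qed

lemma ysym_not_perm: "\<not> p permutes {1..n} \<Longrightarrow> ysym n rw cl p = 0"
  unfolding ysym_def
proof (intro sum.neutral ballI)
  fix r assume np: "\<not> p permutes {1..n}" and r: "r \<in> fibre_group n rw"
  note rp = fibre_group_permutes[OF r]
  have "inv' r \<circ> p \<notin> fibre_group n cl"
    using np comp_permutes_iff[OF rp] fibre_group_permutes by blast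
  then show "col_sign n cl (inv' r \<circ> p) = 0" by (simp add: col_sign_def)
qed

lemma translate_sum: "translate g (\<Sum>i\<in>I. fun_scale (a i) (x i)) = (\<Sum>i\<in>I. fun_scale (a i) (translate g (x i)))"
  by (simp add: translate_def fun_eq_iff sum_galg_apply fun_scale_def)

lemma translate_comp:
  "g permutes {1..n} \<Longrightarrow> h permutes {1..n} \<Longrightarrow> translate (g \<circ> h) x = translate g (translate h x)"
  by (simp add: translate_def inv_comp comp_assoc)

lemma translate_id: "translate id x = x" by (simp add: translate_def fun_eq_iff)

text \<open>An arbitrary matrix form of the Specht module together with its basis; nothing here
  depends on which form the choice in \<open>specht_rep\<close> selects.\<close>

locale specht_form =
  fixes \<mu> :: "nat list" and \<rho> :: matrep and bs :: "galg list" and n :: nat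
  assumes tab: "tableau n (row_of \<mu>) (col_of \<mu>)" and n: "n = sum_list \<mu>"
    and bs: "distinct bs" "galg.independent (set bs)" "galg.span (set bs) = specht_module \<mu>"
    and carrier: "\<And>g. g permutes {1..n} \<Longrightarrow> \<rho> g \<in> carrier_mat (length bs) (length bs)"
    and act: "\<And>g j. g permutes {1..n} \<Longrightarrow> j < length bs \<Longrightarrow>
       translate g (bs ! j) = (\<Sum>i<length bs. fun_scale (\<rho> g $$ (i, j)) (bs ! i))"
begin

interpretation tableau n "row_of \<mu>" "col_of \<mu>" by (rule tab)

abbreviation "c \<equiv> ysym n (row_of \<mu>) (col_of \<mu>)"
abbreviation "\<kappa> \<equiv> ysym_scalar n (row_of \<mu>) (col_of \<mu>)"
abbreviation "d \<equiv> length bs"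

lemma basis_sum: "(\<Sum>i<d. fun_scale (a (bs ! i)) (bs ! i)) = (\<Sum>b\<in>set bs. fun_scale (a b) b)"
  using sum.reindex_bij_betw[OF bij_betw_nth[OF bs(1) refl refl], of "\<lambda>b. fun_scale (a b) b"] by simp

lemma coeffs_unique:
  assumes e: "(\<Sum>i<d. fun_scale (a i) (bs ! i)) = (\<Sum>i<d. fun_scale (b i) (bs ! i))" and i: "i < d"
  shows "a i = b i"
proof -
  define ix where "ix = inv_into {..<d} ((!) bs)"
  have ix: "ix (bs ! k) = k" if "k < d" for k
    unfolding ix_def using bij_betw_nth[OF bs(1) refl refl] that by (intro inv_into_f_f) (auto simp: bij_betw_def)
  define u where "u v = a (ix v) - b (ix v)" for v
  have "(\<Sum>v\<in>set bs. fun_scale (u v) v) = (\<Sum>k<d. fun_scale (u (bs ! k)) (bs ! k))" by (rule basis_sum[symmetric])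
  also have "\<dots> = (\<Sum>k<d. fun_scale (a k - b k) (bs ! k))" by (intro sum.cong refl) (simp add: u_def ix)
  also have "\<dots> = 0" using e by (simp add: galg.scale_left_diff_distrib sum_subtractf)
  finally have "u (bs ! i) = 0"
    using galg.independentD[OF bs(2) _ subset_refl, of u "bs ! i"] i by simp
  then show ?thesis using ix[OF i] by (simp add: u_def)
qed

lemma span_coeffs:
  assumes "x \<in> specht_module \<mu>"
  obtains a where "x = (\<Sum>i<d. fun_scale (a i) (bs ! i))"
proof -
  have "x \<in> range (\<lambda>u. \<Sum>v\<in>set bs. fun_scale (u v) v)"
    using assms unfolding bs(3)[symmetric] by (subst (asm) galg.span_finite) simp_all
  then obtain u where "x = (\<Sum>v\<in>set bs. fun_scale (u v) v)" by blast
  then show ?thesis using that[of "\<lambda>i. u (bs ! i)"] basis_sum[of u] by simp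
qed

lemma specht_module_eq: "specht_module \<mu> = (\<lambda>x. conv n x c) ` group_algebra n"
  by (simp add: specht_module_def n young_symmetrizer_eq)

lemma ysym_in: "c \<in> specht_module \<mu>"
proof -
  define e where "e p = (if p = id then 1 else 0 :: complex)" for p :: "nat \<Rightarrow> nat"
  have "conv n e c p = c p" for p
  proof -
    have "conv n e c p = (\<Sum>q\<in>perms n. if q = id then c (inv' id \<circ> p) else 0)"
      unfolding conv_def Sym_eq by (intro sum.cong refl) (simp add: e_def)
    then show ?thesis by (simp add: sum.delta[OF finite_perms] permutes_id)
  qed
  then have "conv n e c = c" by blast
  moreover have "e \<in> group_algebra n" by (auto simp: group_algebra_def e_def Sym_eq permutes_id)
  ultimately show ?thesis unfolding specht_module_eq by (metis image_eqI)
qed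

definition "\<alpha>0 = (SOME a. c = (\<Sum>i<d. fun_scale (a i) (bs ! i)))"

text \<open>The coordinates of the translate h c in the basis; see
  \<open>translate_c\<close>.\<close>

definition "\<alpha> h i = (\<Sum>j<d. \<rho> h $$ (i, j) * \<alpha>0 j)"

lemma \<alpha>0: "c = (\<Sum>i<d. fun_scale (\<alpha>0 i) (bs ! i))"
proof -
  have "\<exists>a. c = (\<Sum>i<d. fun_scale (a i) (bs ! i))" by (rule span_coeffs[OF ysym_in]) blast
  then show ?thesis unfolding \<alpha>0_def by (rule someI_ex)
qed

lemma act_comb:
  assumes "g permutes {1..n}"
  shows "translate g (\<Sum>j<d. fun_scale (a j) (bs ! j)) = (\<Sum>i<d. fun_scale (\<Sum>j<d. \<rho> g $$ (i, j) * a j) (bs ! i))"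
proof -
  have "translate g (\<Sum>j<d. fun_scale (a j) (bs ! j)) = (\<Sum>j<d. fun_scale (a j) (\<Sum>i<d. fun_scale (\<rho> g $$ (i, j)) (bs ! i)))"
    unfolding translate_sum using assms by (intro sum.cong refl) (simp add: act)
  also have "\<dots> = (\<Sum>j<d. \<Sum>i<d. fun_scale (\<rho> g $$ (i, j) * a j) (bs ! i))"
    by (simp add: galg.scale_sum_right mult.commute)
  also have "\<dots> = (\<Sum>i<d. \<Sum>j<d. fun_scale (\<rho> g $$ (i, j) * a j) (bs ! i))" by (rule sum.swap)
  finally show ?thesis by (simp add: galg.scale_sum_left)
qed

lemma translate_c: "h permutes {1..n} \<Longrightarrow> translate h c = (\<Sum>i<d. fun_scale (\<alpha> h i) (bs ! i))"
  by (subst \<alpha>0) (simp add: act_comb \<alpha>_def)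

lemma rho_mult:
  assumes g: "g permutes {1..n}" and h: "h permutes {1..n}" and i: "i < d" and j: "j < d"
  shows "\<rho> (g \<circ> h) $$ (i, j) = (\<Sum>k<d. \<rho> g $$ (i, k) * \<rho> h $$ (k, j))"
proof -
  have "(\<Sum>i<d. fun_scale (\<rho> (g \<circ> h) $$ (i, j)) (bs ! i)) = translate (g \<circ> h) (bs ! j)"
    using act[OF permutes_compose[OF h g] j] by simp
  also have "\<dots> = translate g (\<Sum>i<d. fun_scale (\<rho> h $$ (i, j)) (bs ! i))"
    by (simp add: translate_comp[OF g h] act[OF h j])
  also have "\<dots> = (\<Sum>i<d. fun_scale (\<Sum>k<d. \<rho> g $$ (i, k) * \<rho> h $$ (k, j)) (bs ! i))" by (rule act_comb[OF g])
  finally show ?thesis by (rule coeffs_unique[OF _ i])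
qed

lemma rho_mult_mat:
  assumes g: "g permutes {1..n}" and h: "h permutes {1..n}"
  shows "\<rho> (g \<circ> h) = \<rho> g * \<rho> h"
proof (rule eq_matI)
  note cg = carrier[OF g] and ch = carrier[OF h] and cgh = carrier[OF permutes_compose[OF h g]]
  show "dim_row (\<rho> (g \<circ> h)) = dim_row (\<rho> g * \<rho> h)" "dim_col (\<rho> (g \<circ> h)) = dim_col (\<rho> g * \<rho> h)"
    using cg ch cgh by auto
  fix i j assume "i < dim_row (\<rho> g * \<rho> h)" "j < dim_col (\<rho> g * \<rho> h)"
  then show "\<rho> (g \<circ> h) $$ (i, j) = (\<rho> g * \<rho> h) $$ (i, j)"
    using rho_mult[OF g h, of i j] cg ch by (auto simp: scalar_prod_def atLeast0LessThan)
qed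

lemma rho_id: 
  assumes "i < d" "j < d" shows "\<rho> id $$ (i, j) = (if i = j then 1 else 0)"
proof -
  have "(\<Sum>i<d. fun_scale (\<rho> id $$ (i, j)) (bs ! i)) = bs ! j"
    using act[OF permutes_id assms(2)] by (simp add: translate_id)
  also have "\<dots> = (\<Sum>i<d. fun_scale (if i = j then 1 else 0) (bs ! i))"
    using assms(2) by (simp add: if_distrib[of "\<lambda>x. fun_scale x _"] cong: if_cong)
  finally show ?thesis by (rule coeffs_unique[OF _ assms(1)])
qed

lemma rho_id_mat: "\<rho> id = 1\<^sub>m d"
  by (rule eq_matI) (use carrier[OF permutes_id] rho_id in auto)

text \<open>Elements of the module have the form x c, and x c c = \<kappa> x c.\<close>

lemma basis_conv:
  assumes i: "i < d" shows "(\<Sum>h\<in>perms n. (bs ! i) h * c (inv' h \<circ> p)) = \<kappa> * (bs ! i) p"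
proof -
  have "bs ! i \<in> specht_module \<mu>" unfolding bs(3)[symmetric] using i by (intro galg.span_base) simp
  then obtain x where x: "bs ! i = conv n x c" unfolding specht_module_eq by blast
  have "(\<Sum>h\<in>perms n. (bs ! i) h * c (inv' h \<circ> p)) = (\<Sum>q\<in>perms n. \<Sum>h\<in>perms n. x q * (c (inv' q \<circ> h) * c (inv' h \<circ> p)))"
    unfolding x conv_def Sym_eq sum_distrib_right by (subst sum.swap) (simp add: mult_ac)
  also have "\<dots> = (\<Sum>q\<in>perms n. x q * (\<kappa> * c (inv' q \<circ> p)))"
  proof (rule sum.cong[OF refl])
    fix q assume "q \<in> perms n" then have q: "q permutes {1..n}" by simp
    have "(\<Sum>h\<in>perms n. c (inv' q \<circ> h) * c (inv' h \<circ> p)) = (\<Sum>h\<in>perms n. c (inv' q \<circ> (q \<circ> h)) * c (inv' (q \<circ> h) \<circ> p))"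
      by (rule sum_perms_left[OF q, symmetric])
    also have "\<dots> = (\<Sum>h\<in>perms n. c h * c (inv' h \<circ> (inv' q \<circ> p)))"
      by (intro sum.cong refl) (simp add: inv_comp[OF q] comp_cancel[OF q] comp_assoc)
    also have "\<dots> = \<kappa> * c (inv' q \<circ> p)"
    proof (cases "inv' q \<circ> p permutes {1..n}")
      case True then show ?thesis by (rule ysym_square)
    next
      case False
      then show ?thesis by (simp add: ysym_not_perm comp_permutes_iff)
    qed
    finally show "(\<Sum>h\<in>perms n. x q * (c (inv' q \<circ> h) * c (inv' h \<circ> p))) = x q * (\<kappa> * c (inv' q \<circ> p))"
      by (simp add: sum_distrib_left[symmetric])
  qed
  also have "\<dots> = \<kappa> * (bs ! i) p" by (simp add: x conv_def Sym_eq sum_distrib_left mult_ac)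
  finally show ?thesis .
qed

text \<open>Write b c = \<kappa> b as a combination of the translates h c with coefficients b h and
  compare coordinates. Up to the factor \<kappa>, the coordinate functions h ->
  \<open>\<alpha> h j\<close> are dual to the basis under summation over the group.\<close>

lemma dual_basis:
  assumes i: "i < d" and j: "j < d"
  shows "(\<Sum>h\<in>perms n. (bs ! i) h * \<alpha> h j) = (if j = i then \<kappa> else 0)"
proof (rule coeffs_unique[OF _ j])
  have "(\<Sum>j<d. fun_scale (\<Sum>h\<in>perms n. (bs ! i) h * \<alpha> h j) (bs ! j)) p = (\<Sum>j<d. fun_scale (if j = i then \<kappa> else 0) (bs ! j)) p" for p
  proof -
    have "(\<Sum>j<d. fun_scale (\<Sum>h\<in>perms n. (bs ! i) h * \<alpha> h j) (bs ! j)) p =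
      (\<Sum>h\<in>perms n. (bs ! i) h * (\<Sum>j<d. \<alpha> h j * (bs ! j) p))"
      unfolding sum_galg_apply fun_scale_def sum_distrib_right sum_distrib_left by (subst sum.swap) (simp add: mult_ac)
    also have "\<dots> = (\<Sum>h\<in>perms n. (bs ! i) h * c (inv' h \<circ> p))"
    proof (rule sum.cong[OF refl])
      fix h assume "h \<in> perms n"
      then have "translate h c p = (\<Sum>j<d. \<alpha> h j * (bs ! j) p)" by (simp add: translate_c sum_galg_apply fun_scale_def)
      then show "(bs ! i) h * (\<Sum>j<d. \<alpha> h j * (bs ! j) p) = (bs ! i) h * c (inv' h \<circ> p)" by (simp add: translate_def)
    qed
    also have "\<dots> = \<kappa> * (bs ! i) p" by (rule basis_conv[OF i])
    also have "\<dots> = (\<Sum>j<d. fun_scale (if j = i then \<kappa> else 0) (bs ! j)) p"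
      using i by (simp add: sum_galg_apply fun_scale_def if_distrib[of "\<lambda>x. x * _"] cong: if_cong)
    finally show ?thesis .
  qed
  then show "(\<Sum>j<d. fun_scale (\<Sum>h\<in>perms n. (bs ! i) h * \<alpha> h j) (bs ! j)) = (\<Sum>j<d. fun_scale (if j = i then \<kappa> else 0) (bs ! j))"
    by blast
qed

text \<open>The dual basis turns \<kappa> tr \<rho>(g) into the sum over h of the coefficient at h
  of the translate g h c, and this coefficient is c (h^-1 g^-1 h).\<close>

lemma trace_scaled:
  assumes g: "g permutes {1..n}"
  shows "\<kappa> * (\<Sum>i<d. \<rho> g $$ (i, i)) = class_sum n (row_of \<mu>) (col_of \<mu>) g"
proof -
  have "\<kappa> * (\<Sum>i<d. \<rho> g $$ (i, i)) = (\<Sum>i<d. \<Sum>j<d. \<rho> g $$ (i, j) * (if j = i then \<kappa> else 0))"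
    by (simp add: sum_distrib_left mult_ac if_distrib[of "\<lambda>x. _ * x"] cong: if_cong)
  also have "\<dots> = (\<Sum>i<d. \<Sum>j<d. \<rho> g $$ (i, j) * (\<Sum>h\<in>perms n. (bs ! i) h * \<alpha> h j))"
    by (intro sum.cong refl) (simp add: dual_basis)
  also have "\<dots> = (\<Sum>i<d. \<Sum>h\<in>perms n. (\<Sum>j<d. \<rho> g $$ (i, j) * \<alpha> h j) * (bs ! i) h)"
    unfolding sum_distrib_left sum_distrib_right by (rule sum.cong[OF refl], subst sum.swap) (simp add: mult_ac)
  also have "\<dots> = (\<Sum>h\<in>perms n. \<Sum>i<d. (\<Sum>j<d. \<rho> g $$ (i, j) * \<alpha> h j) * (bs ! i) h)" by (rule sum.swap)
  also have "\<dots> = (\<Sum>h\<in>perms n. c (inv' h \<circ> inv' g \<circ> h))"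
  proof (rule sum.cong[OF refl])
    fix h assume "h \<in> perms n" then have h: "h permutes {1..n}" by simp
    have "translate (g \<circ> h) c = translate g (\<Sum>i<d. fun_scale (\<alpha> h i) (bs ! i))"
      by (simp add: translate_comp[OF g h] translate_c[OF h])
    also have "\<dots> = (\<Sum>i<d. fun_scale (\<Sum>j<d. \<rho> g $$ (i, j) * \<alpha> h j) (bs ! i))" by (rule act_comb[OF g])
    finally have "translate (g \<circ> h) c h = (\<Sum>i<d. (\<Sum>j<d. \<rho> g $$ (i, j) * \<alpha> h j) * (bs ! i) h)"
      by (simp add: sum_galg_apply fun_scale_def)
    then show "(\<Sum>i<d. (\<Sum>j<d. \<rho> g $$ (i, j) * \<alpha> h j) * (bs ! i) h) = c (inv' h \<circ> inv' g \<circ> h)"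
      by (simp add: translate_def inv_comp[OF g h])
  qed
  also have "\<dots> = class_sum n (row_of \<mu>) (col_of \<mu>) (inv' g)" by (simp add: class_sum_def)
  finally show ?thesis by (simp add: class_sum_inv[OF g])
qed

lemma scalar_dim: "\<kappa> * of_nat d = fact n"
proof -
  have "class_sum n (row_of \<mu>) (col_of \<mu>) id = (\<Sum>h\<in>perms n. 1)"
    unfolding class_sum_def by (intro sum.cong refl) (simp add: comp_cancel(2)[of _ "{1..n}"] ysym_id)
  also have "\<dots> = fact n" by (simp add: card_permutations[of "{1..n}" n])
  finally show ?thesis using trace_scaled[OF permutes_id] by (simp add: rho_id)
qed

lemma dim_pos: "d > 0" and scalar_eq: "\<kappa> = fact n / of_nat d"
proof -
  have "fact n \<noteq> (0::complex)" by simp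
  then show d: "d > 0" using scalar_dim by (intro gr0I) auto
  show "\<kappa> = fact n / of_nat d" unfolding scalar_dim[symmetric] using d by simp
qed

lemma trace_rho:
  assumes g: "g permutes {1..n}"
  shows "(\<Sum>i<d. \<rho> g $$ (i, i)) = of_nat d * class_sum n (row_of \<mu>) (col_of \<mu>) g / fact n"
  using trace_scaled[OF g] scalar_eq dim_pos by (simp add: field_simps)

lemma dim_eq: "specht_dim \<mu> = d"
  unfolding specht_dim_def bs(3)[symmetric]
  using galg.dim_span_eq_card_independent[OF bs(2)] bs(1) by (simp add: distinct_card)

text \<open>The translates of c by the elements of A are linearly independent: their values at the
  points of A form an identity matrix.\<close>

lemma card_le_dim:
  assumes A: "A \<subseteq> perms n" and free: "\<And>g h. g \<in> A \<Longrightarrow> h \<in> A \<Longrightarrow> g \<noteq> h \<Longrightarrow> c (inv' h \<circ> g) = 0"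
  shows "card A \<le> d"
proof -
  have fin: "finite A" using finite_subset[OF A finite_perms] .
  have ev: "translate h c g = (if g = h then 1 else 0)" if "g \<in> A" "h \<in> A" for g h
    using free[OF that] A that(2) ysym_id by (auto simp: translate_def comp_cancel(2)[of _ "{1..n}"] subset_iff)
  have inj: "inj_on (\<lambda>h. translate h c) A"
  proof (rule inj_onI)
    fix g h assume "g \<in> A" "h \<in> A" "translate g c = translate h c"
    then show "g = h" using ev[of g g] ev[of g h] by (auto split: if_splits)
  qed
  have "galg.independent ((\<lambda>h. translate h c) ` A)"
  proof (rule galg.independent_if_scalars_zero[OF finite_imageI[OF fin]])
    fix u v assume z: "(\<Sum>x\<in>(\<lambda>h. translate h c) ` A. fun_scale (u x) x) = 0" and "v \<in> (\<lambda>h. translate h c) ` A"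
    then obtain g where g: "g \<in> A" "v = translate g c" by blast
    have "0 = (\<Sum>h\<in>A. fun_scale (u (translate h c)) (translate h c)) g"
      using z by (simp add: sum.reindex[OF inj] zero_fun_def)
    also have "\<dots> = (\<Sum>h\<in>A. if g = h then u (translate h c) else 0)"
      unfolding sum_galg_apply fun_scale_def using ev[OF g(1)] by (intro sum.cong refl) simp
    also have "\<dots> = u v" using g fin by simp
    finally show "u v = 0" by simp
  qed
  moreover have "(\<lambda>h. translate h c) ` A \<subseteq> galg.span (set bs)"
  proof (rule image_subsetI)
    fix h assume "h \<in> A"
    then have "h permutes {1..n}" using A by blast
    then show "translate h c \<in> galg.span (set bs)"
      unfolding translate_c[OF \<open>h permutes _\<close>] by (intro galg.span_sum galg.span_scale galg.span_base) simp
  qed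
  ultimately have "card ((\<lambda>h. translate h c) ` A) \<le> card (set bs)"
    using galg.independent_span_bound[of "set bs"] by blast
  then show ?thesis using card_image[OF inj] distinct_card[OF bs(1)] by simp
qed

end

lemma specht_form_exists:
  assumes mu: "\<mu> \<in> partitions n"
  obtains bs where "specht_form \<mu> (specht_rep \<mu>) bs n"
proof -
  have n: "sum_list \<mu> = n" using mu by (simp add: partitions_def)
  obtain bs where "distinct bs" "galg.independent (set bs)" "galg.span (set bs) = specht_module \<mu>"
    "\<forall>g\<in>Sym n. specht_rep \<mu> g \<in> carrier_mat (length bs) (length bs) \<and>
           (\<forall>j<length bs. translate g (bs ! j) =
              (\<Sum>i<length bs. fun_scale (specht_rep \<mu> g $$ (i, j)) (bs ! i)))"
    using specht_rep_matrix_form[of \<mu>] unfolding matrix_form_def n by blast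
  then have "specht_form \<mu> (specht_rep \<mu>) bs n"
    using partition_tableau[OF mu] n by (intro specht_form.intro) (simp_all add: Sym_eq)
  then show ?thesis by (rule that)
qed

text \<open>The normalization makes the value at the identity 1. Taking the real part loses nothing,
  because the symmetrizer has values in {0, 1, -1}; see \<open>class_sum_psi\<close>.\<close>

definition psi :: "nat list \<Rightarrow> (nat \<Rightarrow> nat) \<Rightarrow> real" where
  "psi \<mu> g = Re (class_sum (sum_list \<mu>) (row_of \<mu>) (col_of \<mu>) g) / fact (sum_list \<mu>)"

definition chi :: "nat list \<Rightarrow> (nat \<Rightarrow> nat) \<Rightarrow> real" where
  "chi \<mu> g = real (specht_dim \<mu>) * psi \<mu> g"

lemma sum_list_partition: "\<mu> \<in> partitions n \<Longrightarrow> sum_list \<mu> = n" by (simp add: partitions_def)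

lemma class_sum_psi:
  assumes mu: "\<mu> \<in> partitions n"
  shows "class_sum n (row_of \<mu>) (col_of \<mu>) g = of_real (fact n * psi \<mu> g)"
proof -
  interpret tableau n "row_of \<mu>" "col_of \<mu>" by (rule partition_tableau[OF mu])
  have "Im (ysym n (row_of \<mu>) (col_of \<mu>) x) = 0" for x using ysym_cases[of x] by auto
  then have "Im (class_sum n (row_of \<mu>) (col_of \<mu>) g) = 0" by (simp add: class_sum_def)
  then show ?thesis by (simp add: psi_def sum_list_partition[OF mu] complex_eq_iff)
qed

lemma psi_conj: "\<mu> \<in> partitions n \<Longrightarrow> h permutes {1..n} \<Longrightarrow> psi \<mu> (h \<circ> g \<circ> inv' h) = psi \<mu> g"
  by (simp add: psi_def class_sum_conj sum_list_partition)

lemma psi_inv: "\<mu> \<in> partitions n \<Longrightarrow> g permutes {1..n} \<Longrightarrow> psi \<mu> (inv' g) = psi \<mu> g"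
  by (simp add: psi_def class_sum_inv sum_list_partition)

lemma specht_dim_pos: 
  assumes "\<mu> \<in> partitions n" shows "specht_dim \<mu> > 0"
proof (rule specht_form_exists[OF assms])
  fix bs assume b: "specht_form \<mu> (specht_rep \<mu>) bs n"
  show ?thesis using specht_form.dim_pos[OF b] by (simp only: specht_form.dim_eq[OF b])
qed

lemma specht_scalar: 
  assumes "\<mu> \<in> partitions n" 
  shows "ysym_scalar n (row_of \<mu>) (col_of \<mu>) = of_real (fact n / real (specht_dim \<mu>))"
  by (rule specht_form_exists[OF assms]) (simp add: specht_form.scalar_eq specht_form.dim_eq)

lemma psi_id: 
  assumes mu: "\<mu> \<in> partitions n" shows "psi \<mu> id = 1"
proof -
  interpret tableau n "row_of \<mu>" "col_of \<mu>" by (rule partition_tableau[OF mu])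
  have "class_sum n (row_of \<mu>) (col_of \<mu>) id = (\<Sum>h\<in>perms n. 1)"
    unfolding class_sum_def by (intro sum.cong refl) (simp add: comp_cancel(2)[of _ "{1..n}"] ysym_id)
  also have "\<dots> = fact n" by (simp add: card_permutations[of "{1..n}" n])
  finally show ?thesis by (simp add: psi_def sum_list_partition[OF mu])
qed

text \<open>The idempotent relation \<open>class_sum_square\<close> with \<kappa> = n! / dim
  inserted. Read from right to left it writes a character as a convolution square, which is the
  source of positivity in \<open>psi_restrict_nonneg\<close>.\<close>

lemma psi_conv:
  assumes mu: "\<mu> \<in> partitions n" and p: "p permutes {1..n}"
  shows "(\<Sum>q\<in>perms n. psi \<mu> q * psi \<mu> (inv' q \<circ> p)) = fact n / (real (specht_dim \<mu>))\<^sup>2 * psi \<mu> p"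
proof -
  interpret tableau n "row_of \<mu>" "col_of \<mu>" by (rule partition_tableau[OF mu])
  have "complex_of_real (\<Sum>q\<in>perms n. (fact n * psi \<mu> q) * (fact n * psi \<mu> (inv' q \<circ> p))) =
    of_real ((fact n / real (specht_dim \<mu>))\<^sup>2 * (fact n * psi \<mu> p))"
    using class_sum_square[OF p] unfolding specht_scalar[OF mu] class_sum_psi[OF mu]
    by (simp only: of_real_sum of_real_mult of_real_power)
  then have "(\<Sum>q\<in>perms n. (fact n * psi \<mu> q) * (fact n * psi \<mu> (inv' q \<circ> p))) =
    (fact n / real (specht_dim \<mu>))\<^sup>2 * (fact n * psi \<mu> p)" by (simp only: of_real_eq_iff)
  moreover have "(\<Sum>q\<in>perms n. (fact n * psi \<mu> q) * (fact n * psi \<mu> (inv' q \<circ> p))) =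
    (fact n)\<^sup>2 * (\<Sum>q\<in>perms n. psi \<mu> q * psi \<mu> (inv' q \<circ> p))"
    by (simp add: sum_distrib_left power2_eq_square mult_ac)
  ultimately have "(fact n)\<^sup>2 * (\<Sum>q\<in>perms n. psi \<mu> q * psi \<mu> (inv' q \<circ> p)) =
    (fact n)\<^sup>2 * (fact n / (real (specht_dim \<mu>))\<^sup>2 * psi \<mu> p)" by (simp add: power_divide field_simps)
  then show ?thesis by (subst (asm) mult_cancel_left) simp
qed

lemma psi_square_sum:
  assumes mu: "\<mu> \<in> partitions n"
  shows "(\<Sum>q\<in>perms n. (psi \<mu> q)\<^sup>2) = fact n / (real (specht_dim \<mu>))\<^sup>2"
  using psi_conv[OF mu permutes_id] by (simp add: psi_inv[OF mu] psi_id[OF mu] power2_eq_square)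

lemma psi_orthogonal:
  assumes l: "\<nu> \<in> partitions n" and m: "\<mu> \<in> partitions n" and ne: "\<nu> \<noteq> \<mu>"
  shows "(\<Sum>q\<in>perms n. psi \<nu> q * psi \<mu> q) = 0"
proof -
  have "complex_of_real (\<Sum>q\<in>perms n. (fact n * psi \<nu> q) * (fact n * psi \<mu> q)) = of_real 0"
    using class_sum_partitions_orthogonal[OF l m ne] unfolding class_sum_psi[OF l] class_sum_psi[OF m]
    by (simp only: of_real_sum of_real_mult of_real_0)
  then have "(\<Sum>q\<in>perms n. (fact n * psi \<nu> q) * (fact n * psi \<mu> q)) = 0" by (simp only: of_real_eq_iff)
  moreover have "(\<Sum>q\<in>perms n. (fact n * psi \<nu> q) * (fact n * psi \<mu> q)) =
    (fact n)\<^sup>2 * (\<Sum>q\<in>perms n. psi \<nu> q * psi \<mu> q)"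
    by (simp add: sum_distrib_left power2_eq_square mult_ac)
  ultimately show ?thesis by simp
qed

lemma chi_orthonormal:
  assumes l: "\<nu> \<in> partitions n" and m: "\<mu> \<in> partitions n"
  shows "(\<Sum>q\<in>perms n. chi \<nu> q * chi \<mu> q) = (if \<nu> = \<mu> then fact n else 0)"
proof -
  have "(\<Sum>q\<in>perms n. chi \<nu> q * chi \<mu> q) = real (specht_dim \<nu>) * real (specht_dim \<mu>) * (\<Sum>q\<in>perms n. psi \<nu> q * psi \<mu> q)"
    by (simp add: chi_def sum_distrib_left mult_ac)
  then show ?thesis
    using psi_orthogonal[OF l m] psi_square_sum[OF m] specht_dim_pos[OF m] by (simp add: power2_eq_square)
qed

lemma specht_rep_carrier:
  assumes mu: "\<mu> \<in> partitions n" and g: "g permutes {1..n}"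
  shows "specht_rep \<mu> g \<in> carrier_mat (specht_dim \<mu>) (specht_dim \<mu>)"
  by (rule specht_form_exists[OF mu]) (simp add: specht_form.carrier specht_form.dim_eq g)

lemma specht_rep_mult:
  assumes mu: "\<mu> \<in> partitions n" and g: "g permutes {1..n}" "h permutes {1..n}"
  shows "specht_rep \<mu> (g \<circ> h) = specht_rep \<mu> g * specht_rep \<mu> h"
  by (rule specht_form_exists[OF mu]) (simp add: specht_form.rho_mult_mat g)

lemma specht_rep_id:
  assumes mu: "\<mu> \<in> partitions n"
  shows "specht_rep \<mu> id = 1\<^sub>m (specht_dim \<mu>)"
  by (rule specht_form_exists[OF mu]) (simp add: specht_form.rho_id_mat specht_form.dim_eq)

lemma specht_rep_trace:
  assumes mu: "\<mu> \<in> partitions n" and g: "g permutes {1..n}"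
  shows "(\<Sum>i<specht_dim \<mu>. specht_rep \<mu> g $$ (i, i)) = of_real (chi \<mu> g)"
  by (rule specht_form_exists[OF mu]) 
    (simp add: specht_form.trace_rho specht_form.dim_eq g class_sum_psi[OF mu] chi_def)

lemma card_le_specht_dim:
  assumes mu: "\<mu> \<in> partitions n" and A: "A \<subseteq> perms n"
    and free: "\<And>g h. g \<in> A \<Longrightarrow> h \<in> A \<Longrightarrow> g \<noteq> h \<Longrightarrow> ysym n (row_of \<mu>) (col_of \<mu>) (inv' h \<circ> g) = 0"
  shows "card A \<le> specht_dim \<mu>"
  by (rule specht_form_exists[OF mu]) (simp add: specht_form.dim_eq specht_form.card_le_dim[OF _ A free])

text \<open>The symmetrizer has modulus at most 1 and is supported on products p q, so the triangle
  inequality reduces the class sum to a count.\<close>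

lemma abs_psi_le:
  assumes mu: "\<mu> \<in> partitions n"
  shows "\<bar>psi \<mu> g\<bar> \<le> real (card {h\<in>perms n. \<exists>p\<in>fibre_group n (row_of \<mu>). \<exists>q\<in>fibre_group n (col_of \<mu>).
     inv' h \<circ> g \<circ> h = p \<circ> q}) / fact n"
proof -
  interpret tableau n "row_of \<mu>" "col_of \<mu>" by (rule partition_tableau[OF mu])
  let ?S = "{h\<in>perms n. \<exists>p\<in>fibre_group n (row_of \<mu>). \<exists>q\<in>fibre_group n (col_of \<mu>). inv' h \<circ> g \<circ> h = p \<circ> q}"
  let ?c = "ysym n (row_of \<mu>) (col_of \<mu>)"
  have "\<bar>fact n * psi \<mu> g\<bar> = cmod (class_sum n (row_of \<mu>) (col_of \<mu>) g)" by (simp add: class_sum_psi[OF mu] norm_mult abs_mult)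
  also have "\<dots> \<le> (\<Sum>h\<in>perms n. cmod (?c (inv' h \<circ> g \<circ> h)))" unfolding class_sum_def by (rule norm_sum)
  also have "\<dots> = (\<Sum>h\<in>?S. cmod (?c (inv' h \<circ> g \<circ> h)))"
  proof (rule sum.mono_neutral_right)
    show "\<forall>h\<in>perms n - ?S. cmod (?c (inv' h \<circ> g \<circ> h)) = 0"
    proof
      fix h assume h: "h \<in> perms n - ?S"
      have "?c (inv' h \<circ> g \<circ> h) = 0"
      proof (rule ccontr)
        assume "?c (inv' h \<circ> g \<circ> h) \<noteq> 0"
        then obtain p q where "p \<in> fibre_group n (row_of \<mu>)" "q \<in> fibre_group n (col_of \<mu>)" "inv' h \<circ> g \<circ> h = p \<circ> q"
          by (rule ysym_nonzero)
        then show False using h by blast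
      qed
      then show "cmod (?c (inv' h \<circ> g \<circ> h)) = 0" by simp
    qed
  qed (auto simp: finite_perms)
  also have "\<dots> \<le> (\<Sum>h\<in>?S. 1)"
  proof (rule sum_mono)
    fix h show "cmod (?c (inv' h \<circ> g \<circ> h)) \<le> 1" using ysym_cases[of "inv' h \<circ> g \<circ> h"] by auto
  qed
  finally show ?thesis by (simp add: abs_mult field_simps)
qed

section \<open>Conjugacy classes and cycle types\<close>

definition conj_class :: "nat \<Rightarrow> (nat \<Rightarrow> nat) \<Rightarrow> (nat \<Rightarrow> nat) set" where
  "conj_class n g = (\<lambda>h. h \<circ> g \<circ> inv' h) ` perms n"

abbreviation "orb \<equiv> Orbits.orbit"

lemma orb_eq:
  assumes p: "permutation p" and y: "y \<in> orb p x"
  shows "orb p y = orb p x"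
proof
  have x: "x \<in> orb p x" using permutation_self_in_orbit[OF p] .
  have xy: "x \<in> orb p y" using orbit_swap[OF x y] .
  show "orb p y \<subseteq> orb p x" using y by (auto intro: orbit_trans)
  show "orb p x \<subseteq> orb p y" using xy by (auto intro: orbit_trans)
qed

text \<open>\<open>h\<close> conjugates the row rotations of the tableau of shape \<open>\<mu>\<close> into \<open>p\<close>.\<close>

definition rotates :: "nat \<Rightarrow> (nat \<Rightarrow> nat) \<Rightarrow> nat list \<Rightarrow> (nat \<Rightarrow> nat) \<Rightarrow> bool" where
  "rotates n p \<mu> h \<longleftrightarrow> h permutes {1..n} \<and>
     (\<forall>r<length \<mu>. \<forall>c<\<mu> ! r. p (h (tab_entry \<mu> r c)) = h (tab_entry \<mu> r ((c + 1) mod \<mu> ! r)))"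

text \<open>The parts are the orbit sizes, fixed points included, in decreasing order. The cell in
  row r and column c goes to the c-th iterate of p at a base point of the r-th orbit, so a step to
  the right in a row is an application of p.\<close>

lemma cycle_type_exists:
  assumes p: "p permutes {1..n}"
  shows "\<exists>\<mu>\<in>partitions n. \<exists>h. rotates n p \<mu> h"
proof -
  have pp: "permutation p" using p by (auto simp: permutation_permutes)
  define Orbs where "Orbs = orb p ` {1..n}"
  have finOrbs: "finite Orbs" by (simp add: Orbs_def)
  obtain os where os: "set os = Orbs" "distinct os" using finite_distinct_list[OF finOrbs] by blast
  define L where "L = rev (sort_key card os)"
  have L: "set L = Orbs" "distinct L" using os by (auto simp: L_def)
  define \<mu> where "\<mu> = map card L"
  have self: "x \<in> orb p x" for x by (rule permutation_self_in_orbit[OF pp])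
  have finO: "finite (orb p x)" for x by (rule finite_orbit[OF self])
  have subO: "orb p x \<subseteq> {1..n}" if "x \<in> {1..n}" for x by (rule permutes_orbit_subset[OF p that])
  have UO: "\<Union>Orbs = {1..n}" unfolding Orbs_def using subO self by blast
  have disj: "disjoint Orbs"
  proof (rule disjointI)
    fix A B assume AB: "A \<in> Orbs" "B \<in> Orbs" "A \<noteq> B"
    then obtain a b where ab: "A = orb p a" "B = orb p b" by (auto simp: Orbs_def)
    show "A \<inter> B = {}"
    proof (rule ccontr)
      assume "A \<inter> B \<noteq> {}"
      then obtain z where "z \<in> orb p a" "z \<in> orb p b" using ab by blast
      then have "orb p a = orb p b" using orb_eq[OF pp] by metis
      then show False using AB ab by simp
    qed
  qed
  have sum: "sum_list \<mu> = n"
  proof -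
    have "sum_list \<mu> = (\<Sum>A\<in>Orbs. card A)" unfolding \<mu>_def using L by (metis sum_list_distinct_conv_sum_set)
    also have "\<dots> = card (\<Union>Orbs)"
      by (rule card_Union_disjoint[symmetric, OF disj]) (auto simp: Orbs_def finO)
    finally show ?thesis by (simp add: UO)
  qed
  have mu: "\<mu> \<in> partitions n"
  proof -
    have "sorted (map card (sort_key card os))" by simp
    then have "sorted_wrt (\<ge>) \<mu>" unfolding \<mu>_def L_def by (simp only: rev_map[symmetric] sorted_wrt_rev)
    moreover have "0 \<notin> set \<mu>" 
    proof
      assume "0 \<in> set \<mu>"
      then obtain x where "card (orb p x) = 0" using L(1) by (auto simp: \<mu>_def Orbs_def)
      then show False using finO self[of x] by (metis card_eq_0_iff empty_iff)
    qed
    ultimately show ?thesis using sum by (simp add: partitions_def)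
  qed
  define b where "b A = (SOME x. x \<in> A)" for A :: "nat set"
  have Lr: "L ! r \<in> Orbs" if "r < length \<mu>" for r using L(1) that by (auto simp: \<mu>_def)
  have bL: "L ! r = orb p (b (L ! r))" if r: "r < length \<mu>" for r
  proof -
    obtain a where a: "L ! r = orb p a" using Lr[OF r] by (auto simp: Orbs_def)
    then have "b (L ! r) \<in> L ! r" unfolding b_def using self someI[of "\<lambda>x. x \<in> L ! r" a] by simp
    then show ?thesis using orb_eq[OF pp] a by metis
  qed
  have cardd: "\<mu> ! r = funpow_dist1 p (b (L ! r)) (b (L ! r))" if r: "r < length \<mu>" for r
  proof -
    have "\<mu> ! r = card (orb p (b (L ! r)))" using r bL[OF r] by (simp add: \<mu>_def)
    also have "\<dots> = funpow_dist1 p (b (L ! r)) (b (L ! r))"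
      using orbit_conv_funpow_dist1[OF self, of "b (L ! r)"] card_image[OF inj_on_funpow_dist1[OF self, of "b (L ! r)"]] by simp
    finally show ?thesis .
  qed
  have per: "(p ^^ (\<mu> ! r)) (b (L ! r)) = b (L ! r)" if r: "r < length \<mu>" for r
    unfolding cardd[OF r] by (rule funpow_dist1_prop[OF self])
  have injp: "i = j" if r: "r < length \<mu>" and "i < \<mu> ! r" "j < \<mu> ! r" "(p ^^ i) (b (L ! r)) = (p ^^ j) (b (L ! r))" for r i j
    using inj_onD[OF inj_on_funpow_dist1[OF self, of "b (L ! r)"] that(4)] that cardd[OF r] by simp
  define h where "h x = (if x \<in> {1..n} then (p ^^ (col_of \<mu> x)) (b (L ! row_of \<mu> x)) else x)" for x
  have hin: "h x \<in> L ! row_of \<mu> x" if x: "x \<in> {1..n}" for x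
  proof -
    have "row_of \<mu> x < length \<mu>" using pos_tab_entry(1)[of x \<mu>] x sum by simp
    from bL[OF this] show ?thesis using x funpow_in_orbit[OF self] by (metis h_def)
  qed
  have hperm: "h permutes {1..n}"
  proof (rule inj_imp_permutes)
    show "inj_on h {1..n}"
    proof (rule inj_onI)
      fix x y assume x: "x \<in> {1..n}" and y: "y \<in> {1..n}" and e: "h x = h y"
      have px: "row_of \<mu> x < length \<mu>" "col_of \<mu> x < \<mu> ! row_of \<mu> x" "tab_entry \<mu> (row_of \<mu> x) (col_of \<mu> x) = x"
        using pos_tab_entry[of x \<mu>] x sum by (simp_all del: atLeastAtMost_iff)
      have py: "row_of \<mu> y < length \<mu>" "col_of \<mu> y < \<mu> ! row_of \<mu> y" "tab_entry \<mu> (row_of \<mu> y) (col_of \<mu> y) = y"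
        using pos_tab_entry[of y \<mu>] y sum by (simp_all del: atLeastAtMost_iff)
      have "L ! row_of \<mu> x = L ! row_of \<mu> y"
        using hin[OF x] hin[OF y] e Lr[OF px(1)] Lr[OF py(1)] disj by (metis disjointD disjoint_iff)
      then have r: "row_of \<mu> x = row_of \<mu> y"
        using nth_eq_iff_index_eq[OF L(2)] px(1) py(1) by (simp add: \<mu>_def)
      have "col_of \<mu> x = col_of \<mu> y"
        by (rule injp[OF px(1)]) (use px py r e x y in \<open>simp_all add: h_def\<close>)
      then show "x = y" using r px(3) py(3) by metis
    qed
    show "h x \<in> {1..n}" if x: "x \<in> {1..n}" for x
    proof -
      have "row_of \<mu> x < length \<mu>" using pos_tab_entry(1)[of x \<mu>] x sum by simp
      then show ?thesis using hin[OF x] Lr UO by blast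
    qed
  qed (auto simp: h_def)
  have "p (h (tab_entry \<mu> r c)) = h (tab_entry \<mu> r ((c + 1) mod \<mu> ! r))" if r: "r < length \<mu>" and c: "c < \<mu> ! r" for r c
  proof -
    have c': "(c + 1) mod \<mu> ! r < \<mu> ! r" using c by simp
    note t = tab_entry_pos[OF r c] and t' = tab_entry_pos[OF r c']
    have "p (h (tab_entry \<mu> r c)) = (p ^^ (c + 1)) (b (L ! r))" using t sum by (simp add: h_def flip: Suc_eq_plus1)
    also have "\<dots> = (p ^^ ((c + 1) mod \<mu> ! r)) (b (L ! r))" by (rule funpow_mod_eq[OF per[OF r], symmetric])
    also have "\<dots> = h (tab_entry \<mu> r ((c + 1) mod \<mu> ! r))" using t' sum by (simp add: h_def)
    finally show ?thesis .
  qed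
  then show ?thesis using mu hperm by (auto simp: rotates_def)
qed

text \<open>The rotation of the rows is h^-1 p h as well as k^-1 q k, so k h^-1 conjugates p into
  q.\<close>

lemma same_type_conj:
  assumes p: "p permutes {1..n}" and q: "q permutes {1..n}" and n: "sum_list \<mu> = n"
    and h: "rotates n p \<mu> h" and k: "rotates n q \<mu> k"
  shows "\<exists>g. g permutes {1..n} \<and> q = g \<circ> p \<circ> inv' g"
proof -
  have hp: "h permutes {1..n}" and kp: "k permutes {1..n}" using h k by (auto simp: rotates_def)
  have "inv' h (p (h x)) = inv' k (q (k x))" for x
  proof (cases "x \<in> {1..n}")
    case True
    then have t: "row_of \<mu> x < length \<mu>" "col_of \<mu> x < \<mu> ! row_of \<mu> x" "tab_entry \<mu> (row_of \<mu> x) (col_of \<mu> x) = x"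
      using pos_tab_entry[of x \<mu>] n by (simp_all del: atLeastAtMost_iff)
    let ?y = "tab_entry \<mu> (row_of \<mu> x) ((col_of \<mu> x + 1) mod \<mu> ! row_of \<mu> x)"
    have "p (h x) = h ?y" "q (k x) = k ?y" using h k t unfolding rotates_def by metis+
    then show ?thesis by (simp add: comp_cancel(7)[OF hp] comp_cancel(7)[OF kp])
  next
    case False
    then show ?thesis using hp kp p q 
      by (simp add: permutes_not_in[of h] permutes_not_in[of k] permutes_not_in[of p] permutes_not_in[of q]
          permutes_not_in[OF permutes_inv[OF hp]] permutes_not_in[OF permutes_inv[OF kp]] del: atLeastAtMost_iff)
  qed
  then have e: "q (k x) = k (inv' h (p (h x)))" for x by (metis comp_cancel(6)[OF kp])
  have "q = (k \<circ> inv' h) \<circ> p \<circ> inv' (k \<circ> inv' h)"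
  proof
    fix y show "q y = ((k \<circ> inv' h) \<circ> p \<circ> inv' (k \<circ> inv' h)) y"
      using e[of "inv' k y"] by (simp add: inv_comp[OF kp permutes_inv[OF hp]] comp_cancel[OF hp] comp_cancel[OF kp])
  qed
  then show ?thesis using permutes_compose[OF permutes_inv[OF hp] kp] by blast
qed

lemma conj_class_self: "g \<in> conj_class n g"
  unfolding conj_class_def by (rule image_eqI[of _ _ id]) (simp_all add: permutes_id inv_id)

lemma conj_class_perms: "g permutes {1..n} \<Longrightarrow> conj_class n g \<subseteq> perms n"
  unfolding conj_class_def by (auto intro!: permutes_compose permutes_inv)

lemma conj_class_conj:
  assumes g: "g permutes {1..n}" and k: "k permutes {1..n}"
  shows "conj_class n (k \<circ> g \<circ> inv' k) = conj_class n g"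
proof -
  have sub: "conj_class n (k \<circ> g \<circ> inv' k) \<subseteq> conj_class n g" if k: "k permutes {1..n}" for g k
  proof
    fix x assume "x \<in> conj_class n (k \<circ> g \<circ> inv' k)"
    then obtain h where h: "h permutes {1..n}" "x = h \<circ> (k \<circ> g \<circ> inv' k) \<circ> inv' h" by (auto simp: conj_class_def)
    then have "x = (h \<circ> k) \<circ> g \<circ> inv' (h \<circ> k)" by (simp add: inv_comp[OF h(1) k] comp_assoc)
    then show "x \<in> conj_class n g" using permutes_compose[OF k h(1)] unfolding conj_class_def by blast
  qed
  have "inv' k \<circ> (k \<circ> g \<circ> inv' k) \<circ> inv' (inv' k) = g"
    using k by (simp add: comp_cancel(5)[OF k] comp_assoc comp_cancel[OF k])
  then show ?thesis using sub[OF k, of g] sub[OF permutes_inv[OF k], of "k \<circ> g \<circ> inv' k"] by auto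
qed

lemma conj_class_eq:
  assumes "g permutes {1..n}" "x \<in> conj_class n g" shows "conj_class n x = conj_class n g"
proof -
  obtain h where "h permutes {1..n}" "x = h \<circ> g \<circ> inv' h" using assms(2) unfolding conj_class_def by blast
  then show ?thesis using conj_class_conj[OF assms(1)] by simp
qed

text \<open>A class is determined by a cycle type of its members. In
  \<open>column_orthogonality\<close> this bounds the number of columns of the character table by
  the number of its rows.\<close>

lemma card_conj_classes: "card (conj_class n ` perms n) \<le> card (partitions n)"
proof -
  define T where "T p = (SOME \<mu>. \<mu> \<in> partitions n \<and> (\<exists>h. rotates n p \<mu> h))" for p
  have T: "T p \<in> partitions n \<and> (\<exists>h. rotates n p (T p) h)" if "p permutes {1..n}" for p
    unfolding T_def by (rule someI_ex) (use cycle_type_exists[OF that] in blast)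
  have TT: "conj_class n p = conj_class n q" if pq: "p permutes {1..n}" "q permutes {1..n}" "T p = T q" for p q
  proof -
    obtain h where h: "rotates n p (T p) h" using T[OF pq(1)] by blast
    obtain k where k: "rotates n q (T p) k" using T[OF pq(2)] pq(3) by metis
    have "sum_list (T p) = n" using T[OF pq(1)] by (simp add: partitions_def)
    from same_type_conj[OF pq(1,2) this h k]
    obtain g where "g permutes {1..n}" "q = g \<circ> p \<circ> inv' g" by blast
    then show ?thesis using conj_class_conj[OF pq(1)] by simp
  qed
  define R where "R \<mu> = conj_class n (SOME p. p permutes {1..n} \<and> T p = \<mu>)" for \<mu>
  have "conj_class n p = R (T p)" if p: "p permutes {1..n}" for p
  proof -
    have "(SOME q. q permutes {1..n} \<and> T q = T p) permutes {1..n} \<and> T (SOME q. q permutes {1..n} \<and> T q = T p) = T p"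
      by (rule someI[of "\<lambda>q. q permutes {1..n} \<and> T q = T p" p]) (simp add: p)
    then show ?thesis unfolding R_def using TT[OF p] by simp
  qed
  then have "conj_class n ` perms n \<subseteq> R ` partitions n" using T by blast
  then show ?thesis using finite_nonempty_partitions[of n] by (meson card_image_le card_mono finite_imageI le_trans)
qed

section \<open>Column orthogonality and restriction to smaller symmetric groups\<close>

lemma chi_conj: "\<mu> \<in> partitions n \<Longrightarrow> h permutes {1..n} \<Longrightarrow> chi \<mu> (h \<circ> g \<circ> inv' h) = chi \<mu> g"
  by (simp add: chi_def psi_conj)

lemma class_fun_eq:
  fixes F :: "(nat \<Rightarrow> nat) \<Rightarrow> real"
  assumes "\<And>g h. g permutes {1..n} \<Longrightarrow> h permutes {1..n} \<Longrightarrow> F (h \<circ> g \<circ> inv' h) = F g"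
    and "g permutes {1..n}" "x \<in> conj_class n g"
  shows "F x = F g"
proof -
  obtain h where "h permutes {1..n}" "x = h \<circ> g \<circ> inv' h" using assms(3) unfolding conj_class_def by blast
  then show ?thesis using assms(1)[OF assms(2)] by simp
qed

lemma conj_class_eq_iff:
  assumes "g permutes {1..n}" "h permutes {1..n}"
  shows "conj_class n h = conj_class n g \<longleftrightarrow> h \<in> conj_class n g"
  using conj_class_eq[OF assms(1)] conj_class_self[of h n] by blast

lemma finite_conj_class: "finite (conj_class n g)"
  unfolding conj_class_def by (rule finite_imageI[OF finite_perms])

lemma card_conj_class_pos: "card (conj_class n g) > 0"
  using conj_class_self[of g n] finite_conj_class card_gt_0_iff by blast

lemma sum_by_classes:
  fixes F :: "(nat \<Rightarrow> nat) \<Rightarrow> real"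
  assumes F: "\<And>g h. g permutes {1..n} \<Longrightarrow> h permutes {1..n} \<Longrightarrow> F (h \<circ> g \<circ> inv' h) = F g"
    and rep: "\<And>C. C \<in> conj_class n ` perms n \<Longrightarrow> rep C \<in> C"
  shows "(\<Sum>q\<in>perms n. F q) = (\<Sum>C\<in>conj_class n ` perms n. real (card C) * F (rep C))"
proof -
  have "(\<Sum>q\<in>perms n. F q) = (\<Sum>C\<in>conj_class n ` perms n. \<Sum>q\<in>{q\<in>perms n. conj_class n q = C}. F q)"
    by (rule sum.image_gen[OF finite_perms])
  also have "\<dots> = (\<Sum>C\<in>conj_class n ` perms n. real (card C) * F (rep C))"
  proof (rule sum.cong[OF refl])
    fix C assume C: "C \<in> conj_class n ` perms n"
    then obtain g where g: "g permutes {1..n}" "C = conj_class n g" by blast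
    have e: "{q\<in>perms n. conj_class n q = C} = C"
      using conj_class_eq_iff[OF g(1)] conj_class_perms[OF g(1)] g(2) by blast
    have "F q = F (rep C)" if "q \<in> C" for q
      using class_fun_eq[of n F g, OF F g(1)] that rep[OF C] g(2) by metis
    then have "(\<Sum>q\<in>C. F q) = (\<Sum>q\<in>C. F (rep C))" by (intro sum.cong) auto
    then show "(\<Sum>q\<in>{q\<in>perms n. conj_class n q = C}. F q) = real (card C) * F (rep C)" unfolding e by simp
  qed
  finally show ?thesis .
qed

text \<open>Row orthogonality says A B = 1 for the character table A and its transpose B weighted by
  class sizes over n!. For square matrices B A = 1 follows, which is column orthogonality. Zero
  columns of A and zero rows of B pad the table to a square one.\<close>

lemma column_orthogonality:
  assumes g: "g permutes {1..n}" and h: "h permutes {1..n}"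
  shows "real (card (conj_class n g)) * (\<Sum>\<mu>\<in>partitions n. chi \<mu> g * chi \<mu> h) =
    (if h \<in> conj_class n g then fact n else 0)"
proof -
  have finP: "finite (partitions n)" using finite_nonempty_partitions by blast
  obtain ps where ps: "set ps = partitions n" "distinct ps" using finite_distinct_list[OF finP] by blast
  define Cl where "Cl = conj_class n ` perms n"
  have finC: "finite Cl" by (simp add: Cl_def finite_perms)
  obtain cs where cs: "set cs = Cl" "distinct cs" using finite_distinct_list[OF finC] by blast
  define N where "N = length ps"
  have le: "length cs \<le> N"
    using card_conj_classes[of n] distinct_card[OF ps(2)] distinct_card[OF cs(2)] ps(1) cs(1) by (simp add: Cl_def N_def)
  define rep where "rep C = (SOME x. x \<in> C)" for C :: "(nat \<Rightarrow> nat) set"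
  have rep: "rep C \<in> C" if "C \<in> Cl" for C 
    using that someI[of "\<lambda>x. x \<in> C"] conj_class_self by (auto simp: rep_def Cl_def)
  define A where "A = mat N N (\<lambda>(i, j). if j < length cs then chi (ps ! i) (rep (cs ! j)) else 0)"
  define B where "B = mat N N (\<lambda>(j, i). if j < length cs then real (card (cs ! j)) * chi (ps ! i) (rep (cs ! j)) / fact n else 0)"
  have AB: "A * B = 1\<^sub>m N"
  proof (rule eq_matI)
    fix i k assume "i < dim_row (1\<^sub>m N :: real mat)" "k < dim_col (1\<^sub>m N :: real mat)"
    then have i: "i < N" and k: "k < N" by auto
    have pi: "ps ! i \<in> partitions n" "ps ! k \<in> partitions n"
      using nth_mem[of i ps] nth_mem[of k ps] i k unfolding ps(1) N_def by blast+
    have "(A * B) $$ (i, k) = (\<Sum>j<N. A $$ (i, j) * B $$ (j, k))"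
      using i k by (simp add: A_def B_def scalar_prod_def atLeast0LessThan)
    also have "\<dots> = (\<Sum>j<length cs. real (card (cs ! j)) * (chi (ps ! i) (rep (cs ! j)) * chi (ps ! k) (rep (cs ! j))) / fact n)"
      using i k le by (intro sum.mono_neutral_cong_right) (auto simp: A_def B_def)
    also have "\<dots> = (\<Sum>C\<in>Cl. real (card C) * (chi (ps ! i) (rep C) * chi (ps ! k) (rep C)) / fact n)"
      using sum.reindex_bij_betw[OF bij_betw_nth[OF cs(2) refl refl], of "\<lambda>C. real (card C) * (chi (ps ! i) (rep C) * chi (ps ! k) (rep C)) / fact n"] cs(1)
      by simp
    also have "\<dots> = (\<Sum>q\<in>perms n. chi (ps ! i) q * chi (ps ! k) q) / fact n"
      unfolding Cl_def sum_divide_distrib[symmetric]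
      by (subst sum_by_classes[of n "\<lambda>q. chi (ps ! i) q * chi (ps ! k) q" rep]) (use pi rep in \<open>simp_all add: chi_conj Cl_def\<close>)
    also have "\<dots> = (if i = k then 1 else 0)"
      using chi_orthonormal[OF pi] nth_eq_iff_index_eq[OF ps(2)] i k by (simp add: N_def)
    finally show "(A * B) $$ (i, k) = 1\<^sub>m N $$ (i, k)" using i k by simp
  qed (simp_all add: A_def B_def)
  have BA: "B * A = 1\<^sub>m N"
    by (rule mat_mult_left_right_inverse[OF _ _ AB]) (simp_all add: A_def B_def)
  obtain j where j: "j < length cs" "cs ! j = conj_class n g" using cs(1) g by (metis Cl_def imageI in_set_conv_nth mem_Collect_eq)
  obtain k where k: "k < length cs" "cs ! k = conj_class n h" using cs(1) h by (metis Cl_def imageI in_set_conv_nth mem_Collect_eq)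
  have jN: "j < N" "k < N" using j k le by auto
  have chr: "chi \<mu> (rep (conj_class n g)) = chi \<mu> g" if "\<mu> \<in> partitions n" "g permutes {1..n}" for \<mu> g
    by (rule class_fun_eq[of n "chi \<mu>" g]) (use that rep[of "conj_class n g"] in \<open>auto simp: chi_conj Cl_def\<close>)
  have "(B * A) $$ (j, k) = (\<Sum>i<N. B $$ (j, i) * A $$ (i, k))"
    using jN by (simp add: A_def B_def scalar_prod_def atLeast0LessThan)
  also have "\<dots> = (\<Sum>i<N. real (card (conj_class n g)) * (chi (ps ! i) g * chi (ps ! i) h) / fact n)"
  proof (rule sum.cong[OF refl])
    fix i assume "i \<in> {..<N}"
    then have "i < N" "ps ! i \<in> partitions n" using nth_mem[of i ps] unfolding ps(1) N_def by blast+
    then show "B $$ (j, i) * A $$ (i, k) = real (card (conj_class n g)) * (chi (ps ! i) g * chi (ps ! i) h) / fact n"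
      using jN j k g h by (simp add: A_def B_def chr)
  qed
  also have "\<dots> = (\<Sum>\<mu>\<in>partitions n. real (card (conj_class n g)) * (chi \<mu> g * chi \<mu> h) / fact n)"
    using sum.reindex_bij_betw[OF bij_betw_nth[OF ps(2) refl refl], of "\<lambda>\<mu>. real (card (conj_class n g)) * (chi \<mu> g * chi \<mu> h) / fact n"] ps(1)
    by (simp add: N_def)
  finally have "real (card (conj_class n g)) * (\<Sum>\<mu>\<in>partitions n. chi \<mu> g * chi \<mu> h) / fact n = (if j = k then 1 else 0)"
    using jN unfolding BA by (simp add: sum_distrib_left sum_divide_distrib)
  moreover have "j = k \<longleftrightarrow> h \<in> conj_class n g"
    using nth_eq_iff_index_eq[OF cs(2) j(1) k(1)] j(2) k(2) conj_class_eq_iff[OF g h] by auto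
  ultimately show ?thesis by (auto simp: field_simps)
qed

lemma chi_square_sum:
  assumes g: "g permutes {1..n}"
  shows "(\<Sum>\<mu>\<in>partitions n. (chi \<mu> g)\<^sup>2) = fact n / real (card (conj_class n g))"
  using column_orthogonality[OF g g] card_conj_class_pos[of n g] conj_class_self[of g n]
  by (simp add: field_simps power2_eq_square)

text \<open>By column orthogonality, the sum of \<chi>(g) \<chi>(h) over all shapes is n! / |C| for
  h in the class C of g and zero otherwise, so averaging F against it returns F g.\<close>

lemma class_fun_expansion:
  fixes F :: "(nat \<Rightarrow> nat) \<Rightarrow> real"
  assumes F: "\<And>g h. g permutes {1..n} \<Longrightarrow> h permutes {1..n} \<Longrightarrow> F (h \<circ> g \<circ> inv' h) = F g"
    and g: "g permutes {1..n}"
  shows "F g = (\<Sum>\<mu>\<in>partitions n. ((\<Sum>h\<in>perms n. F h * chi \<mu> h) / fact n) * chi \<mu> g)"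
proof -
  let ?k = "real (card (conj_class n g))"
  have k: "?k > 0" using card_conj_class_pos by simp
  have "?k * (\<Sum>\<mu>\<in>partitions n. ((\<Sum>h\<in>perms n. F h * chi \<mu> h) / fact n) * chi \<mu> g) =
    (\<Sum>\<mu>\<in>partitions n. \<Sum>h\<in>perms n. F h / fact n * (?k * (chi \<mu> g * chi \<mu> h)))"
    by (simp add: sum_distrib_left sum_distrib_right sum_divide_distrib mult_ac)
  also have "\<dots> = (\<Sum>h\<in>perms n. F h / fact n * (?k * (\<Sum>\<mu>\<in>partitions n. chi \<mu> g * chi \<mu> h)))"
    by (subst sum.swap) (simp add: sum_distrib_left)
  also have "\<dots> = (\<Sum>h\<in>perms n. if h \<in> conj_class n g then F h else 0)"
    by (intro sum.cong refl) (simp add: column_orthogonality[OF g])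
  also have "\<dots> = (\<Sum>h\<in>conj_class n g. F h)"
    using conj_class_perms[OF g] by (subst sum.inter_restrict[symmetric, OF finite_perms]) (simp add: Int_absorb1)
  also have "\<dots> = (\<Sum>h\<in>conj_class n g. F g)"
    by (intro sum.cong refl class_fun_eq[of n F g, OF F g])
  also have "\<dots> = ?k * F g" by simp
  finally show ?thesis using k by simp
qed

section \<open>Restriction to a smaller symmetric group\<close>

lemma perms_mono: "m \<le> n \<Longrightarrow> p permutes {1..m} \<Longrightarrow> p permutes {1..n :: nat}"
  by (erule permutes_subset) simp

lemma sum_swap3: "(\<Sum>q\<in>A. \<Sum>t\<in>A'. \<Sum>w\<in>B. G q t w) = (\<Sum>w\<in>B. \<Sum>q\<in>A. \<Sum>t\<in>A'. G q t w)"
  by (subst sum.swap[of _ A B], rule sum.cong[OF refl], rule sum.swap)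

text \<open>Up to a positive factor this sum is the multiplicity of \<mu> in the restriction of
  \<nu>. Replacing both characters by their convolution squares exhibits it as a positive multiple
  of the sum of squares of the convolution of \<open>psi \<mu>\<close>, taken over the small group,
  with \<open>psi \<nu>\<close>.\<close>

lemma psi_restrict_nonneg:
  assumes nu: "\<nu> \<in> partitions n" and mu: "\<mu> \<in> partitions m" and mn: "m \<le> n"
  shows "(\<Sum>t\<in>perms m. psi \<nu> t * psi \<mu> t) \<ge> 0"
proof -
  let ?d = "(real (specht_dim \<mu>))\<^sup>2 / fact m" and ?D = "(real (specht_dim \<nu>))\<^sup>2 / fact n"
  have mc: "psi \<mu> t = ?d * (\<Sum>q\<in>perms m. psi \<mu> q * psi \<mu> (inv' q \<circ> t))" if "t permutes {1..m}" for t
    using psi_conv[OF mu that] specht_dim_pos[OF mu] by simp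
  have nc: "psi \<nu> t = ?D * (\<Sum>q\<in>perms n. psi \<nu> q * psi \<nu> (inv' q \<circ> t))" if "t permutes {1..n}" for t
    using psi_conv[OF nu that] specht_dim_pos[OF nu] by simp
  have "(\<Sum>t\<in>perms m. psi \<nu> t * psi \<mu> t) = (\<Sum>t\<in>perms m. psi \<nu> t * (?d * (\<Sum>q\<in>perms m. psi \<mu> q * psi \<mu> (inv' q \<circ> t))))"
  proof (rule sum.cong[OF refl])
    fix t assume "t \<in> perms m"
    then have t: "t permutes {1..m}" by simp
    show "psi \<nu> t * psi \<mu> t = psi \<nu> t * (?d * (\<Sum>q\<in>perms m. psi \<mu> q * psi \<mu> (inv' q \<circ> t)))"
      by (simp only: mc[OF t])
  qed
  also have "\<dots> = ?d * (\<Sum>q\<in>perms m. \<Sum>t\<in>perms m. psi \<nu> t * psi \<mu> q * psi \<mu> (inv' q \<circ> t))"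
    by (subst sum.swap) (simp add: sum_distrib_left sum_distrib_right mult_ac)
  also have "(\<Sum>q\<in>perms m. \<Sum>t\<in>perms m. psi \<nu> t * psi \<mu> q * psi \<mu> (inv' q \<circ> t)) =
    (\<Sum>q\<in>perms m. \<Sum>t\<in>perms m. psi \<nu> (q \<circ> t) * psi \<mu> q * psi \<mu> t)"
  proof (rule sum.cong[OF refl])
    fix q assume "q \<in> perms m" then have q: "q permutes {1..m}" by simp
    have "(\<Sum>t\<in>perms m. psi \<nu> t * psi \<mu> q * psi \<mu> (inv' q \<circ> t)) =
      (\<Sum>t\<in>perms m. psi \<nu> (q \<circ> t) * psi \<mu> q * psi \<mu> (inv' q \<circ> (q \<circ> t)))" by (rule sum_perms_left[OF q, symmetric])
    then show "(\<Sum>t\<in>perms m. psi \<nu> t * psi \<mu> q * psi \<mu> (inv' q \<circ> t)) = (\<Sum>t\<in>perms m. psi \<nu> (q \<circ> t) * psi \<mu> q * psi \<mu> t)"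
      by (simp add: comp_cancel[OF q])
  qed
  also have "\<dots> = (\<Sum>q\<in>perms m. \<Sum>t\<in>perms m. psi \<nu> (inv' q \<circ> t) * psi \<mu> q * psi \<mu> t)"
    by (subst sum_perms_inv[symmetric]) (intro sum.cong refl, simp add: psi_inv[OF mu])
  \<comment> \<open>Splitting the value of \<open>psi \<nu>\<close> at q^-1 t over w separates the
    variables into a factor in q and the same factor in t.\<close>
  also have "\<dots> = (\<Sum>q\<in>perms m. \<Sum>t\<in>perms m. \<Sum>w\<in>perms n. ?D * ((psi \<mu> q * psi \<nu> (inv' q \<circ> w)) * (psi \<mu> t * psi \<nu> (inv' t \<circ> w))))"
  proof (intro sum.cong refl)
    fix q t assume "q \<in> perms m" "t \<in> perms m"
    then have q: "q permutes {1..n}" and t: "t permutes {1..n}" using perms_mono[OF mn] by auto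
    have "psi \<nu> (inv' q \<circ> t) = ?D * (\<Sum>u\<in>perms n. psi \<nu> u * psi \<nu> (inv' u \<circ> (inv' q \<circ> t)))"
      by (rule nc) (intro permutes_compose permutes_inv q t)
    also have "(\<Sum>u\<in>perms n. psi \<nu> u * psi \<nu> (inv' u \<circ> (inv' q \<circ> t))) =
      (\<Sum>w\<in>perms n. psi \<nu> (inv' q \<circ> w) * psi \<nu> (inv' (inv' q \<circ> w) \<circ> (inv' q \<circ> t)))"
      by (rule sum_perms_left[OF permutes_inv[OF q], symmetric])
    also have "\<dots> = (\<Sum>w\<in>perms n. psi \<nu> (inv' q \<circ> w) * psi \<nu> (inv' t \<circ> w))"
    proof (rule sum.cong[OF refl])
      fix w assume "w \<in> perms n" then have w: "w permutes {1..n}" by simp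
      have "inv' (inv' q \<circ> w) \<circ> (inv' q \<circ> t) = inv' w \<circ> t"
        by (simp add: inv_comp[OF permutes_inv[OF q] w] comp_assoc comp_cancel[OF q])
      moreover have "psi \<nu> (inv' w \<circ> t) = psi \<nu> (inv' t \<circ> w)"
        using psi_inv[OF nu permutes_compose[OF t permutes_inv[OF w]]]
        by (simp add: inv_comp[OF permutes_inv[OF w] t] comp_cancel[OF w])
      ultimately show "psi \<nu> (inv' q \<circ> w) * psi \<nu> (inv' (inv' q \<circ> w) \<circ> (inv' q \<circ> t)) = psi \<nu> (inv' q \<circ> w) * psi \<nu> (inv' t \<circ> w)" by simp
    qed
    finally have E: "psi \<nu> (inv' q \<circ> t) = ?D * (\<Sum>w\<in>perms n. psi \<nu> (inv' q \<circ> w) * psi \<nu> (inv' t \<circ> w))" .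
    show "psi \<nu> (inv' q \<circ> t) * psi \<mu> q * psi \<mu> t =
      (\<Sum>w\<in>perms n. ?D * ((psi \<mu> q * psi \<nu> (inv' q \<circ> w)) * (psi \<mu> t * psi \<nu> (inv' t \<circ> w))))"
      unfolding E sum_distrib_left sum_distrib_right by (intro sum.cong refl) (simp only: mult_ac)
  qed
  also have "\<dots> = (\<Sum>w\<in>perms n. ?D * ((\<Sum>q\<in>perms m. psi \<mu> q * psi \<nu> (inv' q \<circ> w)) * (\<Sum>t\<in>perms m. psi \<mu> t * psi \<nu> (inv' t \<circ> w))))"
    unfolding sum_product unfolding sum_distrib_left by (rule sum_swap3)
  finally have "(\<Sum>t\<in>perms m. psi \<nu> t * psi \<mu> t) = ?d * \<dots>" .
  then show ?thesis by (simp add: sum_nonneg zero_le_mult_iff zero_le_divide_iff)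
qed

lemma sum_permutes_left:
  assumes t: "t permutes D"
  shows "(\<Sum>s\<in>{s. s permutes D}. F (t \<circ> s)) = (\<Sum>s\<in>{s. s permutes D}. F s)"
  using setum_permutations_compose_left[OF t, of F] by simp

lemma sum_permutes_right:
  assumes t: "t permutes D"
  shows "(\<Sum>s\<in>{s. s permutes D}. F (s \<circ> t)) = (\<Sum>s\<in>{s. s permutes D}. F s)"
  using sum_permutations_compose_right[OF t, of F] by simp

text \<open>The same coefficient as a sum over the column factor instead of the row factor;
  \<open>antisymmetrizer_kills\<close> needs the column factor fixed while it varies a permutation
  of D.\<close>

lemma ysym_alt:
  assumes g: "g permutes {1..n}"
  shows "ysym n rw cl g = (\<Sum>q\<in>fibre_group n cl. of_int (sign q) * (if g \<circ> inv' q \<in> fibre_group n rw then 1 else 0))"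
proof -
  have "ysym n rw cl g = (\<Sum>r\<in>{r\<in>fibre_group n rw. inv' r \<circ> g \<in> fibre_group n cl}. of_int (sign (inv' r \<circ> g)))"
    unfolding ysym_def col_sign_def by (rule sum.inter_filter[symmetric, OF finite_fibre_group])
  also have "\<dots> = (\<Sum>q\<in>{q\<in>fibre_group n cl. g \<circ> inv' q \<in> fibre_group n rw}. of_int (sign q))"
  proof (rule sum.reindex_bij_witness[of _ "\<lambda>q. g \<circ> inv' q" "\<lambda>r. inv' r \<circ> g"])
    fix r assume r: "r \<in> {r\<in>fibre_group n rw. inv' r \<circ> g \<in> fibre_group n cl}"
    then have rp: "r permutes {1..n}" using fibre_group_permutes by blast
    show a: "g \<circ> inv' (inv' r \<circ> g) = r"
      by (simp add: inv_comp[OF permutes_inv[OF rp] g] comp_cancel[OF rp] comp_cancel[OF g])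
    show "inv' r \<circ> g \<in> {q\<in>fibre_group n cl. g \<circ> inv' q \<in> fibre_group n rw}" using r a by simp
  next
    fix q assume q: "q \<in> {q\<in>fibre_group n cl. g \<circ> inv' q \<in> fibre_group n rw}"
    then have qp: "q permutes {1..n}" using fibre_group_permutes by blast
    show a: "inv' (g \<circ> inv' q) \<circ> g = q"
      by (simp add: inv_comp[OF g permutes_inv[OF qp]] comp_cancel[OF qp] comp_assoc comp_cancel[OF g])
    show "g \<circ> inv' q \<in> {r\<in>fibre_group n rw. inv' r \<circ> g \<in> fibre_group n cl}" using q a by simp
  qed simp
  also have "\<dots> = (\<Sum>q\<in>fibre_group n cl. if g \<circ> inv' q \<in> fibre_group n rw then of_int (sign q) else 0)"
    by (rule sum.inter_filter[OF finite_fibre_group])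
  also have "\<dots> = (\<Sum>q\<in>fibre_group n cl. of_int (sign q) * (if g \<circ> inv' q \<in> fibre_group n rw then 1 else 0))"
    by (intro sum.cong refl) simp
  finally show ?thesis .
qed

text \<open>Pigeonhole: D has more points than f has values, so two points of D, pulled back by k,
  lie in one fibre. Transposing them on the outer side of k is the same as applying an element of
  the fibre group on its inner side.\<close>

lemma fibre_collision:
  assumes D: "D \<subseteq> {1..n}" and k: "k permutes {1..n}" and f: "\<And>x. x \<in> {1..n} \<Longrightarrow> f x < W" and c: "card D > W"
  obtains x y where "x \<in> D" "y \<in> D" "x \<noteq> y" 
    "Transposition.transpose (inv' k x) (inv' k y) \<in> fibre_group n (f :: nat \<Rightarrow> nat)"
    "Transposition.transpose x y \<circ> k = k \<circ> Transposition.transpose (inv' k x) (inv' k y)"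
    "inv' k \<circ> Transposition.transpose x y = Transposition.transpose (inv' k x) (inv' k y) \<circ> inv' k"
proof -
  have kin: "inv' k x \<in> {1..n}" if "x \<in> D" for x using permutes_in_image[OF permutes_inv[OF k]] that D by blast
  have "(\<lambda>x. f (inv' k x)) ` D \<subseteq> {..<W}" using f kin by blast
  then have "card ((\<lambda>x. f (inv' k x)) ` D) \<le> W" using card_mono[of "{..<W}"] by simp
  then have "\<not> inj_on (\<lambda>x. f (inv' k x)) D" using c pigeonhole[of "\<lambda>x. f (inv' k x)" D] by simp
  then obtain x y where xy: "x \<in> D" "y \<in> D" "x \<noteq> y" "f (inv' k x) = f (inv' k y)" by (auto simp: inj_on_def)
  have t: "Transposition.transpose (inv' k x) (inv' k y) \<in> fibre_group n f"
    by (rule transpose_fibre_group) (use kin xy in auto)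
  have 1: "inv' k \<circ> Transposition.transpose x y = Transposition.transpose (inv' k x) (inv' k y) \<circ> inv' k"
    using permutes_inj[OF permutes_inv[OF k]] by (auto simp: fun_eq_iff Transposition.transpose_def inj_eq)
  have "k \<circ> (inv' k \<circ> Transposition.transpose x y) \<circ> k = k \<circ> (Transposition.transpose (inv' k x) (inv' k y) \<circ> inv' k) \<circ> k"
    by (simp only: 1)
  then have 2: "Transposition.transpose x y \<circ> k = k \<circ> Transposition.transpose (inv' k x) (inv' k y)"
    by (simp only: comp_cancel[OF k] comp_assoc o_id)
  show ?thesis by (rule that[OF xy(1,2,3) t 2 1])
qed

text \<open>D has more points than there are columns. For each row factor r, two points of D share a
  column after being pulled back by h r; composing s with their transposition permutes the summation
  over s and reverses every sign.\<close>

lemma symmetrizer_kills: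
  assumes D: "D \<subseteq> {1..n}" and h: "h permutes {1..n}"
    and cl: "\<And>x. x \<in> {1..n} \<Longrightarrow> cl x < W" and c: "card D > W"
  shows "(\<Sum>s\<in>{s. s permutes D}. ysym n rw cl (inv' h \<circ> (s \<circ> w))) = 0"
proof -
  have "(\<Sum>s\<in>{s. s permutes D}. col_sign n cl (inv' r \<circ> (inv' h \<circ> (s \<circ> w)))) = 0" if r: "r \<in> fibre_group n rw" for r
  proof -
    define k where "k = h \<circ> r"
    have kp: "k permutes {1..n}" unfolding k_def by (intro permutes_compose h fibre_group_permutes[OF r])
    have e: "inv' r \<circ> (inv' h \<circ> x) = inv' k \<circ> x" for x
      by (simp add: k_def inv_comp[OF h fibre_group_permutes[OF r]] comp_assoc)
    obtain x y where xy: "x \<in> D" "y \<in> D" "x \<noteq> y" 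
      and t: "Transposition.transpose (inv' k x) (inv' k y) \<in> fibre_group n cl"
      and sw: "inv' k \<circ> Transposition.transpose x y = Transposition.transpose (inv' k x) (inv' k y) \<circ> inv' k"
      by (rule fibre_collision[OF D kp cl c])
    have ne: "inv' k x \<noteq> inv' k y" using xy(3) permutes_inj[OF permutes_inv[OF kp]] by (simp add: inj_eq)
    have "(\<Sum>s\<in>{s. s permutes D}. col_sign n cl (inv' k \<circ> (s \<circ> w))) =
      (\<Sum>s\<in>{s. s permutes D}. col_sign n cl (inv' k \<circ> ((Transposition.transpose x y \<circ> s) \<circ> w)))"
      by (rule sum_permutes_left[symmetric]) (rule permutes_swap_id[OF xy(1,2)])
    also have "\<dots> = (\<Sum>s\<in>{s. s permutes D}. - col_sign n cl (inv' k \<circ> (s \<circ> w)))"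
    proof (rule sum.cong[OF refl])
      fix s
      have "inv' k \<circ> ((Transposition.transpose x y \<circ> s) \<circ> w) = (inv' k \<circ> Transposition.transpose x y) \<circ> (s \<circ> w)"
        by (simp only: comp_assoc)
      also have "\<dots> = Transposition.transpose (inv' k x) (inv' k y) \<circ> (inv' k \<circ> (s \<circ> w))" by (simp only: sw comp_assoc)
      finally show "col_sign n cl (inv' k \<circ> ((Transposition.transpose x y \<circ> s) \<circ> w)) = - col_sign n cl (inv' k \<circ> (s \<circ> w))"
        using col_sign_left[OF t] ne by (simp add: sign_swap_id)
    qed
    finally show ?thesis by (simp add: e sum_negf)
  qed
  then have "(\<Sum>r\<in>fibre_group n rw. \<Sum>s\<in>{s. s permutes D}. col_sign n cl (inv' r \<circ> (inv' h \<circ> (s \<circ> w)))) = 0" by simp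
  then show ?thesis unfolding ysym_def by (subst sum.swap)
qed

text \<open>The mirror image: D has more points than there are rows. For each column factor, a
  transposition of two points of D preserves membership in the row group and reverses the sign of
  s.\<close>

lemma antisymmetrizer_kills:
  assumes D: "D \<subseteq> {1..n}" and h: "h permutes {1..n}" and w: "w permutes {1..n}"
    and rw: "\<And>x. x \<in> {1..n} \<Longrightarrow> rw x < H" and c: "card D > H"
  shows "(\<Sum>s\<in>{s. s permutes D}. of_int (sign s) * ysym n rw cl (w \<circ> (s \<circ> h))) = 0"
proof -
  let ?R = "fibre_group n rw"
  have *: "(\<Sum>s\<in>{s. s permutes D}. complex_of_int (sign s) * (if w \<circ> (s \<circ> h) \<circ> inv' q \<in> ?R then 1 else 0)) = 0" if q: "q \<in> fibre_group n cl" for q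
  proof -
    define k where "k = h \<circ> inv' q"
    have kp: "k permutes {1..n}" unfolding k_def by (intro permutes_compose h permutes_inv fibre_group_permutes[OF q])
    have e: "w \<circ> (s \<circ> h) \<circ> inv' q = w \<circ> (s \<circ> k)" for s by (simp add: k_def comp_assoc)
    obtain x y where xy: "x \<in> D" "y \<in> D" "x \<noteq> y" 
      and t: "Transposition.transpose (inv' k x) (inv' k y) \<in> ?R"
      and sw: "Transposition.transpose x y \<circ> k = k \<circ> Transposition.transpose (inv' k x) (inv' k y)"
      by (rule fibre_collision[OF D kp rw c])
    have "(\<Sum>s\<in>{s. s permutes D}. complex_of_int (sign s) * (if w \<circ> (s \<circ> k) \<in> ?R then 1 else 0)) =
      (\<Sum>s\<in>{s. s permutes D}. complex_of_int (sign (s \<circ> Transposition.transpose x y)) * (if w \<circ> ((s \<circ> Transposition.transpose x y) \<circ> k) \<in> ?R then 1 else 0))"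
      by (rule sum_permutes_right[symmetric]) (rule permutes_swap_id[OF xy(1,2)])
    also have "\<dots> = (\<Sum>s\<in>{s. s permutes D}. - (complex_of_int (sign s) * (if w \<circ> (s \<circ> k) \<in> ?R then 1 else 0)))"
    proof (rule sum.cong[OF refl])
      fix s assume "s \<in> {s. s permutes D}"
      then have s: "permutation s" using finite_subset[OF D] by (auto simp: permutation_permutes)
      have "w \<circ> ((s \<circ> Transposition.transpose x y) \<circ> k) = (w \<circ> (s \<circ> k)) \<circ> Transposition.transpose (inv' k x) (inv' k y)"
        by (simp only: comp_assoc sw)
      then have "w \<circ> ((s \<circ> Transposition.transpose x y) \<circ> k) \<in> ?R \<longleftrightarrow> w \<circ> (s \<circ> k) \<in> ?R"
        using fibre_group_comp_iff(2)[OF t] by simp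
      moreover have "sign (s \<circ> Transposition.transpose x y) = - sign s"
        using sign_compose[OF s permutation_swap_id] xy(3) by (simp add: sign_swap_id)
      ultimately show "complex_of_int (sign (s \<circ> Transposition.transpose x y)) * (if w \<circ> ((s \<circ> Transposition.transpose x y) \<circ> k) \<in> ?R then 1 else 0)
        = - (complex_of_int (sign s) * (if w \<circ> (s \<circ> k) \<in> ?R then 1 else 0))" by simp
    qed
    finally show ?thesis by (simp add: e sum_negf)
  qed
  have "(\<Sum>s\<in>{s. s permutes D}. of_int (sign s) * ysym n rw cl (w \<circ> (s \<circ> h))) =
    (\<Sum>s\<in>{s. s permutes D}. \<Sum>q\<in>fibre_group n cl. of_int (sign q) * (of_int (sign s) * (if w \<circ> (s \<circ> h) \<circ> inv' q \<in> ?R then 1 else 0)))"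
  proof (rule sum.cong[OF refl])
    fix s assume "s \<in> {s. s permutes D}"
    then have "w \<circ> (s \<circ> h) permutes {1..n}" using permutes_subset[OF _ D] by (intro permutes_compose w h) blast
    from ysym_alt[OF this, of rw cl] show "of_int (sign s) * ysym n rw cl (w \<circ> (s \<circ> h)) = 
      (\<Sum>q\<in>fibre_group n cl. of_int (sign q) * (of_int (sign s) * (if w \<circ> (s \<circ> h) \<circ> inv' q \<in> ?R then 1 else 0)))"
      by (simp only: sum_distrib_left mult.left_commute)
  qed
  also have "\<dots> = (\<Sum>q\<in>fibre_group n cl. of_int (sign q) * (\<Sum>s\<in>{s. s permutes D}. of_int (sign s) * (if w \<circ> (s \<circ> h) \<circ> inv' q \<in> ?R then 1 else 0)))"
    by (subst sum.swap) (simp only: sum_distrib_left)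
  also have "\<dots> = 0" using * by simp
  finally show ?thesis .
qed

lemma permutes_fibre:
  assumes "s permutes {x\<in>{1..m}. f x = i}"
  shows "s \<in> fibre_group m f"
proof -
  have "s permutes {1..m}" by (rule permutes_subset[OF assms]) blast
  moreover have "f (s x) = f x" if "x \<in> {1..m}" for x
    using permutes_in_image[OF assms, of x] permutes_not_in[OF assms, of x] that by (cases "f x = i") auto
  ultimately show ?thesis by (simp add: fibre_group_def)
qed

text \<open>The class sum of the large group is invariant under conjugation by the small one, so all
  m! conjugates of the small symmetrizer contribute equally.\<close>

lemma class_sum_inner_ysym:
  assumes mn: "m \<le> n"
  shows "(\<Sum>t\<in>perms m. class_sum n rw cl t * class_sum m rw' cl' t) =
    fact m * (\<Sum>t\<in>perms m. class_sum n rw cl t * ysym m rw' cl' t)"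
proof -
  have "(\<Sum>t\<in>perms m. class_sum n rw cl t * class_sum m rw' cl' t) =
    (\<Sum>h\<in>perms m. \<Sum>t\<in>perms m. class_sum n rw cl t * ysym m rw' cl' (inv' h \<circ> t \<circ> h))"
    by (subst (2) class_sum_def, unfold sum_distrib_left, rule sum.swap)
  also have "\<dots> = (\<Sum>h\<in>perms m. \<Sum>t\<in>perms m. class_sum n rw cl t * ysym m rw' cl' t)"
  proof (rule sum.cong[OF refl])
    fix h assume "h \<in> perms m" then have h: "h permutes {1..m}" by simp
    have "(\<Sum>t\<in>perms m. class_sum n rw cl t * ysym m rw' cl' (inv' h \<circ> t \<circ> h)) =
      (\<Sum>t\<in>perms m. class_sum n rw cl (h \<circ> t \<circ> inv' h) * ysym m rw' cl' (inv' h \<circ> (h \<circ> t \<circ> inv' h) \<circ> h))"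
      by (rule sum_perms_conj[OF h, symmetric])
    then show "(\<Sum>t\<in>perms m. class_sum n rw cl t * ysym m rw' cl' (inv' h \<circ> t \<circ> h)) =
      (\<Sum>t\<in>perms m. class_sum n rw cl t * ysym m rw' cl' t)"
      by (simp add: class_sum_conj[OF perms_mono[OF mn h], unfolded comp_assoc] comp_assoc comp_cancel[OF h])
  qed
  also have "\<dots> = fact m * (\<Sum>t\<in>perms m. class_sum n rw cl t * ysym m rw' cl' t)"
    by (simp add: card_permutations[of "{1..m}" m])
  finally show ?thesis .
qed

text \<open>The small symmetrizer is invariant under permutations of its row i, so the large class
  sum may be averaged over them. If that row is longer than the number of columns of the large
  shape, the average vanishes by \<open>symmetrizer_kills\<close>.\<close>

lemma class_sum_inner_row_zero:
  assumes mn: "m \<le> n" and cl: "\<And>x. x \<in> {1..n} \<Longrightarrow> cl x < W" and c: "card {x\<in>{1..m}. rw' x = i} > W"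
  shows "(\<Sum>t\<in>perms m. class_sum n rw cl t * ysym m rw' cl' t) = 0"
proof -
  let ?D = "{x\<in>{1..m}. rw' x = i}" and ?T = "{s. s permutes {x\<in>{1..m}. rw' x = i}}"
  have D: "?D \<subseteq> {1..n}" using mn by auto
  have "of_nat (card ?T) * (\<Sum>t\<in>perms m. class_sum n rw cl t * ysym m rw' cl' t) =
    (\<Sum>s\<in>?T. \<Sum>t\<in>perms m. class_sum n rw cl t * ysym m rw' cl' t)" by simp
  also have "\<dots> = (\<Sum>s\<in>?T. \<Sum>t\<in>perms m. class_sum n rw cl (s \<circ> t) * ysym m rw' cl' t)"
  proof (rule sum.cong[OF refl])
    fix s assume "s \<in> ?T" then have s: "s \<in> fibre_group m rw'" using permutes_fibre by blast
    have "(\<Sum>t\<in>perms m. class_sum n rw cl t * ysym m rw' cl' t) =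
      (\<Sum>t\<in>perms m. class_sum n rw cl (s \<circ> t) * ysym m rw' cl' (s \<circ> t))"
      by (rule sum_perms_left[OF fibre_group_permutes[OF s], symmetric])
    then show "(\<Sum>t\<in>perms m. class_sum n rw cl t * ysym m rw' cl' t) =
      (\<Sum>t\<in>perms m. class_sum n rw cl (s \<circ> t) * ysym m rw' cl' t)" by (simp only: ysym_left[OF s])
  qed
  also have "\<dots> = (\<Sum>t\<in>perms m. (\<Sum>s\<in>?T. class_sum n rw cl (s \<circ> t)) * ysym m rw' cl' t)"
    unfolding sum_distrib_right by (rule sum.swap)
  also have "\<dots> = (\<Sum>t\<in>perms m. 0 * ysym m rw' cl' t)"
  proof (rule sum.cong[OF refl])
    fix t
    have "(\<Sum>s\<in>?T. class_sum n rw cl (s \<circ> t)) = (\<Sum>h\<in>perms n. \<Sum>s\<in>?T. ysym n rw cl (inv' h \<circ> (s \<circ> (t \<circ> h))))"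
      unfolding class_sum_def by (subst sum.swap) (simp add: comp_assoc)
    also have "\<dots> = 0"
    proof (rule sum.neutral, rule ballI)
      fix h assume "h \<in> perms n"
      then have h: "h permutes {1..n}" by simp
      show "(\<Sum>s\<in>?T. ysym n rw cl (inv' h \<circ> (s \<circ> (t \<circ> h)))) = 0"
        by (rule symmetrizer_kills[OF D h cl c])
    qed
    finally show "(\<Sum>s\<in>?T. class_sum n rw cl (s \<circ> t)) * ysym m rw' cl' t = 0 * ysym m rw' cl' t" by simp
  qed
  finally have "of_nat (card ?T) * (\<Sum>t\<in>perms m. class_sum n rw cl t * ysym m rw' cl' t) = 0" by simp
  moreover have "card ?T \<noteq> 0" by (simp add: card_permutations[OF refl])
  ultimately show ?thesis by (simp only: mult_eq_0_iff of_nat_eq_0_iff simp_thms)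
qed

lemma class_sum_inner_col_zero:
  assumes mn: "m \<le> n" and rw: "\<And>x. x \<in> {1..n} \<Longrightarrow> rw x < H" and c: "card {x\<in>{1..m}. cl' x = i} > H"
  shows "(\<Sum>t\<in>perms m. class_sum n rw cl t * ysym m rw' cl' t) = 0"
proof -
  let ?D = "{x\<in>{1..m}. cl' x = i}" and ?T = "{s. s permutes {x\<in>{1..m}. cl' x = i}}"
  have D: "?D \<subseteq> {1..n}" using mn by auto
  have "of_nat (card ?T) * (\<Sum>t\<in>perms m. class_sum n rw cl t * ysym m rw' cl' t) =
    (\<Sum>s\<in>?T. \<Sum>t\<in>perms m. class_sum n rw cl t * ysym m rw' cl' t)" by simp
  also have "\<dots> = (\<Sum>s\<in>?T. \<Sum>t\<in>perms m. (of_int (sign s) * class_sum n rw cl (t \<circ> s)) * ysym m rw' cl' t)"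
  proof (rule sum.cong[OF refl])
    fix s assume "s \<in> ?T" then have s: "s \<in> fibre_group m cl'" using permutes_fibre by blast
    have "(\<Sum>t\<in>perms m. class_sum n rw cl t * ysym m rw' cl' t) =
      (\<Sum>t\<in>perms m. class_sum n rw cl (t \<circ> s) * ysym m rw' cl' (t \<circ> s))"
      by (rule sum_perms_right[OF fibre_group_permutes[OF s], symmetric])
    then show "(\<Sum>t\<in>perms m. class_sum n rw cl t * ysym m rw' cl' t) =
      (\<Sum>t\<in>perms m. (of_int (sign s) * class_sum n rw cl (t \<circ> s)) * ysym m rw' cl' t)"
      by (simp only: ysym_right[OF s] mult_ac)
  qed
  also have "\<dots> = (\<Sum>t\<in>perms m. (\<Sum>s\<in>?T. of_int (sign s) * class_sum n rw cl (t \<circ> s)) * ysym m rw' cl' t)"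
    unfolding sum_distrib_right by (rule sum.swap)
  also have "\<dots> = (\<Sum>t\<in>perms m. 0 * ysym m rw' cl' t)"
  proof (rule sum.cong[OF refl])
    fix t assume "t \<in> perms m"
    then have t: "t permutes {1..n}" using perms_mono[OF mn] by blast
    have "(\<Sum>s\<in>?T. of_int (sign s) * class_sum n rw cl (t \<circ> s)) =
      (\<Sum>h\<in>perms n. \<Sum>s\<in>?T. of_int (sign s) * ysym n rw cl ((inv' h \<circ> t) \<circ> (s \<circ> h)))"
      unfolding class_sum_def sum_distrib_left by (subst sum.swap) (simp only: comp_assoc)
    also have "\<dots> = 0" 
    proof (rule sum.neutral, rule ballI)
      fix h assume "h \<in> perms n"
      then have h: "h permutes {1..n}" by simp
      show "(\<Sum>s\<in>?T. of_int (sign s) * ysym n rw cl ((inv' h \<circ> t) \<circ> (s \<circ> h))) = 0"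
        by (rule antisymmetrizer_kills[OF D h _ rw c]) (intro permutes_compose permutes_inv h t)
    qed
    finally show "(\<Sum>s\<in>?T. of_int (sign s) * class_sum n rw cl (t \<circ> s)) * ysym m rw' cl' t = 0 * ysym m rw' cl' t" by simp
  qed
  finally have "of_nat (card ?T) * (\<Sum>t\<in>perms m. class_sum n rw cl t * ysym m rw' cl' t) = 0" by simp
  moreover have "card ?T \<noteq> 0" by (simp add: card_permutations[OF refl])
  ultimately show ?thesis by (simp only: mult_eq_0_iff of_nat_eq_0_iff simp_thms)
qed

text \<open>A bound on the column indices bounds the row lengths, and a bound on the row indices
  bounds the column lengths.\<close>

definition fits :: "nat \<Rightarrow> nat \<Rightarrow> nat list \<Rightarrow> bool" where
  "fits n L \<mu> \<longleftrightarrow> (\<forall>x\<in>{1..n}. row_of \<mu> x < L \<and> col_of \<mu> x < L)"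

text \<open>A weak form of the branching rule: of the containment of shapes it retains containment
  in the L by L box. A nonzero inner product excludes a row or a column of \<mu> longer than
  L.\<close>

lemma constituent_fits:
  assumes nu: "\<nu> \<in> partitions n" and mu: "\<mu> \<in> partitions m" and mn: "m \<le> n" and f: "fits n L \<nu>"
    and nz: "(\<Sum>t\<in>perms m. psi \<nu> t * psi \<mu> t) \<noteq> 0"
  shows "fits m L \<mu>"
proof -
  interpret tableau m "row_of \<mu>" "col_of \<mu>" by (rule partition_tableau[OF mu])
  let ?Z = "\<Sum>t\<in>perms m. class_sum n (row_of \<nu>) (col_of \<nu>) t * ysym m (row_of \<mu>) (col_of \<mu>) t"
  have "complex_of_real (fact n * fact m * (\<Sum>t\<in>perms m. psi \<nu> t * psi \<mu> t)) =
    (\<Sum>t\<in>perms m. class_sum n (row_of \<nu>) (col_of \<nu>) t * class_sum m (row_of \<mu>) (col_of \<mu>) t)"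
    unfolding class_sum_psi[OF nu] class_sum_psi[OF mu] of_real_mult[symmetric] of_real_sum[symmetric]
    by (simp add: sum_distrib_left mult_ac)
  also have "\<dots> = fact m * ?Z" by (rule class_sum_inner_ysym[OF mn])
  finally have e: "complex_of_real (fact n * fact m * (\<Sum>t\<in>perms m. psi \<nu> t * psi \<mu> t)) = fact m * ?Z" .
  have "complex_of_real (fact n * fact m * (\<Sum>t\<in>perms m. psi \<nu> t * psi \<mu> t)) \<noteq> 0"
    using nz by (simp only: of_real_eq_0_iff) simp
  then have Z: "?Z \<noteq> 0" unfolding e by (metis mult_zero_right)
  have rows: "card {x\<in>{1..m}. row_of \<mu> x = i} \<le> L" for i
    using class_sum_inner_row_zero[OF mn, of "col_of \<nu>" L "row_of \<mu>" i "row_of \<nu>" "col_of \<mu>"] f Z unfolding fits_def by (meson not_le)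
  have cols: "card {x\<in>{1..m}. col_of \<mu> x = i} \<le> L" for i
    using class_sum_inner_col_zero[OF mn, of "row_of \<nu>" L "col_of \<mu>" i "col_of \<nu>" "row_of \<mu>"] f Z unfolding fits_def by (meson not_le)
  show ?thesis unfolding fits_def
  proof (intro ballI conjI)
    fix x assume x: "x \<in> {1..m}"
    have "{..col_of \<mu> x} \<subseteq> col_of \<mu> ` {y\<in>{1..m}. row_of \<mu> y = row_of \<mu> x}"
      using young[OF x, of "row_of \<mu> x"] by fastforce
    then have "card {..col_of \<mu> x} \<le> card {y\<in>{1..m}. row_of \<mu> y = row_of \<mu> x}"
      by (rule surj_card_le[rotated]) simp
    then show "col_of \<mu> x < L" using rows[of "row_of \<mu> x"] by simp
    have "{..row_of \<mu> x} \<subseteq> row_of \<mu> ` {y\<in>{1..m}. col_of \<mu> y = col_of \<mu> x}"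
      using young[OF x _ order_refl] by fastforce
    then have "card {..row_of \<mu> x} \<le> card {y\<in>{1..m}. col_of \<mu> y = col_of \<mu> x}"
      by (rule surj_card_le[rotated]) simp
    then show "row_of \<mu> x < L" using cols[of "col_of \<mu> x"] by simp
  qed
qed

text \<open>On the smaller group \<open>psi \<nu>\<close> is a convex combination of the normalized
  characters of its constituents: the weights \<open>a \<mu>\<close> times the dimension are
  nonnegative and sum to the value 1 at the identity. A bound for each constituent is therefore
  inherited.\<close>

lemma psi_restrict_bound:
  assumes nu: "\<nu> \<in> partitions n" and mn: "m \<le> n" and f: "fits n L \<nu>" and s: "s permutes {1..m}"
    and B: "\<And>\<mu>. \<mu> \<in> partitions m \<Longrightarrow> fits m L \<mu> \<Longrightarrow> \<bar>chi \<mu> s\<bar> \<le> B * real (specht_dim \<mu>)"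
  shows "\<bar>psi \<nu> s\<bar> \<le> B"
proof -
  define a where "a \<mu> = (\<Sum>h\<in>perms m. psi \<nu> h * chi \<mu> h) / fact m" for \<mu>
  have a: "a \<mu> = real (specht_dim \<mu>) * (\<Sum>h\<in>perms m. psi \<nu> h * psi \<mu> h) / fact m" for \<mu>
    by (simp add: a_def chi_def sum_distrib_left mult_ac)
  have pos: "a \<mu> \<ge> 0" if "\<mu> \<in> partitions m" for \<mu>
    using psi_restrict_nonneg[OF nu that mn] by (simp add: a)
  have ex: "psi \<nu> g = (\<Sum>\<mu>\<in>partitions m. a \<mu> * chi \<mu> g)" if "g permutes {1..m}" for g
    unfolding a_def by (intro class_fun_expansion[of m "psi \<nu>" g, OF _ that] psi_conj[OF nu perms_mono[OF mn]])
  have one: "(\<Sum>\<mu>\<in>partitions m. a \<mu> * real (specht_dim \<mu>)) = 1"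
    using ex[OF permutes_id] by (simp add: psi_id[OF nu] chi_def psi_id)
  have "\<bar>psi \<nu> s\<bar> \<le> (\<Sum>\<mu>\<in>partitions m. \<bar>a \<mu> * chi \<mu> s\<bar>)" unfolding ex[OF s] by (rule sum_abs)
  also have "\<dots> \<le> (\<Sum>\<mu>\<in>partitions m. B * (a \<mu> * real (specht_dim \<mu>)))"
  proof (rule sum_mono)
    fix \<mu> assume mu: "\<mu> \<in> partitions m"
    show "\<bar>a \<mu> * chi \<mu> s\<bar> \<le> B * (a \<mu> * real (specht_dim \<mu>))"
    proof (cases "a \<mu> = 0")
      case False
      then have "fits m L \<mu>" using constituent_fits[OF nu mu mn f] by (auto simp: a)
      from mult_left_mono[OF B[OF mu this] pos[OF mu]] show ?thesis using pos[OF mu] by (simp add: abs_mult mult_ac)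
    qed simp
  qed
  also have "\<dots> = B" by (simp add: sum_distrib_left[symmetric] one)
  finally show ?thesis .
qed

text \<open>A permutation \<open>k = pq\<close> preserving \<open>s = row + col\<close> moves \<open>row\<close> by \<open>e\<close>; as \<open>q\<close> preserves the
  sum of \<open>s\<^sup>2\<close> and \<open>s \<circ> q = s + e\<close>, the sum of \<open>e\<^sup>2\<close> vanishes.\<close>

lemma (in tableau) antidiagonal_trivial:
  assumes k: "k \<in> fibre_group n (\<lambda>x. rw x + cl x)" and nz: "ysym n rw cl k \<noteq> 0"
  shows "k = id"
proof -
  obtain p q where p: "p \<in> fibre_group n rw" and q: "q \<in> fibre_group n cl" and pq: "k = p \<circ> q"
    using nz by (rule ysym_nonzero)
  have kp: "k permutes {1..n}" and qp: "q permutes {1..n}" using k q fibre_group_permutes by auto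
  define s where "s x = int (rw x) + int (cl x)" for x
  define e where "e x = int (rw (k x)) - int (rw x)" for x
  have sk: "s (k x) = s x" for x using fibre_group_fibre[OF k, of x] by (simp add: s_def)
  have sq: "s (q x) = s x + e x" for x
  proof -
    have "rw (q x) = rw (k x)" using fibre_group_fibre[OF p, of "q x"] pq by simp
    then show ?thesis using fibre_group_fibre[OF q, of x] by (simp add: s_def e_def)
  qed
  have 1: "(\<Sum>x\<in>{1..n}. (s (q x))\<^sup>2) = (\<Sum>x\<in>{1..n}. (s x)\<^sup>2)"
    using sum.permute[OF qp, of "\<lambda>x. (s x)\<^sup>2"] by (simp add: comp_def)
  have "(\<Sum>x\<in>{1..n}. s x * int (rw (k x))) = (\<Sum>x\<in>{1..n}. s x * int (rw x))"
    using sum.permute[OF kp, of "\<lambda>x. s x * int (rw x)"] by (simp add: comp_def sk)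
  then have 2: "(\<Sum>x\<in>{1..n}. s x * e x) = 0" by (simp add: e_def algebra_simps sum_subtractf)
  have "(\<Sum>x\<in>{1..n}. (e x)\<^sup>2) = 0"
    using 1 2 by (simp add: sq power2_sum sum.distrib mult.assoc sum_distrib_left[symmetric])
  then have e0: "e x = 0" if "x \<in> {1..n}" for x using that by (subst (asm) sum_nonneg_eq_0_iff) auto
  show ?thesis
  proof
    fix x
    show "k x = id x"
    proof (cases "x \<in> {1..n}")
      case True
      have "rw (k x) = rw x" using e0[OF True] by (simp add: e_def)
      moreover have "cl (k x) = cl x" using sk[of x] calculation by (simp add: s_def)
      ultimately show ?thesis using inj_onD[OF inj, of "k x" x] True permutes_in_image[OF kp, of x] by (simp del: atLeastAtMost_iff)
    qed (use kp in \<open>simp add: permutes_not_in del: atLeastAtMost_iff\<close>)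
  qed
qed

lemma card_antidiagonal_le:
  assumes mu: "\<mu> \<in> partitions n"
  shows "card (fibre_group n (\<lambda>x. row_of \<mu> x + col_of \<mu> x)) \<le> specht_dim \<mu>"
proof (rule card_le_specht_dim[OF mu])
  interpret tableau n "row_of \<mu>" "col_of \<mu>" by (rule partition_tableau[OF mu])
  let ?A = "fibre_group n (\<lambda>x. row_of \<mu> x + col_of \<mu> x)"
  show "?A \<subseteq> perms n" using fibre_group_permutes by blast
  fix g h assume gh: "g \<in> ?A" "h \<in> ?A" "g \<noteq> h"
  note hp = fibre_group_permutes[OF gh(2)]
  have "inv' h \<circ> g \<noteq> id"
  proof
    assume "inv' h \<circ> g = id"
    then have "h \<circ> (inv' h \<circ> g) = h" by simp
    then show False using gh(3) by (simp only: comp_cancel(3)[OF hp])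
  qed
  then show "ysym n (row_of \<mu>) (col_of \<mu>) (inv' h \<circ> g) = 0"
    using antidiagonal_trivial fibre_group_comp[OF fibre_group_inv[OF gh(2)] gh(1)] by blast
qed

text \<open>Permutations chosen independently on the fibres glue to a permutation preserving f, and
  the glued permutation remembers each of them.\<close>

lemma card_fibre_group_ge:
  assumes f: "\<And>x. x \<in> {1..n} \<Longrightarrow> f x < K"
  shows "(\<Prod>t<K. fact (card {x\<in>{1..n}. f x = t})) \<le> card (fibre_group n f)"
proof -
  let ?F = "\<lambda>t. {x\<in>{1..n}. f x = t}"
  define \<Phi> where "\<Phi> P x = (if x \<in> {1..n} then P (f x) x else x)" for P :: "nat \<Rightarrow> nat \<Rightarrow> nat" and x
  let ?S = "PiE {..<K} (\<lambda>t. {p. p permutes ?F t})"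
  have perm: "P (f x) permutes ?F (f x)" if "P \<in> ?S" "x \<in> {1..n}" for P x
    using PiE_mem[OF that(1), of "f x"] f[OF that(2)] by simp
  have in1: "P (f x) x \<in> ?F (f x)" if "P \<in> ?S" "x \<in> {1..n}" for P x
    using permutes_in_image[OF perm[OF that], of x] that(2) by blast
  have "\<Phi> ` ?S \<subseteq> fibre_group n f"
  proof (rule image_subsetI)
    fix P assume P: "P \<in> ?S"
    have "\<Phi> P permutes {1..n}"
    proof (rule inj_imp_permutes)
      show "inj_on (\<Phi> P) {1..n}"
      proof (rule inj_onI)
        fix x y assume x: "x \<in> {1..n}" and y: "y \<in> {1..n}" and e: "\<Phi> P x = \<Phi> P y"
        have e': "P (f x) x = P (f y) y" using e x y by (simp add: \<Phi>_def del: atLeastAtMost_iff)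
        then have ff: "f x = f y" using in1[OF P x] in1[OF P y] by simp
        then show "x = y" using e' permutes_inj[OF perm[OF P x]] by (simp add: inj_eq)
      qed
      show "\<Phi> P x \<in> {1..n}" if "x \<in> {1..n}" for x using in1[OF P that] that by (simp add: \<Phi>_def)
    qed (auto simp: \<Phi>_def)
    moreover have "f (\<Phi> P x) = f x" if "x \<in> {1..n}" for x using in1[OF P that] that by (simp add: \<Phi>_def)
    ultimately show "\<Phi> P \<in> fibre_group n f" by (simp add: fibre_group_def)
  qed
  moreover have "inj_on \<Phi> ?S"
  proof (rule inj_onI)
    fix P Q assume P: "P \<in> ?S" and Q: "Q \<in> ?S" and e: "\<Phi> P = \<Phi> Q"
    show "P = Q"
    proof (rule PiE_ext[OF P Q])
      fix t assume t: "t \<in> {..<K}"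
      have "P t x = Q t x" for x
      proof (cases "x \<in> ?F t")
        case True
        then show ?thesis using fun_cong[OF e, of x] by (simp add: \<Phi>_def)
      next
        case False
        have p: "P t permutes ?F t" and q: "Q t permutes ?F t" using PiE_mem[OF P t] PiE_mem[OF Q t] by auto
        show ?thesis by (simp only: permutes_not_in[OF p False] permutes_not_in[OF q False])
      qed
      then show "P t = Q t" by blast
    qed
  qed
  ultimately have "card ?S \<le> card (fibre_group n f)" using card_inj_on_le[OF _ _ finite_fibre_group] by blast
  moreover have "card ?S = (\<Prod>t<K. fact (card (?F t)))"
    by (subst card_PiE) (simp_all add: card_permutations[OF refl])
  ultimately show ?thesis by simp
qed

lemma power_le_fact_exp:
  assumes y: "y \<ge> (0::real)" shows "y ^ a \<le> fact a * exp y"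
proof -
  have "summable (\<lambda>k. y ^ k /\<^sub>R fact k)" by (rule summable_exp_generic)
  then have "(\<Sum>k\<in>{a}. y ^ k /\<^sub>R fact k) \<le> (\<Sum>k. y ^ k /\<^sub>R fact k)"
    by (rule sum_le_suminf) (use y in auto)
  then have "y ^ a / fact a \<le> exp y" by (simp add: exp_def divide_inverse mult.commute)
  then show ?thesis by (simp add: field_simps)
qed

text \<open>The n cells lie on at most 2L antidiagonals. Each of length a contributes a! \<ge> y^a
  exp(-y), with y = n / (2L); in the product the exponents a sum to n, and the total loss is exp(-2L
  y) = exp(-n).\<close>

lemma specht_dim_ge:
  assumes mu: "\<mu> \<in> partitions n" and f: "fits n L \<mu>" and L: "L > 0"
  shows "(real n / (2 * real L)) ^ n \<le> real (specht_dim \<mu>) * exp (real n)"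
proof -
  let ?f = "\<lambda>x. row_of \<mu> x + col_of \<mu> x" and ?K = "2 * L"
  let ?a = "\<lambda>t. card {x\<in>{1..n}. ?f x = t}"
  define y where "y = real n / (2 * real L)"
  have y: "y \<ge> 0" by (simp add: y_def)
  have fK: "?f x < ?K" if "x \<in> {1..n}" for x
  proof -
    have "row_of \<mu> x < L \<and> col_of \<mu> x < L" using f that unfolding fits_def by blast
    then show ?thesis by linarith
  qed
  have le: "(\<Prod>t<?K. fact (?a t)) \<le> specht_dim \<mu>"
    by (rule order.trans[OF card_fibre_group_ge card_antidiagonal_le[OF mu]]) (rule fK)
  have sum: "(\<Sum>t<?K. ?a t) = n"
  proof -
    have "(\<Sum>t<?K. ?a t) = card (\<Union>t<?K. {x\<in>{1..n}. ?f x = t})"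
      by (rule card_UN_disjoint[symmetric]) auto
    also have "(\<Union>t<?K. {x\<in>{1..n}. ?f x = t}) = {1..n}" using fK by blast
    finally show ?thesis by simp
  qed
  have "y ^ n = (\<Prod>t<?K. y ^ ?a t)" by (simp only: power_sum[symmetric] sum)
  also have "\<dots> \<le> (\<Prod>t<?K. fact (?a t) * exp y)"
    by (rule prod_mono) (use y power_le_fact_exp[OF y] in auto)
  also have "\<dots> = (\<Prod>t<?K. fact (?a t)) * exp y ^ ?K" by (simp add: prod.distrib)
  also have "exp y ^ ?K = exp (real n)" using L by (simp add: exp_of_nat_mult[symmetric] y_def)
  also have "(\<Prod>t<?K. fact (?a t)) = real (\<Prod>t<?K. fact (?a t))" by simp
  also have "\<dots> * exp (real n) \<le> real (specht_dim \<mu>) * exp (real n)"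
    using le by (intro mult_right_mono) (simp_all only: of_nat_le_iff exp_ge_zero)
  finally show ?thesis by (simp add: y_def)
qed

section \<open>Supports and class sizes\<close>

definition supp :: "(nat \<Rightarrow> nat) \<Rightarrow> nat set" where
  "supp g = {x. g x \<noteq> x}"

lemma supp_subset: "g permutes {1..n} \<Longrightarrow> supp g \<subseteq> {1..n}"
  by (auto simp: supp_def dest: permutes_not_in)

lemma finite_supp: "g permutes {1..n::nat} \<Longrightarrow> finite (supp g)"
  by (rule finite_subset[OF supp_subset]) auto

lemma supp_closed: "inj g \<Longrightarrow> x \<in> supp g \<Longrightarrow> g x \<in> supp g"
  by (auto simp: supp_def inj_eq)

text \<open>Take X of the largest size. A moved point z outside X, g X and g^-1 X could be added,
  because its pair would meet none of the others; so these three sets cover the support.\<close>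

lemma disjoint_pairs_exist:
  assumes g: "inj g" and fin: "finite (supp g)"
  shows "\<exists>X\<subseteq>supp g. (\<forall>x\<in>X. \<forall>y\<in>X. x \<noteq> y \<longrightarrow> {x, g x} \<inter> {y, g y} = {}) \<and> card (supp g) \<le> 3 * card X"
proof -
  define good where "good X \<longleftrightarrow> X \<subseteq> supp g \<and> (\<forall>x\<in>X. \<forall>y\<in>X. x \<noteq> y \<longrightarrow> {x, g x} \<inter> {y, g y} = {})" for X
  have "finite {X. good X}" by (rule finite_subset[of _ "Pow (supp g)"]) (use fin in \<open>auto simp: good_def\<close>)
  moreover have "good {}" by (simp add: good_def)
  ultimately have G: "finite (card ` {X. good X})" "card ` {X. good X} \<noteq> {}" by blast+
  obtain X where X: "good X" "card X = Max (card ` {X. good X})" using Max_in[OF G] by force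
  have max: "card Y \<le> card X" if "good Y" for Y unfolding X(2) by (rule Max_ge[OF G(1)]) (use that in blast)
  have finX: "finite X" using X fin finite_subset by (auto simp: good_def)
  have "supp g \<subseteq> X \<union> g ` X \<union> (inv' g) ` X"
  proof
    fix z assume z: "z \<in> supp g"
    show "z \<in> X \<union> g ` X \<union> inv' g ` X"
    proof (rule ccontr)
      assume nz: "z \<notin> X \<union> g ` X \<union> inv' g ` X"
      have gz: "g z \<notin> X" using nz g by (metis UnCI image_eqI inv_f_f)
      have gz': "g z \<notin> g ` X" using nz g by (auto simp: inj_eq)
      have "good (insert z X)" unfolding good_def
      proof (intro conjI ballI impI)
        show "insert z X \<subseteq> supp g" using X z by (auto simp: good_def)
        fix x y assume xy: "x \<in> insert z X" "y \<in> insert z X" "x \<noteq> y"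
        show "{x, g x} \<inter> {y, g y} = {}"
        proof (cases "x = z \<or> y = z")
          case False then show ?thesis using X xy unfolding good_def by blast
        next
          case True
          then show ?thesis using xy nz gz gz' g by (auto simp: inj_eq)
        qed
      qed
      from max[OF this] show False using nz finX by simp
    qed
  qed
  then have "card (supp g) \<le> card (X \<union> g ` X \<union> inv' g ` X)" by (intro card_mono) (simp_all add: finX)
  also have "\<dots> \<le> card X + card (g ` X) + card (inv' g ` X)" by (meson card_Un_le add_mono le_refl order.trans)
  also have "\<dots> \<le> 3 * card X" using card_image_le[OF finX, of g] card_image_le[OF finX, of "inv' g"] by simp
  finally show ?thesis using X unfolding good_def by blast
qed

lemma card_le_image_mult:
  assumes fin: "finite S" and b: "\<And>y. y \<in> f ` S \<Longrightarrow> card {x\<in>S. f x = y} \<le> B"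
  shows "card S \<le> card (f ` S) * B"
proof -
  have "card S = (\<Sum>y\<in>f ` S. card {x\<in>S. f x = y})"
    using sum.image_gen[OF fin, of "\<lambda>_. 1::nat" f] by simp
  also have "\<dots> \<le> (\<Sum>y\<in>f ` S. B)" by (rule sum_mono) (rule b)
  finally show ?thesis by simp
qed

text \<open>Permutations agreeing with \<open>h\<close> on \<open>M\<close> differ from it by a permutation of the complement.\<close>

lemma card_agreeing_perms:
  assumes M: "M \<subseteq> {1..n}" and h: "h permutes {1..n}"
  shows "card {k\<in>perms n. \<forall>x\<in>M. k x = h x} \<le> fact (n - card M)"
proof -
  have fM: "finite M" using M finite_subset by blast
  have "inj_on (\<lambda>k. inv' h \<circ> k) {k\<in>perms n. \<forall>x\<in>M. k x = h x}"
  proof (rule inj_onI)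
    fix k k' assume "inv' h \<circ> k = inv' h \<circ> k'"
    then have "h \<circ> (inv' h \<circ> k) = h \<circ> (inv' h \<circ> k')" by simp
    then show "k = k'" by (simp only: comp_cancel(3)[OF h])
  qed
  moreover have "(\<lambda>k. inv' h \<circ> k) ` {k\<in>perms n. \<forall>x\<in>M. k x = h x} \<subseteq> {p. p permutes ({1..n} - M)}"
  proof (rule image_subsetI)
    fix k assume k: "k \<in> {k\<in>perms n. \<forall>x\<in>M. k x = h x}"
    have "inv' h \<circ> k permutes {1..n}" using k by (intro permutes_compose permutes_inv h) blast
    moreover have "(inv' h \<circ> k) x = x" if "x \<in> {1..n} - ({1..n} - M)" for x
      using k that comp_cancel(7)[OF h, of x] by auto
    ultimately have "inv' h \<circ> k permutes ({1..n} - M)" by (rule permutes_superset)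
    then show "inv' h \<circ> k \<in> {p. p permutes ({1..n} - M)}" by simp
  qed
  ultimately have "card {k\<in>perms n. \<forall>x\<in>M. k x = h x} \<le> card {p. p permutes ({1..n} - M)}"
    by (intro card_inj_on_le[of "\<lambda>k. inv' h \<circ> k"]) (auto intro: finite_permutations)
  also have "\<dots> = fact (card ({1..n} - M))" by (rule card_permutations[OF refl]) simp
  also have "card ({1..n} - M) = n - card M" using M by (simp add: card_Diff_subset fM)
  finally show ?thesis .
qed

lemma supp_conj:
  assumes h: "h permutes {1..n}" shows "supp (h \<circ> g \<circ> inv' h) = h ` supp g"
proof (intro equalityI subsetI)
  fix y assume "y \<in> supp (h \<circ> g \<circ> inv' h)"
  then have "inv' h y \<in> supp g" using comp_cancel(6)[OF h, of y] by (auto simp: supp_def)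
  then show "y \<in> h ` supp g" using comp_cancel(6)[OF h, of y] by (metis imageI)
next
  fix y assume "y \<in> h ` supp g"
  then show "y \<in> supp (h \<circ> g \<circ> inv' h)" using permutes_inj[OF h] by (auto simp: supp_def comp_cancel(7)[OF h] inj_eq)
qed

text \<open>The fibres of h -> h g h^-1 are counted. If the conjugate is t, then h (g x) = t (h x),
  so on the support h is determined by its values off g X, where X comes from the disjoint pairs.
  There are j \<le> 2m/3 such values, each in the support of t; outside the support of g, at most (n
  - m)! completions remain.\<close>

lemma conj_class_size:
  assumes g: "g permutes {1..n}"
  shows "\<exists>j. 3 * j \<le> 2 * card (supp g) \<and>
    fact n \<le> card (conj_class n g) * (card (supp g) ^ j * fact (n - card (supp g)))"
proof -
  let ?M = "supp g" and ?m = "card (supp g)"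
  have Mn: "?M \<subseteq> {1..n}" by (rule supp_subset[OF g])
  have fM: "finite ?M" by (rule finite_supp[OF g])
  have ig: "inj g" by (rule permutes_inj[OF g])
  obtain X where X1: "X \<subseteq> ?M" and X2: "\<forall>x\<in>X. \<forall>y\<in>X. x \<noteq> y \<longrightarrow> {x, g x} \<inter> {y, g y} = {}" and X3: "?m \<le> 3 * card X"
    using disjoint_pairs_exist[OF ig fM] by (elim exE conjE)
  have disj: "X \<inter> g ` X = {}"
  proof -
    have "False" if "x \<in> X" "y \<in> X" "x = g y" for x y
    proof (cases "x = y")
      case True then show False using that X1 by (auto simp: supp_def)
    next
      case False then show False using X2 that by blast
    qed
    then show ?thesis by blast
  qed
  let ?B = "?M - g ` X"
  have gX: "g ` X \<subseteq> ?M" using X1 supp_closed[OF ig] by blast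
  have cB: "card ?B = ?m - card X"
    using card_Diff_subset[OF finite_subset[OF gX fM] gX] card_image[OF inj_on_subset[OF ig subset_UNIV], of X] by simp
  have j: "3 * card ?B \<le> 2 * ?m" using cB X3 by simp
  have "card (perms n) \<le> card ((\<lambda>h. h \<circ> g \<circ> inv' h) ` perms n) * (?m ^ card ?B * fact (n - ?m))"
  proof (rule card_le_image_mult[OF finite_perms])
    fix t assume "t \<in> (\<lambda>h. h \<circ> g \<circ> inv' h) ` perms n"
    then obtain h0 where h0: "h0 permutes {1..n}" "t = h0 \<circ> g \<circ> inv' h0" by blast
    let ?S = "{h\<in>perms n. h \<circ> g \<circ> inv' h = t}"
    have finS: "finite ?S" using finite_perms[of n] by simp
    have ct: "card (supp t) = ?m" unfolding h0(2) supp_conj[OF h0(1)]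
      by (rule card_image[OF inj_on_subset[OF permutes_inj[OF h0(1)] subset_UNIV]])
    have ft: "finite (supp t)" unfolding h0(2) supp_conj[OF h0(1)] using fM by simp
    have inter: "h (g x) = t (h x)" if "h \<in> ?S" for h x
      using that comp_cancel(7)[of h "{1..n}" x] by auto
    have 1: "card ?S \<le> card ((\<lambda>h. restrict h ?B) ` ?S) * fact (n - ?m)"
    proof (rule card_le_image_mult[OF finS])
      fix r assume "r \<in> (\<lambda>h. restrict h ?B) ` ?S"
      then obtain h where h: "h \<in> ?S" "r = restrict h ?B" by blast
      have "{k\<in>?S. restrict k ?B = r} \<subseteq> {k\<in>perms n. \<forall>x\<in>?M. k x = h x}"
      proof (intro subsetI)
        fix k assume k: "k \<in> {k\<in>?S. restrict k ?B = r}"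
        have onB: "k x = h x" if "x \<in> ?B" for x using k h(2) that by (metis (mono_tags, lifting) mem_Collect_eq restrict_apply')
        have "k x = h x" if x: "x \<in> ?M" for x
        proof (cases "x \<in> g ` X")
          case True
          then obtain z where z: "z \<in> X" "x = g z" by blast
          have "z \<in> ?B" using z X1 disj by blast
          then show ?thesis using inter[of k z] inter[OF h(1), of z] k onB z(2) by simp
        next
          case False then show ?thesis using onB x by blast
        qed
        then show "k \<in> {k\<in>perms n. \<forall>x\<in>?M. k x = h x}" using k by blast
      qed
      then have "card {k\<in>?S. restrict k ?B = r} \<le> card {k\<in>perms n. \<forall>x\<in>?M. k x = h x}"
        by (intro card_mono) (use finite_perms[of n] in simp_all)
      also have "\<dots> \<le> fact (n - ?m)" using h by (intro card_agreeing_perms[OF Mn]) blast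
      finally show "card {k\<in>?S. restrict k ?B = r} \<le> fact (n - ?m)" .
    qed
    have "card ((\<lambda>h. restrict h ?B) ` ?S) \<le> card (?B \<rightarrow>\<^sub>E supp t)"
    proof (rule card_mono)
      show "finite (?B \<rightarrow>\<^sub>E supp t)" using fM ft by (intro finite_PiE) auto
      show "(\<lambda>h. restrict h ?B) ` ?S \<subseteq> ?B \<rightarrow>\<^sub>E supp t"
      proof (rule image_subsetI)
        fix h assume h: "h \<in> ?S"
        have "h x \<in> supp t" if "x \<in> ?B" for x
          using supp_conj[of h n g] h that by blast
        then show "restrict h ?B \<in> ?B \<rightarrow>\<^sub>E supp t" by auto
      qed
    qed
    also have "card (?B \<rightarrow>\<^sub>E supp t) = ?m ^ card ?B" using fM ct by (simp add: card_funcsetE)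
    finally have 2: "card ((\<lambda>h. restrict h ?B) ` ?S) \<le> ?m ^ card ?B" .
    show "card ?S \<le> ?m ^ card ?B * fact (n - ?m)" by (rule order.trans[OF 1 mult_right_mono[OF 2]]) simp
  qed
  then have "fact n \<le> card (conj_class n g) * (?m ^ card ?B * fact (n - ?m))"
    by (simp add: conj_class_def card_permutations[of "{1..n}" n])
  then show ?thesis using j by blast
qed

section \<open>Characters at permutations of small support\<close>

definition placements :: "nat set \<Rightarrow> nat set \<Rightarrow> (nat \<Rightarrow> nat) \<Rightarrow> (nat \<Rightarrow> nat) \<Rightarrow> (nat \<Rightarrow> nat) \<Rightarrow>
    nat set \<Rightarrow> (nat \<Rightarrow> nat) \<Rightarrow> nat set \<Rightarrow> (nat \<Rightarrow> nat) set" where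
  "placements M N rw cl s P f0 Y = {f \<in> M \<rightarrow>\<^sub>E N. (\<forall>z\<in>P. f z = f0 z) \<and>
     (\<forall>x\<in>Y. \<exists>u\<in>M. rw (f u) = rw (f (s x)) \<and> cl (f u) = cl (f x))}"

lemma placementsD:
  assumes "f \<in> placements M N rw cl s P f0 Y"
  shows "f \<in> M \<rightarrow>\<^sub>E N" "\<And>u. u \<in> M \<Longrightarrow> f u \<in> N" "\<And>z. z \<in> P \<Longrightarrow> f z = f0 z"
    "\<And>x. x \<in> Y \<Longrightarrow> \<exists>u\<in>M. rw (f u) = rw (f (s x)) \<and> cl (f u) = cl (f x)"
  using assms unfolding placements_def by blast+

lemma placementsI:
  assumes "f \<in> M \<rightarrow>\<^sub>E N" "\<And>z. z \<in> P \<Longrightarrow> f z = f0 z"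
    "\<And>x. x \<in> Y \<Longrightarrow> \<exists>u\<in>M. rw (f u) = rw (f (s x)) \<and> cl (f u) = cl (f x)"
  shows "f \<in> placements M N rw cl s P f0 Y"
  using assms unfolding placements_def by blast

lemma finite_placements: "finite M \<Longrightarrow> finite N \<Longrightarrow> finite (placements M N rw cl s P f0 Y)"
  by (rule finite_subset[of _ "M \<rightarrow>\<^sub>E N"]) (auto simp: placements_def intro: finite_PiE)

lemma card_UN_le_mult:
  assumes "finite I" and "\<And>i. i \<in> I \<Longrightarrow> real (card (A i)) \<le> b" and "real (card I) \<le> c" and "b \<ge> 0"
  shows "real (card (\<Union>i\<in>I. A i)) \<le> c * b"
proof -
  have "real (card (\<Union>i\<in>I. A i)) \<le> real (\<Sum>i\<in>I. card (A i))" using card_UN_le[OF assms(1)] by (simp only: of_nat_le_iff)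
  also have "\<dots> \<le> (\<Sum>i\<in>I. b)" unfolding of_nat_sum by (rule sum_mono) (rule assms(2))
  also have "\<dots> \<le> c * b" using assms(3,4) by (simp add: mult_right_mono)
  finally show ?thesis .
qed

text \<open>Expose the images of one \<open>x\<close> and \<open>s x\<close>: the cell in the row of the latter and the column of the
  former is occupied by one of the two, by a point placed before, or by a new point whose image is
  then determined.  This gives the three terms of \<open>\<theta>\<close>.\<close>

lemma card_placements_le:
  fixes n L :: nat
  assumes fM: "finite M" and fN: "finite N" and cN: "card N = n" and n: "n > 0"
    and inj: "inj_on (\<lambda>v. (rw v, cl v)) N"
    and rL: "\<And>i. card {w\<in>N. rw w = i} \<le> L" and cL: "\<And>i. card {w\<in>N. cl w = i} \<le> L"
    and sM: "\<And>x. x \<in> M \<Longrightarrow> s x \<in> M \<and> s x \<noteq> x"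
    and disj: "\<And>x y. x \<in> X \<Longrightarrow> y \<in> X \<Longrightarrow> x \<noteq> y \<Longrightarrow> {x, s x} \<inter> {y, s y} = {}" and XM: "X \<subseteq> M"
  defines "\<theta> \<equiv> 2 * real L / real n + real (card M) * (real L ^ 2 / real n ^ 2 + 1 / real n)"
  assumes "P \<subseteq> M" "Y \<subseteq> X" "\<And>y. y \<in> Y \<Longrightarrow> y \<notin> P \<and> s y \<notin> P" "f0 ` P \<subseteq> N" "2 * k \<le> card Y + 1"
  shows "real (card (placements M N rw cl s P f0 Y)) \<le> \<theta> ^ k * real n ^ card (M - P)"
  using assms(12-16)
proof (induction k arbitrary: P Y f0)
  case 0
  have "inj_on (\<lambda>f. restrict f (M - P)) (placements M N rw cl s P f0 Y)"
  proof (rule inj_onI)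
    fix f g assume f: "f \<in> placements M N rw cl s P f0 Y" and g: "g \<in> placements M N rw cl s P f0 Y"
      and e: "restrict f (M - P) = restrict g (M - P)"
    note fE = placementsD(1)[OF f] and gE = placementsD(1)[OF g]
    show "f = g"
    proof (rule PiE_ext[OF fE gE])
      fix x assume "x \<in> M"
      then show "f x = g x" 
        using placementsD(3)[OF f] placementsD(3)[OF g] fun_cong[OF e, of x] by (cases "x \<in> P") simp_all
    qed
  qed
  moreover have "(\<lambda>f. restrict f (M - P)) ` placements M N rw cl s P f0 Y \<subseteq> (M - P) \<rightarrow>\<^sub>E N"
  proof (rule image_subsetI)
    fix f assume f: "f \<in> placements M N rw cl s P f0 Y"
    show "restrict f (M - P) \<in> (M - P) \<rightarrow>\<^sub>E N" unfolding restrict_PiE_iff using placementsD(2)[OF f] by blast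
  qed
  ultimately have "card (placements M N rw cl s P f0 Y) \<le> card ((M - P) \<rightarrow>\<^sub>E N)"
    using fM fN by (intro card_inj_on_le) (auto intro: finite_PiE)
  also have "\<dots> = n ^ card (M - P)" using fM cN by (simp add: card_funcsetE)
  finally show ?case by (simp flip: of_nat_power)
next
  case (Suc k)
  let ?Bs = "placements M N rw cl s P f0 Y" and ?c = "card (M - P)"
  define E where "E = \<theta> ^ k * real n ^ ?c"
  have \<theta>0: "\<theta> \<ge> 0" by (simp add: \<theta>_def)
  have E0: "E \<ge> 0" by (simp add: E_def \<theta>0)
  have "card Y > 0" using Suc.prems(5) by simp
  then have "Y \<noteq> {}" by auto
  then obtain x where x: "x \<in> Y" by blast
  have fY: "finite Y" using \<open>card Y > 0\<close> by (rule card_ge_0_finite)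
  have apart: "y \<notin> insert x (insert (s x) P) \<and> s y \<notin> insert x (insert (s x) P)" if y: "y \<in> Y" "y \<noteq> x" for y
  proof -
    have "{x, s x} \<inter> {y, s y} = {}" using x y Suc.prems(2) by (intro disj) auto
    moreover have "y \<notin> P \<and> s y \<notin> P" by (rule Suc.prems(3)[OF y(1)])
    ultimately show ?thesis by blast
  qed
  have xM: "x \<in> M" "s x \<in> M" "s x \<noteq> x" using x Suc.prems(2) XM sM by blast+
  have xP: "x \<notin> P" "s x \<notin> P" using Suc.prems(3)[OF x] by blast+
  have c2: "card (M - insert x (insert (s x) P)) = ?c - 2" "?c \<ge> 2"
  proof -
    have e: "M - insert x (insert (s x) P) = (M - P) - {x, s x}" by blast
    have sub: "{x, s x} \<subseteq> M - P" using xM xP by blast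
    have t: "card {x, s x} = 2" using xM(3) by simp
    show "card (M - insert x (insert (s x) P)) = ?c - 2" unfolding e using card_Diff_subset[OF _ sub] t by simp
    show "?c \<ge> 2" using card_mono[OF _ sub] t fM by simp
  qed
  define b where "b u = (if u \<in> {x, s x} then real L / real n else 0) + (real L ^ 2 / real n ^ 2 + 1 / real n)" for u
  define f2 where "f2 v w = f0(x := v, s x := w)" for v w
  define T where "T v w = placements M N rw cl s (insert x (insert (s x) P)) (f2 v w) (Y - {x})" for v w
  have f2N: "f2 v w ` insert x (insert (s x) P) \<subseteq> N" if "v \<in> N" "w \<in> N" for v w
    using that Suc.prems(4) by (auto simp: f2_def)
  have T: "real (card (T v w)) \<le> E / real n ^ 2" if vw: "v \<in> N" "w \<in> N" for v w
  proof -
    have "real (card (T v w)) \<le> \<theta> ^ k * real n ^ card (M - insert x (insert (s x) P))"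
      unfolding T_def
    proof (rule Suc.IH)
      show "insert x (insert (s x) P) \<subseteq> M" using Suc.prems(1) xM by blast
      show "Y - {x} \<subseteq> X" using Suc.prems(2) by blast
      show "y \<notin> insert x (insert (s x) P) \<and> s y \<notin> insert x (insert (s x) P)" if y: "y \<in> Y - {x}" for y
        using apart y by blast
      show "f2 v w ` insert x (insert (s x) P) \<subseteq> N" by (rule f2N[OF vw])
      show "2 * k \<le> card (Y - {x}) + 1" using Suc.prems(5) x fY by (simp add: card_Diff_singleton)
    qed
    also have "\<dots> = E / real n ^ 2" unfolding c2(1) E_def using c2(2) n by (simp add: power_diff)
    finally show ?thesis .
  qed
  define B where "B u = {f\<in>?Bs. rw (f u) = rw (f (s x)) \<and> cl (f u) = cl (f x)}" for u
  have BT: "f \<in> T (f x) (f (s x)) \<and> f x \<in> N \<and> f (s x) \<in> N" if "f \<in> B u" for f u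
  proof -
    have f: "f \<in> ?Bs" using that by (simp add: B_def)
    have "f \<in> T (f x) (f (s x))" unfolding T_def
    proof (rule placementsI[OF placementsD(1)[OF f]])
      fix z assume "z \<in> insert x (insert (s x) P)"
      then show "f z = f2 (f x) (f (s x)) z" using placementsD(3)[OF f, of z] by (auto simp: f2_def)
    qed (use placementsD(4)[OF f] in blast)
    then show ?thesis using placementsD(2)[OF f] xM by blast
  qed
  have Bu: "real (card (B u)) \<le> b u * E" if u: "u \<in> M" for u
  proof -
    have viaT: "real (card (B u)) \<le> c * (E / real n ^ 2)"
      if I: "I \<subseteq> N \<times> N" "\<And>f. f \<in> B u \<Longrightarrow> (f x, f (s x)) \<in> I" "real (card I) \<le> c" for I c
    proof -
      have fI: "finite I" using I(1) fN finite_subset by blast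
      have "B u \<subseteq> (\<Union>i\<in>I. T (fst i) (snd i))"
      proof
        fix f assume f: "f \<in> B u"
        show "f \<in> (\<Union>i\<in>I. T (fst i) (snd i))" by (rule UN_I[OF I(2)[OF f]]) (use BT[OF f] in simp)
      qed
      moreover have "finite (\<Union>i\<in>I. T (fst i) (snd i))"
        unfolding T_def by (intro finite_UN_I fI finite_placements fM fN)
      ultimately have "real (card (B u)) \<le> real (card (\<Union>i\<in>I. T (fst i) (snd i)))" by (simp add: card_mono)
      also have "\<dots> \<le> c * (E / real n ^ 2)"
        by (rule card_UN_le_mult[OF fI _ I(3)]) (use I(1) T E0 in auto)
      finally show ?thesis .
    qed
    \<comment> \<open>Out of n^2 positions for x and s x: u = x puts s x into the row of x, and u =
      s x puts it into the column of x, which leaves n L each. An old u prescribes the column of x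
      and the row of s x, leaving L^2. A new u leaves all n^2 but has its own position determined,
      which saves one factor n.\<close>
    consider (same) "u = x" | (img) "u = s x" | (old) "u \<in> P" | (new) "u \<notin> insert x (insert (s x) P)" by blast
    then show ?thesis
    proof cases
      case same
      let ?I = "Sigma N (\<lambda>v. {w\<in>N. rw w = rw v})"
      have "card ?I = (\<Sum>v\<in>N. card {w\<in>N. rw w = rw v})" using fN by simp
      also have "\<dots> \<le> (\<Sum>v\<in>N. L)" by (rule sum_mono) (rule rL)
      finally have "real (card ?I) \<le> real n * real L" using cN by (simp flip: of_nat_mult)
      then have "real (card (B u)) \<le> (real n * real L) * (E / real n ^ 2)"
        using BT by (intro viaT[of ?I]) (auto simp: B_def same)
      also have "\<dots> = (real L / real n) * E" using n by (simp add: power2_eq_square)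
      also have "\<dots> \<le> b u * E" using same by (intro mult_right_mono E0) (simp add: b_def)
      finally show ?thesis .
    next
      case img
      let ?I = "Sigma N (\<lambda>v. {w\<in>N. cl w = cl v})"
      have "card ?I = (\<Sum>v\<in>N. card {w\<in>N. cl w = cl v})" using fN by simp
      also have "\<dots> \<le> (\<Sum>v\<in>N. L)" by (rule sum_mono) (rule cL)
      finally have "real (card ?I) \<le> real n * real L" using cN by (simp flip: of_nat_mult)
      then have "real (card (B u)) \<le> (real n * real L) * (E / real n ^ 2)"
        using BT by (intro viaT[of ?I]) (auto simp: B_def img)
      also have "\<dots> = (real L / real n) * E" using n by (simp add: power2_eq_square)
      also have "\<dots> \<le> b u * E" using img by (intro mult_right_mono E0) (simp add: b_def)
      finally show ?thesis .
    next
      case old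
      let ?I = "{v\<in>N. cl v = cl (f0 u)} \<times> {w\<in>N. rw w = rw (f0 u)}"
      have "card ?I \<le> L * L" unfolding card_cartesian_product by (intro mult_mono rL cL) auto
      then have "real (card ?I) \<le> real L ^ 2" by (simp add: power2_eq_square flip: of_nat_mult)
      moreover have "f u = f0 u" if "f \<in> B u" for f using that old placementsD(3) unfolding B_def by blast
      ultimately have "real (card (B u)) \<le> (real L ^ 2) * (E / real n ^ 2)"
        using BT by (intro viaT[of ?I]) (auto simp: B_def)
      also have "\<dots> = (real L ^ 2 / real n ^ 2) * E" by simp
      also have "\<dots> \<le> b u * E" by (intro mult_right_mono E0) (simp add: b_def)
      finally show ?thesis .
    next
      case new
      \<comment> \<open>The entry in the row of the second position and the column of the first. It
        is unique by injectivity of the coordinates, and \<open>?I\<close> contains the pairs for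
        which it exists.\<close>
      define z where "z i = (SOME z. z \<in> N \<and> rw z = rw (snd i) \<and> cl z = cl (fst i))" for i
      let ?P3 = "insert u (insert x (insert (s x) P))" and ?Y3 = "{y \<in> Y - {x}. u \<notin> {y, s y}}"
      define T3 where "T3 i = placements M N rw cl s ?P3 ((f2 (fst i) (snd i))(u := z i)) ?Y3" for i
      let ?I = "{i \<in> N \<times> N. \<exists>z. z \<in> N \<and> rw z = rw (snd i) \<and> cl z = cl (fst i)}"
      have fI: "finite ?I" using fN by simp
      have zi: "z i \<in> N \<and> rw (z i) = rw (snd i) \<and> cl (z i) = cl (fst i)" if "i \<in> ?I" for i
        unfolding z_def by (rule someI_ex) (use that in blast)
      have uM: "u \<in> M - insert x (insert (s x) P)" using u new by blast
      have c3: "card (M - ?P3) = ?c - 3" "?c \<ge> 3"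
      proof -
        have e: "M - ?P3 = (M - insert x (insert (s x) P)) - {u}" by blast
        show "card (M - ?P3) = ?c - 3" unfolding e using uM c2 by (simp add: card_Diff_singleton)
        have "card (M - insert x (insert (s x) P)) > 0" using uM fM by (auto simp: card_gt_0_iff)
        then show "?c \<ge> 3" using c2 by simp
      qed
      \<comment> \<open>The pairs are disjoint, so the new u lies in at most one of those that
        remain. A round thus uses up at most two elements of Y, whence the factor 2 in the condition
        on k.\<close>
      have cY: "2 * k \<le> card ?Y3 + 1"
      proof -
        let ?Z = "{y \<in> Y. u \<in> {y, s y}}"
        have "a = b" if "a \<in> ?Z" "b \<in> ?Z" for a b using disj[of a b] that Suc.prems(2) by blast
        then have "card ?Z \<le> 1" using card_le_Suc0_iff_eq[of ?Z] fY One_nat_def by simp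
        moreover have "Y \<subseteq> insert x (?Y3 \<union> ?Z)" by blast
        then have "card Y \<le> card (insert x (?Y3 \<union> ?Z))" using fY by (intro card_mono) auto
        moreover have "card (insert x (?Y3 \<union> ?Z)) \<le> Suc (card ?Y3 + card ?Z)"
          using card_insert_le_m1 card_Un_le[of ?Y3 ?Z] fY by (simp add: card_insert_if le_SucI)
        ultimately show ?thesis using Suc.prems(5) by simp
      qed
      have T3: "real (card (T3 i)) \<le> E / real n ^ 3" if i: "i \<in> ?I" for i
      proof -
        have "real (card (T3 i)) \<le> \<theta> ^ k * real n ^ card (M - ?P3)"
          unfolding T3_def
        proof (rule Suc.IH[OF _ _ _ _ cY])
          show "?P3 \<subseteq> M" using Suc.prems(1) xM u by blast
          show "?Y3 \<subseteq> X" using Suc.prems(2) by blast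
          show "y \<notin> ?P3 \<and> s y \<notin> ?P3" if y: "y \<in> ?Y3" for y
            using apart[of y] y by blast
          show "((f2 (fst i) (snd i))(u := z i)) ` ?P3 \<subseteq> N"
            using f2N[of "fst i" "snd i"] i zi[OF i] by (auto simp: image_subset_iff)
        qed
        also have "\<dots> = E / real n ^ 3" unfolding c3(1) E_def using c3(2) n by (simp add: power_diff)
        finally show ?thesis .
      qed
      have "B u \<subseteq> (\<Union>i\<in>?I. T3 i)"
      proof
        fix f assume f: "f \<in> B u"
        let ?i = "(f x, f (s x))"
        have fB: "f \<in> ?Bs" and fu: "rw (f u) = rw (f (s x))" "cl (f u) = cl (f x)" using f by (simp_all add: B_def)
        have fuN: "f u \<in> N" by (rule placementsD(2)[OF fB u])
        have i: "?i \<in> ?I" using BT[OF f] fu fuN by auto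
        have "z ?i = f u" by (rule inj_onD[OF inj]) (use zi[OF i] fu fuN in auto)
        have "f \<in> T3 ?i" unfolding T3_def
        proof (rule placementsI[OF placementsD(1)[OF fB]])
          fix y assume "y \<in> ?P3"
          then show "f y = ((f2 (fst ?i) (snd ?i))(u := z ?i)) y"
            using placementsD(3)[OF fB, of y] \<open>z ?i = f u\<close> by (auto simp: f2_def)
        qed (use placementsD(4)[OF fB] in blast)
        then show "f \<in> (\<Union>i\<in>?I. T3 i)" using i by blast
      qed
      moreover have "finite (\<Union>i\<in>?I. T3 i)"
        unfolding T3_def by (intro finite_UN_I fI finite_placements fM fN)
      ultimately have "real (card (B u)) \<le> real (card (\<Union>i\<in>?I. T3 i))" by (simp add: card_mono)
      also have "\<dots> \<le> (real n ^ 2) * (E / real n ^ 3)"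
      proof (rule card_UN_le_mult[OF fI T3])
        have "card ?I \<le> card (N \<times> N)" using fN by (intro card_mono) auto
        then show "real (card ?I) \<le> real n ^ 2" using cN by (simp add: card_cartesian_product power2_eq_square flip: of_nat_mult)
      qed (use E0 in auto)
      also have "\<dots> = (1 / real n) * E" using n by (simp add: power2_eq_square power3_eq_cube)
      also have "\<dots> \<le> b u * E" by (intro mult_right_mono E0) (simp add: b_def)
      finally show ?thesis .
    qed
  qed
  have "?Bs \<subseteq> (\<Union>u\<in>M. B u)"
  proof
    fix f assume f: "f \<in> ?Bs"
    obtain u where "u \<in> M" "rw (f u) = rw (f (s x)) \<and> cl (f u) = cl (f x)" using placementsD(4)[OF f x] by blast
    then show "f \<in> (\<Union>u\<in>M. B u)" using f by (auto simp: B_def)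
  qed
  then have "?Bs = (\<Union>u\<in>M. B u)" unfolding B_def by blast
  then have "real (card ?Bs) \<le> real (\<Sum>u\<in>M. card (B u))" using card_UN_le[OF fM, of B] by (simp only: of_nat_le_iff)
  also have "\<dots> \<le> (\<Sum>u\<in>M. b u * E)" unfolding of_nat_sum by (rule sum_mono) (rule Bu)
  also have "\<dots> = (\<Sum>u\<in>M. b u) * E" by (simp add: sum_distrib_right)
  also have "(\<Sum>u\<in>M. b u) = (\<Sum>u\<in>M. if u \<in> {x, s x} then real L / real n else 0) + real (card M) * (real L ^ 2 / real n ^ 2 + 1 / real n)"
    unfolding b_def by (simp add: sum.distrib)
  also have "(\<Sum>u\<in>M. if u \<in> {x, s x} then real L / real n else 0) = (\<Sum>u\<in>{x, s x}. real L / real n)"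
    using xM fM by (intro sum.mono_neutral_cong_right) auto
  also have "\<dots> = 2 * real L / real n" using xM(3) by simp
  finally show ?case by (simp add: \<theta>_def E_def)
qed

text \<open>If h^-1 g h = p q and x is in X, then w = q (h^-1 x) lies in the column of h^-1 x and in
  the row of h^-1 (g x), and the point h w at this position is moved by g. So h^-1 restricted to the
  support is a placement with a coincidence for every x in X, and at most (n - m)! permutations
  share a restriction.\<close>

lemma psi_small_support:
  assumes nu: "\<nu> \<in> partitions n" and f: "fits n L \<nu>" and g: "g permutes {1..n}" and n: "n > 0"
  defines "m \<equiv> card (supp g)"
  defines "\<theta> \<equiv> 2 * real L / real n + real m * (real L ^ 2 / real n ^ 2 + 1 / real n)"
  shows "\<exists>k. m \<le> 6 * k \<and> \<bar>psi \<nu> g\<bar> \<le> \<theta> ^ k * real n ^ m * fact (n - m) / fact n"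
proof -
  interpret tableau n "row_of \<nu>" "col_of \<nu>" by (rule partition_tableau[OF nu])
  let ?M = "supp g" and ?r = "row_of \<nu>" and ?c = "col_of \<nu>"
  have Mn: "?M \<subseteq> {1..n}" by (rule supp_subset[OF g])
  have fM: "finite ?M" by (rule finite_supp[OF g])
  have ig: "inj g" by (rule permutes_inj[OF g])
  obtain X where X1: "X \<subseteq> ?M" and X2: "\<forall>x\<in>X. \<forall>y\<in>X. x \<noteq> y \<longrightarrow> {x, g x} \<inter> {y, g y} = {}" and X3: "m \<le> 3 * card X"
    unfolding m_def using disjoint_pairs_exist[OF ig fM] by (elim exE conjE)
  \<comment> \<open>Half the number of pairs, rounded up: with m \<le> 3 card X this gives m \<le> 6
    k.\<close>
  define k where "k = (card X + 1) div 2"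
  have k: "2 * k \<le> card X + 1" "m \<le> 6 * k" using X3 by (auto simp: k_def)
  let ?S = "{h\<in>perms n. \<exists>p\<in>fibre_group n ?r. \<exists>q\<in>fibre_group n ?c. inv' h \<circ> g \<circ> h = p \<circ> q}"
  define K where "K = {h\<in>perms n. \<forall>x\<in>X. \<exists>u\<in>?M. ?r (h u) = ?r (h (g x)) \<and> ?c (h u) = ?c (h x)}"
  have finK: "finite K" using finite_perms[of n] by (simp add: K_def)
  have "inv' ` ?S \<subseteq> K"
  proof (rule image_subsetI)
    fix h assume "h \<in> ?S"
    then obtain p q where h: "h permutes {1..n}" and p: "p \<in> fibre_group n ?r" and q: "q \<in> fibre_group n ?c"
      and e: "inv' h \<circ> g \<circ> h = p \<circ> q" by blast
    note qp = fibre_group_permutes[OF q]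
    have ev: "p (q y) = inv' h (g (h y))" for y using fun_cong[OF e, of y] by simp
    have "\<exists>u\<in>?M. ?r (inv' h u) = ?r (inv' h (g x)) \<and> ?c (inv' h u) = ?c (inv' h x)" if x: "x \<in> X" for x
    proof -
      have xM: "x \<in> ?M" using x X1 by blast
      define y where "y = inv' h x"
      define w where "w = q y"
      have yn: "y \<in> {1..n}" using permutes_in_image[OF permutes_inv[OF h]] xM Mn by (auto simp only: y_def)
      have wn: "w \<in> {1..n}" using permutes_in_image[OF qp] yn by (simp only: w_def)
      have hy: "h y = x" unfolding y_def by (rule comp_cancel(6)[OF h])
      have r: "?r w = ?r (inv' h (g x))" using fibre_group_fibre[OF p, of w] ev[of y] by (simp add: w_def hy)
      have c: "?c w = ?c (inv' h x)" using fibre_group_fibre[OF q, of y] by (simp add: w_def y_def)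
      have kw: "inv' h (h w) = w" by (rule comp_cancel(7)[OF h])
      \<comment> \<open>If g fixed h w, then p q would fix w, so q w would have the row and the
        column of w and equal it. From q w = w = q y follows w = y, and then h w = x is a moved
        point after all.\<close>
      have "h w \<in> ?M"
      proof (rule ccontr)
        assume "h w \<notin> ?M"
        then have "p (q w) = w" using ev[of w] kw by (simp add: supp_def)
        then have "?r (q w) = ?r w" using fibre_group_fibre[OF p, of "q w"] by simp
        moreover have "?c (q w) = ?c w" by (rule fibre_group_fibre[OF q])
        moreover have "q w \<in> {1..n}" using permutes_in_image[OF qp] wn by blast
        ultimately have "q w = w" using inj_onD[OF inj, of "q w" w] wn by simp
        then have "w = y" using permutes_inj[OF qp] by (metis w_def injD)
        then show False using \<open>h w \<notin> ?M\<close> hy xM by simp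
      qed
      then show ?thesis using r c kw by (intro bexI[of _ "h w"]) simp_all
    qed
    then show "inv' h \<in> K" using permutes_inv[OF h] by (simp add: K_def)
  qed
  moreover have "inj_on inv' ?S"
  proof (rule inj_onI)
    fix a b assume "a \<in> ?S" "b \<in> ?S" and e: "inv' a = inv' b"
    then have "a permutes {1..n}" "b permutes {1..n}" by blast+
    then show "a = b" using comp_cancel(5) e by metis
  qed
  ultimately have 1: "card ?S \<le> card K" by (intro card_inj_on_le[OF _ _ finK])
  have 2: "card K \<le> card ((\<lambda>h. restrict h ?M) ` K) * fact (n - m)"
  proof (rule card_le_image_mult[OF finK])
    fix r assume "r \<in> (\<lambda>h. restrict h ?M) ` K"
    then obtain h where h: "h \<in> K" "r = restrict h ?M" by blast
    have "{k\<in>K. restrict k ?M = r} \<subseteq> {k\<in>perms n. \<forall>x\<in>?M. k x = h x}"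
    proof
      fix k assume k: "k \<in> {k\<in>K. restrict k ?M = r}"
      have "k x = h x" if "x \<in> ?M" for x
      proof -
        have "restrict k ?M x = restrict h ?M x" using k h(2) by simp
        then show ?thesis using that by simp
      qed
      then show "k \<in> {k\<in>perms n. \<forall>x\<in>?M. k x = h x}" using k by (simp add: K_def)
    qed
    then have "card {k\<in>K. restrict k ?M = r} \<le> card {k\<in>perms n. \<forall>x\<in>?M. k x = h x}"
      by (intro card_mono) (use finite_perms[of n] in simp_all)
    also have "\<dots> \<le> fact (n - m)" unfolding m_def using h by (intro card_agreeing_perms[OF Mn]) (simp add: K_def)
    finally show "card {k\<in>K. restrict k ?M = r} \<le> fact (n - m)" .
  qed
  have 3: "(\<lambda>h. restrict h ?M) ` K \<subseteq> placements ?M {1..n} ?r ?c g {} id X"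
  proof (rule image_subsetI)
    fix h assume h: "h \<in> K"
    then have hp: "h permutes {1..n}" by (simp add: K_def)
    show "restrict h ?M \<in> placements ?M {1..n} ?r ?c g {} id X"
    proof (rule placementsI)
      show "restrict h ?M \<in> ?M \<rightarrow>\<^sub>E {1..n}"
        unfolding restrict_PiE_iff using permutes_in_image[OF hp] Mn by blast
      fix x assume x: "x \<in> X"
      then have xM: "x \<in> ?M" "g x \<in> ?M" using X1 supp_closed[OF ig] by blast+
      obtain u where "u \<in> ?M" "?r (h u) = ?r (h (g x)) \<and> ?c (h u) = ?c (h x)" using h x unfolding K_def by blast
      then show "\<exists>u\<in>?M. ?r (restrict h ?M u) = ?r (restrict h ?M (g x)) \<and> ?c (restrict h ?M u) = ?c (restrict h ?M x)"
        using xM by (intro bexI[of _ u]) simp_all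
    qed simp
  qed
  have fitx: "?r x < L \<and> ?c x < L" if "x \<in> {1..n}" for x using f that unfolding fits_def by blast
  have rL: "card {w\<in>{1..n}. ?r w = i} \<le> L" for i
  proof -
    have "card {w\<in>{1..n}. ?r w = i} \<le> card {..<L}"
    proof (rule card_inj_on_le[of ?c])
      show "inj_on ?c {w\<in>{1..n}. ?r w = i}" by (rule inj_onI, rule inj_onD[OF inj]; simp)
      show "?c ` {w\<in>{1..n}. ?r w = i} \<subseteq> {..<L}" using fitx by blast
    qed simp
    then show ?thesis by simp
  qed
  have cL: "card {w\<in>{1..n}. ?c w = i} \<le> L" for i
  proof -
    have "card {w\<in>{1..n}. ?c w = i} \<le> card {..<L}"
    proof (rule card_inj_on_le[of ?r])
      show "inj_on ?r {w\<in>{1..n}. ?c w = i}" by (rule inj_onI, rule inj_onD[OF inj]; simp)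
      show "?r ` {w\<in>{1..n}. ?c w = i} \<subseteq> {..<L}" using fitx by blast
    qed simp
    then show ?thesis by simp
  qed
  have "real (card (placements ?M {1..n} ?r ?c g {} id X)) \<le> \<theta> ^ k * real n ^ card (?M - {})"
    unfolding \<theta>_def m_def
  proof (rule card_placements_le[OF fM _ _ n inj rL cL, where X = X])
    show "g x \<in> ?M \<and> g x \<noteq> x" if "x \<in> ?M" for x using that supp_closed[OF ig] by (simp add: supp_def)
    show "{x, g x} \<inter> {y, g y} = {}" if "x \<in> X" "y \<in> X" "x \<noteq> y" for x y using X2 that by blast
  qed (use X1 k in auto)
  then have 4: "real (card (placements ?M {1..n} ?r ?c g {} id X)) \<le> \<theta> ^ k * real n ^ m" by (simp add: m_def)
  have "card ((\<lambda>h. restrict h ?M) ` K) \<le> card (placements ?M {1..n} ?r ?c g {} id X)"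
    by (rule card_mono[OF finite_placements 3]) (simp_all add: fM)
  then have "real (card ((\<lambda>h. restrict h ?M) ` K)) \<le> \<theta> ^ k * real n ^ m" using 4 by linarith
  moreover have "real (card ?S) \<le> real (card ((\<lambda>h. restrict h ?M) ` K) * fact (n - m))"
    using order.trans[OF 1 2] by (simp only: of_nat_le_iff)
  then have "real (card ?S) \<le> real (card ((\<lambda>h. restrict h ?M) ` K)) * fact (n - m)"
    by (simp only: of_nat_mult of_nat_fact)
  ultimately have "real (card ?S) \<le> \<theta> ^ k * real n ^ m * fact (n - m)"
    by (meson fact_ge_zero mult_right_mono order.trans)
  then have "\<bar>psi \<nu> g\<bar> \<le> \<theta> ^ k * real n ^ m * fact (n - m) / fact n"
    using abs_psi_le[OF nu, of g] by (meson divide_right_mono fact_ge_zero order.trans)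
  then show ?thesis using k(2) by blast
qed

section \<open>A covering criterion\<close>

definition mtrace :: "complex mat \<Rightarrow> complex" where
  "mtrace A = (\<Sum>i<dim_row A. A $$ (i, i))"

definition matrix_rep :: "nat \<Rightarrow> nat \<Rightarrow> matrep \<Rightarrow> bool" where
  "matrix_rep n d \<rho> \<longleftrightarrow> \<rho> id = 1\<^sub>m d \<and> (\<forall>g. g permutes {1..n} \<longrightarrow> \<rho> g \<in> carrier_mat d d) \<and>
     (\<forall>g h. g permutes {1..n} \<longrightarrow> h permutes {1..n} \<longrightarrow> \<rho> (g \<circ> h) = \<rho> g * \<rho> h)"

lemma matrix_repD:
  assumes "matrix_rep n d \<rho>"
  shows "\<rho> id = 1\<^sub>m d" "g permutes {1..n} \<Longrightarrow> \<rho> g \<in> carrier_mat d d"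
    "g permutes {1..n} \<Longrightarrow> h permutes {1..n} \<Longrightarrow> \<rho> (g \<circ> h) = \<rho> g * \<rho> h"
  using assms by (simp_all add: matrix_rep_def)

lemma matrix_rep_degree: "matrix_rep n d \<rho> \<Longrightarrow> rep_degree \<rho> = d"
  by (simp add: rep_degree_def matrix_repD(1))

lemma matrix_rep_specht: "\<mu> \<in> partitions n \<Longrightarrow> matrix_rep n (specht_dim \<mu>) (specht_rep \<mu>)"
  by (simp add: matrix_rep_def specht_rep_id specht_rep_carrier specht_rep_mult)

lemma mtrace_specht:
  assumes "\<mu> \<in> partitions n" "g permutes {1..n}"
  shows "mtrace (specht_rep \<mu> g) = of_real (chi \<mu> g)"
  using specht_rep_trace[OF assms] specht_rep_carrier[OF assms] by (simp add: mtrace_def)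

lemma representation_matrix_rep:
  assumes r: "representation n \<rho>"
  shows "matrix_rep n (rep_degree \<rho>) \<rho>"
proof -
  let ?d = "rep_degree \<rho>"
  let ?R = "ring_mat TYPE(complex) ?d ()"
  have hom: "\<rho> \<in> hom (sym_group n) (GL ?d)" using r by (simp add: representation_def)
  have c: "\<rho> g \<in> Units ?R" if "g permutes {1..n}" for g
    using hom that by (auto simp: hom_def sym_group_def units_of_def)
  have car: "\<rho> g \<in> carrier_mat ?d ?d" if "g permutes {1..n}" for g
    using c[OF that] by (auto simp: Units_def ring_mat_def)
  have mult: "\<rho> (g \<circ> h) = \<rho> g * \<rho> h" if "g permutes {1..n}" "h permutes {1..n}" for g h
    using hom that by (auto simp: hom_def sym_group_def units_of_def ring_mat_def)
  have "\<rho> id = 1\<^sub>m ?d"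
  proof -
    obtain B where B: "B \<in> carrier_mat ?d ?d" "B * \<rho> id = 1\<^sub>m ?d"
      using c[OF permutes_id] by (auto simp: Units_def ring_mat_def)
    have "\<rho> id * \<rho> id = \<rho> id" using mult[OF permutes_id permutes_id] by simp
    then have "(B * \<rho> id) * \<rho> id = B * \<rho> id" using B(1) car[OF permutes_id] by (simp add: assoc_mult_mat[of _ ?d ?d _ ?d _ ?d])
    then show ?thesis using B(2) car[OF permutes_id] by simp
  qed
  then show ?thesis using car mult by (simp add: matrix_rep_def)
qed

lemma mult_mat_index:
  assumes "A \<in> carrier_mat a b" "B \<in> carrier_mat b c" "i < a" "j < c"
  shows "(A * B) $$ (i, j) = (\<Sum>k<b. A $$ (i, k) * B $$ (k, j))"
  using assms by (auto simp: scalar_prod_def atLeast0LessThan)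

lemma sum_div_mod:
  fixes F :: "nat \<Rightarrow> nat \<Rightarrow> 'a :: comm_monoid_add"
  shows "(\<Sum>k<a * b. F (k div b) (k mod b)) = (\<Sum>i<a. \<Sum>j<b. F i j)"
proof -
  have "(\<Sum>i<a. \<Sum>j<b. F i j) = (\<Sum>p\<in>{..<a} \<times> {..<b}. F (fst p) (snd p))"
    by (simp add: sum.cartesian_product case_prod_beta)
  also have "\<dots> = (\<Sum>k<a * b. F (k div b) (k mod b))"
  proof (rule sum.reindex_bij_witness[of _ "\<lambda>k. (k div b, k mod b)" "\<lambda>p. fst p * b + snd p"])
    fix p assume "p \<in> {..<a} \<times> {..<b}"
    then have p: "fst p < a" "snd p < b" by auto
    show "((fst p * b + snd p) div b, (fst p * b + snd p) mod b) = p" using p by (simp add: prod_eq_iff)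
    have "fst p * b + snd p < (fst p + 1) * b" using p by (simp only: add_mult_distrib)
    also have "\<dots> \<le> a * b" using p by (intro mult_right_mono) auto
    finally show "fst p * b + snd p \<in> {..<a * b}" by simp
    show "F ((fst p * b + snd p) div b) ((fst p * b + snd p) mod b) = F (fst p) (snd p)" using p by simp
  next
    fix k assume "k \<in> {..<a * b}"
    then have k: "k < a * b" by simp
    then have b: "b > 0" by (cases b) auto
    show "(k div b, k mod b) \<in> {..<a} \<times> {..<b}" using k b by (simp add: less_mult_imp_div_less)
    show "fst (k div b, k mod b) * b + snd (k div b, k mod b) = k" by simp
  qed
  finally show ?thesis by simp
qed

lemma kronecker_carrier: 
  "A \<in> carrier_mat a a' \<Longrightarrow> B \<in> carrier_mat b b' \<Longrightarrow> kronecker A B \<in> carrier_mat (a * b) (a' * b')"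
  by (simp add: kronecker_def)

lemma kronecker_index:
  assumes "A \<in> carrier_mat a a'" "B \<in> carrier_mat b b'" "i < a * b" "j < a' * b'"
  shows "kronecker A B $$ (i, j) = A $$ (i div b, j div b') * B $$ (i mod b, j mod b')"
  using assms by (simp add: kronecker_def)

lemma kronecker_mult:
  assumes A: "A \<in> carrier_mat a a" "A' \<in> carrier_mat a a" and B: "B \<in> carrier_mat b b" "B' \<in> carrier_mat b b"
  shows "kronecker (A * A') (B * B') = kronecker A B * kronecker A' B'"
proof (rule eq_matI)
  note c = kronecker_carrier[OF A(1) B(1)] kronecker_carrier[OF A(2) B(2)]
    kronecker_carrier[OF mult_carrier_mat[OF A] mult_carrier_mat[OF B]]
  fix i j assume "i < dim_row (kronecker A B * kronecker A' B')" "j < dim_col (kronecker A B * kronecker A' B')"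
  then have ij: "i < a * b" "j < a * b" using c by auto
  then have b: "b > 0" by (cases b) auto
  have lt: "i div b < a" "j div b < a" "i mod b < b" "j mod b < b" using ij b by (simp_all add: less_mult_imp_div_less)
  have "(kronecker A B * kronecker A' B') $$ (i, j) = (\<Sum>k<a * b. kronecker A B $$ (i, k) * kronecker A' B' $$ (k, j))"
    by (rule mult_mat_index[OF c(1,2) ij])
  also have "\<dots> = (\<Sum>k<a * b. (A $$ (i div b, k div b) * B $$ (i mod b, k mod b)) * (A' $$ (k div b, j div b) * B' $$ (k mod b, j mod b)))"
  proof (rule sum.cong[OF refl])
    fix k assume "k \<in> {..<a * b}"
    then have k: "k < a * b" by simp
    show "kronecker A B $$ (i, k) * kronecker A' B' $$ (k, j) =
      (A $$ (i div b, k div b) * B $$ (i mod b, k mod b)) * (A' $$ (k div b, j div b) * B' $$ (k mod b, j mod b))"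
      by (simp only: kronecker_index[OF A(1) B(1) ij(1) k] kronecker_index[OF A(2) B(2) k ij(2)])
  qed
  also have "\<dots> = (\<Sum>k<a. \<Sum>l<b. (A $$ (i div b, k) * B $$ (i mod b, l)) * (A' $$ (k, j div b) * B' $$ (l, j mod b)))"
    by (rule sum_div_mod)
  also have "\<dots> = (\<Sum>k<a. A $$ (i div b, k) * A' $$ (k, j div b)) * (\<Sum>l<b. B $$ (i mod b, l) * B' $$ (l, j mod b))"
    by (simp add: sum_product mult_ac)
  also have "\<dots> = kronecker (A * A') (B * B') $$ (i, j)"
    by (simp only: kronecker_index[OF mult_carrier_mat[OF A] mult_carrier_mat[OF B] ij]
        mult_mat_index[OF A lt(1,2)] mult_mat_index[OF B lt(3,4)])
  finally show "kronecker (A * A') (B * B') $$ (i, j) = (kronecker A B * kronecker A' B') $$ (i, j)" by simp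
qed (use A B in \<open>auto simp: kronecker_def\<close>)

lemma kronecker_one: "kronecker (1\<^sub>m a) (1\<^sub>m b) = 1\<^sub>m (a * b)"
proof (rule eq_matI)
  fix i j assume "i < dim_row (1\<^sub>m (a * b))" "j < dim_col (1\<^sub>m (a * b))"
  then have ij: "i < a * b" "j < a * b" by auto
  then have b: "b > 0" by (cases b) auto
  have lt: "i div b < a" "j div b < a" "i mod b < b" "j mod b < b" using ij b by (simp_all add: less_mult_imp_div_less)
  have "i = j \<longleftrightarrow> i div b = j div b \<and> i mod b = j mod b" by (metis div_mult_mod_eq)
  then show "kronecker (1\<^sub>m a) (1\<^sub>m b) $$ (i, j) = 1\<^sub>m (a * b) $$ (i, j)"
    using lt ij kronecker_index[of "1\<^sub>m a" a a "1\<^sub>m b" b b i j] by auto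
qed (simp_all add: kronecker_def)

lemma kronecker_trace:
  assumes "A \<in> carrier_mat a a" "B \<in> carrier_mat b b"
  shows "mtrace (kronecker A B) = mtrace A * mtrace B"
proof -
  have "mtrace (kronecker A B) = (\<Sum>k<a * b. A $$ (k div b, k div b) * B $$ (k mod b, k mod b))"
    using kronecker_carrier[OF assms] by (simp add: mtrace_def kronecker_index[OF assms])
  also have "\<dots> = (\<Sum>i<a. \<Sum>j<b. A $$ (i, i) * B $$ (j, j))" by (rule sum_div_mod)
  also have "\<dots> = mtrace A * mtrace B" using assms by (simp add: mtrace_def sum_product)
  finally show ?thesis .
qed

lemma tensor_rep_matrix_rep:
  assumes "\<forall>\<mu>\<in>set ls. \<mu> \<in> partitions n"
  shows "matrix_rep n (\<Prod>\<mu>\<leftarrow>ls. specht_dim \<mu>) (tensor_rep (map specht_rep ls)) \<and>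
    (\<forall>g. g permutes {1..n} \<longrightarrow> mtrace (tensor_rep (map specht_rep ls) g) = of_real (\<Prod>\<mu>\<leftarrow>ls. chi \<mu> g))"
  using assms
proof (induction ls)
  case Nil
  show ?case by (simp add: tensor_rep_def matrix_rep_def mtrace_def)
next
  case (Cons \<mu> ls)
  let ?\<rho> = "tensor_rep (map specht_rep ls)" and ?d = "\<Prod>\<mu>\<leftarrow>ls. specht_dim \<mu>"
  have mu: "\<mu> \<in> partitions n" using Cons.prems by simp
  have IH: "matrix_rep n ?d ?\<rho>" "\<And>g. g permutes {1..n} \<Longrightarrow> mtrace (?\<rho> g) = of_real (\<Prod>\<mu>\<leftarrow>ls. chi \<mu> g)"
    using Cons.IH Cons.prems by auto
  have e: "tensor_rep (map specht_rep (\<mu> # ls)) g = kronecker (specht_rep \<mu> g) (?\<rho> g)" for g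
    by (simp add: tensor_rep_def)
  note M = matrix_repD[OF matrix_rep_specht[OF mu]] and R = matrix_repD[OF IH(1)]
  have "matrix_rep n (specht_dim \<mu> * ?d) (tensor_rep (map specht_rep (\<mu> # ls)))"
    unfolding matrix_rep_def e
  proof (intro conjI allI impI)
    show "kronecker (specht_rep \<mu> id) (?\<rho> id) = 1\<^sub>m (specht_dim \<mu> * ?d)" by (simp only: M(1) R(1) kronecker_one)
    fix g assume g: "g permutes {1..n}"
    show "kronecker (specht_rep \<mu> g) (?\<rho> g) \<in> carrier_mat (specht_dim \<mu> * ?d) (specht_dim \<mu> * ?d)"
      by (rule kronecker_carrier[OF M(2)[OF g] R(2)[OF g]])
    fix h assume h: "h permutes {1..n}"
    show "kronecker (specht_rep \<mu> (g \<circ> h)) (?\<rho> (g \<circ> h)) = kronecker (specht_rep \<mu> g) (?\<rho> g) * kronecker (specht_rep \<mu> h) (?\<rho> h)"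
      unfolding M(3)[OF g h] R(3)[OF g h] by (rule kronecker_mult[OF M(2)[OF g] M(2)[OF h] R(2)[OF g] R(2)[OF h]])
  qed
  moreover have "mtrace (tensor_rep (map specht_rep (\<mu> # ls)) g) = of_real (\<Prod>\<mu>\<leftarrow>\<mu> # ls. chi \<mu> g)" if g: "g permutes {1..n}" for g
    unfolding e kronecker_trace[OF M(2)[OF g] R(2)[OF g]] by (simp add: mtrace_specht[OF mu g] IH(2)[OF g])
  ultimately show ?case by simp
qed

lemma mult_mat_zero_vec: "M \<in> carrier_mat r c \<Longrightarrow> M *\<^sub>v 0\<^sub>v c = 0\<^sub>v r"
  by (rule eq_vecI) auto

lemma invariant_subspaceI:
  assumes "W \<subseteq> carrier_vec (rep_degree \<rho>)" "0\<^sub>v (rep_degree \<rho>) \<in> W"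
    and "\<And>v w. v \<in> W \<Longrightarrow> w \<in> W \<Longrightarrow> v + w \<in> W" "\<And>c v. v \<in> W \<Longrightarrow> c \<cdot>\<^sub>v v \<in> W"
    and "\<And>g w. g permutes {1..n} \<Longrightarrow> w \<in> W \<Longrightarrow> \<rho> g *\<^sub>v w \<in> W"
  shows "invariant_subspace n \<rho> W"
proof -
  have "submodule class_ring W (module_vec TYPE(complex) (rep_degree \<rho>))"
    using assms(1-4) vec_module[where 'a = complex and n = "rep_degree \<rho>"]
    by (intro submodule.intro) (auto simp: module_vec_simps)
  then have "VectorSpace.subspace class_ring W (module_vec TYPE(complex) (rep_degree \<rho>))"
    using vec_vs by (intro VectorSpace.subspace.intro)
  then show ?thesis using assms(5) by (simp add: invariant_subspace_def Sym_eq)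
qed

text \<open>An intertwiner \<open>\<Sum> \<rho>(g) X \<sigma>(g\<inverse>)\<close> is nonzero for some elementary matrix \<open>X\<close>: otherwise
  \<open>\<Sum> tr \<rho>(g) \<sigma>(g\<inverse>) = 0\<close>, which is impossible when the identity dominates, as one sees at an
  entry of largest modulus among all \<open>\<sigma>(h)\<close>.\<close>

lemma irreducible_occurs_in:
  assumes rho: "matrix_rep n D \<rho>" and sig: "irreducible_rep n \<sigma>"
    and dom: "(\<Sum>g\<in>perms n - {id}. cmod (mtrace (\<rho> g))) < real D"
  shows "occurs_in n \<sigma> \<rho>"
proof -
  define s where "s = rep_degree \<sigma>"
  have s: "s > 0" and irr: "\<And>W. invariant_subspace n \<sigma> W \<Longrightarrow> W = {0\<^sub>v s} \<or> W = carrier_vec s"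
    using sig by (auto simp: irreducible_rep_def s_def)
  have sigr: "matrix_rep n s \<sigma>" using sig representation_matrix_rep by (simp add: irreducible_rep_def s_def)
  note R = matrix_repD[OF rho] and S = matrix_repD[OF sigr]
  have degr: "rep_degree \<rho> = D" by (rule matrix_rep_degree[OF rho])
  let ?P = "perms n"
  \<comment> \<open>The (a, b) entry of the sum of \<rho>(g) E \<sigma>(g^-1), where E is the
    elementary matrix with its 1 at (i, j).\<close>
  define co where "co a i j b = (\<Sum>g\<in>?P. \<rho> g $$ (a, i) * \<sigma> (inv' g) $$ (j, b))" for a i j b
  have "\<exists>a<D. \<exists>i<D. \<exists>j<s. \<exists>b<s. co a i j b \<noteq> 0"
  proof (rule ccontr)
    assume "\<not> (\<exists>a<D. \<exists>i<D. \<exists>j<s. \<exists>b<s. co a i j b \<noteq> 0)"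
    then have z: "co a i j b = 0" if "a < D" "i < D" "j < s" "b < s" for a i j b using that by blast
    have tz: "(\<Sum>g\<in>?P. mtrace (\<rho> g) * \<sigma> (inv' g) $$ (j, b)) = 0" if "j < s" "b < s" for j b
    proof -
      have "(\<Sum>g\<in>?P. mtrace (\<rho> g) * \<sigma> (inv' g) $$ (j, b)) = (\<Sum>g\<in>?P. \<Sum>i<D. \<rho> g $$ (i, i) * \<sigma> (inv' g) $$ (j, b))"
        using R(2) by (intro sum.cong refl) (auto simp: mtrace_def sum_distrib_right)
      also have "\<dots> = (\<Sum>i<D. co i i j b)" unfolding co_def by (rule sum.swap)
      also have "\<dots> = 0" using z that by (intro sum.neutral) auto
      finally show ?thesis .
    qed
    \<comment> \<open>Entries in the column of index 0 are enough. The identity matrix contributes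
      the entry 1, so the maximum is positive.\<close>
    define V where "V = (\<lambda>(h, b). cmod (\<sigma> h $$ (b, 0))) ` (?P \<times> {..<s})"
    have finV: "finite V" unfolding V_def using finite_perms[of n] by simp
    have V1: "1 \<in> V" unfolding V_def
      by (rule image_eqI[of _ _ "(id, 0)"]) (use s S(1) in \<open>simp_all add: permutes_id\<close>)
    then have "V \<noteq> {}" by blast
    note Mx = Max_in[OF finV this] Max_ge[OF finV V1]
    then obtain h b where h: "h permutes {1..n}" and b: "b < s" and m: "Max V = cmod (\<sigma> h $$ (b, 0))"
      unfolding V_def by auto
    have le: "cmod (\<sigma> g $$ (b, 0)) \<le> Max V" if "g permutes {1..n}" for g
      using finV that b by (intro Max_ge) (auto simp: V_def intro!: image_eqI[of _ _ "(g, b)"])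
    \<comment> \<open>Multiply the vanishing matrix by \<sigma>(h). The identity contributes D times
      the maximal entry, and any other g at most |tr \<rho>(g)| times its modulus.\<close>
    have "0 = (\<Sum>k<s. (\<Sum>g\<in>?P. mtrace (\<rho> g) * \<sigma> (inv' g) $$ (b, k)) * \<sigma> h $$ (k, 0))"
      using tz[OF b] by (intro sum.neutral[symmetric]) auto
    also have "\<dots> = (\<Sum>g\<in>?P. mtrace (\<rho> g) * (\<Sum>k<s. \<sigma> (inv' g) $$ (b, k) * \<sigma> h $$ (k, 0)))"
      unfolding sum_distrib_right sum_distrib_left by (subst sum.swap) (simp only: mult.assoc)
    also have "\<dots> = (\<Sum>g\<in>?P. mtrace (\<rho> g) * \<sigma> (inv' g \<circ> h) $$ (b, 0))"
    proof (rule sum.cong[OF refl])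
      fix g assume "g \<in> ?P" then have g: "inv' g permutes {1..n}" using permutes_inv by blast
      show "mtrace (\<rho> g) * (\<Sum>k<s. \<sigma> (inv' g) $$ (b, k) * \<sigma> h $$ (k, 0)) = mtrace (\<rho> g) * \<sigma> (inv' g \<circ> h) $$ (b, 0)"
        by (simp only: S(3)[OF g h] mult_mat_index[OF S(2)[OF g] S(2)[OF h] b s])
    qed
    also have "\<dots> = mtrace (\<rho> id) * \<sigma> (inv' id \<circ> h) $$ (b, 0) + (\<Sum>g\<in>?P - {id}. mtrace (\<rho> g) * \<sigma> (inv' g \<circ> h) $$ (b, 0))"
      by (rule sum.remove[OF finite_perms]) (simp add: permutes_id)
    also have "mtrace (\<rho> id) = of_nat D" by (simp add: R(1) mtrace_def)
    also have "inv' id \<circ> h = h" by (simp add: inv_id)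
    finally have "of_nat D * \<sigma> h $$ (b, 0) = - (\<Sum>g\<in>?P - {id}. mtrace (\<rho> g) * \<sigma> (inv' g \<circ> h) $$ (b, 0))"
      by (simp only: eq_neg_iff_add_eq_0)
    then have "cmod (of_nat D * \<sigma> h $$ (b, 0)) = cmod (\<Sum>g\<in>?P - {id}. mtrace (\<rho> g) * \<sigma> (inv' g \<circ> h) $$ (b, 0))"
      by (simp only: norm_minus_cancel)
    then have "real D * Max V = cmod (\<Sum>g\<in>?P - {id}. mtrace (\<rho> g) * \<sigma> (inv' g \<circ> h) $$ (b, 0))"
      by (simp only: norm_mult norm_of_nat m)
    also have "\<dots> \<le> (\<Sum>g\<in>?P - {id}. cmod (mtrace (\<rho> g)) * Max V)"
    proof (rule sum_norm_le)
      fix g assume "g \<in> ?P - {id}"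
      then have "inv' g \<circ> h permutes {1..n}" by (intro permutes_compose h permutes_inv) blast
      then show "cmod (mtrace (\<rho> g) * \<sigma> (inv' g \<circ> h) $$ (b, 0)) \<le> cmod (mtrace (\<rho> g)) * Max V"
        unfolding norm_mult by (intro mult_left_mono le) simp_all
    qed
    also have "\<dots> = (\<Sum>g\<in>?P - {id}. cmod (mtrace (\<rho> g))) * Max V" by (rule sum_distrib_right[symmetric])
    also have "\<dots> < real D * Max V" using dom Mx(2) by (intro mult_strict_right_mono) auto
    finally show False by simp
  qed
  then obtain a0 i j b0 where ij: "a0 < D" "i < D" "j < s" "b0 < s" and nz: "co a0 i j b0 \<noteq> 0" by blast
  define A where "A = mat D s (\<lambda>(a, b). co a i j b)"
  have A: "A \<in> carrier_mat D s" by (simp add: A_def)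
  have Aix: "A $$ (a, b) = co a i j b" if "a < D" "b < s" for a b using that by (simp add: A_def)
  have tw: "A * \<sigma> h = \<rho> h * A" if h: "h permutes {1..n}" for h
  proof (rule eq_matI)
    show "dim_row (A * \<sigma> h) = dim_row (\<rho> h * A)" "dim_col (A * \<sigma> h) = dim_col (\<rho> h * A)"
      using A R(2)[OF h] S(2)[OF h] by auto
    fix a c assume "a < dim_row (\<rho> h * A)" "c < dim_col (\<rho> h * A)"
    then have ac: "a < D" "c < s" using A R(2)[OF h] by auto
    have "(A * \<sigma> h) $$ (a, c) = (\<Sum>b<s. co a i j b * \<sigma> h $$ (b, c))"
      unfolding mult_mat_index[OF A S(2)[OF h] ac] by (intro sum.cong refl) (simp add: Aix ac)
    also have "\<dots> = (\<Sum>g\<in>?P. \<rho> g $$ (a, i) * (\<Sum>b<s. \<sigma> (inv' g) $$ (j, b) * \<sigma> h $$ (b, c)))"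
      unfolding co_def sum_distrib_right sum_distrib_left by (subst sum.swap) (simp only: mult.assoc)
    also have "\<dots> = (\<Sum>g\<in>?P. \<rho> g $$ (a, i) * \<sigma> (inv' g \<circ> h) $$ (j, c))"
    proof (rule sum.cong[OF refl])
      fix g assume "g \<in> ?P" then have g: "inv' g permutes {1..n}" using permutes_inv by blast
      show "\<rho> g $$ (a, i) * (\<Sum>b<s. \<sigma> (inv' g) $$ (j, b) * \<sigma> h $$ (b, c)) = \<rho> g $$ (a, i) * \<sigma> (inv' g \<circ> h) $$ (j, c)"
        by (simp only: S(3)[OF g h] mult_mat_index[OF S(2)[OF g] S(2)[OF h] ij(3) ac(2)])
    qed
    also have "\<dots> = (\<Sum>g\<in>?P. \<rho> (h \<circ> g) $$ (a, i) * \<sigma> (inv' (h \<circ> g) \<circ> h) $$ (j, c))"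
      by (rule sum_perms_left[OF h, symmetric])
    also have "\<dots> = (\<Sum>g\<in>?P. (\<Sum>k<D. \<rho> h $$ (a, k) * \<rho> g $$ (k, i)) * \<sigma> (inv' g) $$ (j, c))"
    proof (rule sum.cong[OF refl])
      fix g assume "g \<in> ?P" then have g: "g permutes {1..n}" by blast
      have e: "inv' (h \<circ> g) \<circ> h = inv' g" by (simp add: inv_comp[OF h g] comp_assoc comp_cancel(2)[OF h])
      show "\<rho> (h \<circ> g) $$ (a, i) * \<sigma> (inv' (h \<circ> g) \<circ> h) $$ (j, c) = (\<Sum>k<D. \<rho> h $$ (a, k) * \<rho> g $$ (k, i)) * \<sigma> (inv' g) $$ (j, c)"
        by (simp only: e R(3)[OF h g] mult_mat_index[OF R(2)[OF h] R(2)[OF g] ac(1) ij(2)])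
    qed
    also have "\<dots> = (\<Sum>k<D. \<rho> h $$ (a, k) * co k i j c)"
      unfolding co_def sum_distrib_right sum_distrib_left by (subst sum.swap) (simp only: mult.assoc)
    also have "\<dots> = (\<rho> h * A) $$ (a, c)"
      unfolding mult_mat_index[OF R(2)[OF h] A ac] by (intro sum.cong refl) (simp add: Aix ac)
    finally show "(A * \<sigma> h) $$ (a, c) = (\<rho> h * A) $$ (a, c)" .
  qed
  have twv: "A *\<^sub>v (\<sigma> h *\<^sub>v v) = \<rho> h *\<^sub>v (A *\<^sub>v v)" if h: "h permutes {1..n}" and v: "v \<in> carrier_vec s" for h v
    using tw[OF h] assoc_mult_mat_vec[OF A S(2)[OF h] v] assoc_mult_mat_vec[OF R(2)[OF h] A v] by simp
  \<comment> \<open>The kernel of the intertwiner is invariant and misses the unit vector of index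
    b0, because the entry of A at (a0, b0) is nonzero. By irreducibility it is zero, so A embeds
    \<sigma>.\<close>
  define K where "K = {v \<in> carrier_vec s. A *\<^sub>v v = 0\<^sub>v D}"
  have "invariant_subspace n \<sigma> K"
  proof (rule invariant_subspaceI)
    show "K \<subseteq> carrier_vec (rep_degree \<sigma>)" by (auto simp: K_def s_def)
    show "0\<^sub>v (rep_degree \<sigma>) \<in> K" using mult_mat_zero_vec[OF A] by (simp add: K_def s_def[symmetric])
    show "v + w \<in> K" if "v \<in> K" "w \<in> K" for v w using that A by (simp add: K_def mult_add_distrib_mat_vec[of A D s])
    have "c \<cdot>\<^sub>v 0\<^sub>v D = (0\<^sub>v D :: complex vec)" for c by (rule eq_vecI) auto
    then show "c \<cdot>\<^sub>v v \<in> K" if "v \<in> K" for c v using that A by (simp add: K_def mult_mat_vec[of A D s])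
    show "\<sigma> g *\<^sub>v w \<in> K" if g: "g permutes {1..n}" and w: "w \<in> K" for g w
    proof -
      have wc: "w \<in> carrier_vec s" "A *\<^sub>v w = 0\<^sub>v D" using w by (auto simp: K_def)
      have "\<rho> g *\<^sub>v 0\<^sub>v D = 0\<^sub>v D" by (rule mult_mat_zero_vec[OF R(2)[OF g]])
      then show ?thesis using twv[OF g wc(1)] wc mult_mat_vec_carrier[OF S(2)[OF g] wc(1)] by (simp add: K_def)
    qed
  qed
  from irr[OF this] have K0: "K = {0\<^sub>v s}"
  proof
    assume "K = carrier_vec s"
    then have "unit_vec s b0 \<in> K" by simp
    then have "(A *\<^sub>v unit_vec s b0) $ a0 = 0" using ij by (simp add: K_def)
    moreover have "(A *\<^sub>v unit_vec s b0) $ a0 = co a0 i j b0"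
      using ij A by (simp add: A_def)
    ultimately show ?thesis using nz by simp
  qed
  define W where "W = (\<lambda>v. A *\<^sub>v v) ` carrier_vec s"
  have "invariant_subspace n \<rho> W"
  proof (rule invariant_subspaceI)
    show "W \<subseteq> carrier_vec (rep_degree \<rho>)" using A degr by (auto simp: W_def)
    have "A *\<^sub>v 0\<^sub>v s = 0\<^sub>v D" by (rule mult_mat_zero_vec[OF A])
    then show "0\<^sub>v (rep_degree \<rho>) \<in> W" unfolding W_def degr by (metis image_eqI zero_carrier_vec)
    show "v + w \<in> W" if vw: "v \<in> W" "w \<in> W" for v w
    proof -
      obtain x y where xy: "x \<in> carrier_vec s" "y \<in> carrier_vec s" "v = A *\<^sub>v x" "w = A *\<^sub>v y" using vw unfolding W_def by blast
      then show ?thesis unfolding W_def using mult_add_distrib_mat_vec[OF A xy(1,2)] by (intro image_eqI[of _ _ "x + y"]) auto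
    qed
    show "c \<cdot>\<^sub>v v \<in> W" if v: "v \<in> W" for c v
    proof -
      obtain x where x: "x \<in> carrier_vec s" "v = A *\<^sub>v x" using v unfolding W_def by blast
      then show ?thesis unfolding W_def using mult_mat_vec[OF A x(1)] by (intro image_eqI[of _ _ "c \<cdot>\<^sub>v x"]) auto
    qed
    show "\<rho> g *\<^sub>v w \<in> W" if g: "g permutes {1..n}" and w: "w \<in> W" for g w
    proof -
      obtain x where x: "x \<in> carrier_vec s" "w = A *\<^sub>v x" using w unfolding W_def by blast
      then show ?thesis unfolding W_def using twv[OF g x(1)] mult_mat_vec_carrier[OF S(2)[OF g] x(1)]
        by (intro image_eqI[of _ _ "\<sigma> g *\<^sub>v x"]) auto
    qed
  qed
  moreover have "bij_betw (\<lambda>v. A *\<^sub>v v) (carrier_vec s) W"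
    unfolding bij_betw_def
  proof
    show "inj_on (\<lambda>v. A *\<^sub>v v) (carrier_vec s)"
    proof (rule inj_onI)
      fix v w assume v: "v \<in> carrier_vec s" and w: "w \<in> carrier_vec s" and e: "A *\<^sub>v v = A *\<^sub>v w"
      have "A *\<^sub>v (v - w) = 0\<^sub>v D" using e A v w by (simp add: mult_minus_distrib_mat_vec[OF A v w])
      then have "v - w \<in> K" using v w by (simp add: K_def)
      then have d: "v - w = 0\<^sub>v s" using K0 by simp
      show "v = w"
      proof (rule eq_vecI)
        fix i assume "i < dim_vec w"
        then have "(v - w) $ i = 0" "i < s" using w d by auto
        then show "v $ i = w $ i" using v w by simp
      qed (use v w in simp)
    qed
  qed (simp add: W_def)
  ultimately show ?thesis
    unfolding occurs_in_def degr s_def[symmetric] using A twv by (auto simp: Sym_eq)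
qed

text \<open>With this exponent the product of \<open>400\<close> characters decays like \<open>n\<^bsup>-4m\<^esup>\<close>.\<close>

definition decays :: "nat \<Rightarrow> nat list \<Rightarrow> bool" where
  "decays n \<mu> \<longleftrightarrow> (\<forall>g. g permutes {1..n} \<longrightarrow> \<bar>psi \<mu> g\<bar> \<le> real n powr (- real (card (supp g)) / 100))"

lemma card_supp_eq_le:
  assumes M: "M \<subseteq> {1..n}"
  shows "card {g\<in>perms n. supp g = M} \<le> n ^ card M"
proof -
  have fM: "finite M" using M finite_subset by blast
  have "inj_on (\<lambda>g. restrict g M) {g\<in>perms n. supp g = M}"
  proof (rule inj_onI)
    fix g h assume g: "g \<in> {g\<in>perms n. supp g = M}" and h: "h \<in> {g\<in>perms n. supp g = M}" and e: "restrict g M = restrict h M"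
    show "g = h"
    proof
      fix x
      have "restrict g M x = restrict h M x" using e by simp
      moreover have "x \<notin> M \<Longrightarrow> g x = x \<and> h x = x" using g h unfolding supp_def by blast
      ultimately show "g x = h x" by (cases "x \<in> M") simp_all
    qed
  qed
  moreover have "(\<lambda>g. restrict g M) ` {g\<in>perms n. supp g = M} \<subseteq> M \<rightarrow>\<^sub>E {1..n}"
  proof (rule image_subsetI)
    fix g assume "g \<in> {g\<in>perms n. supp g = M}"
    then have g: "g permutes {1..n}" by simp
    show "restrict g M \<in> M \<rightarrow>\<^sub>E {1..n}" unfolding restrict_PiE_iff using permutes_in_image[OF g] M by blast
  qed
  ultimately have "card {g\<in>perms n. supp g = M} \<le> card (M \<rightarrow>\<^sub>E {1..n})"
    using fM by (intro card_inj_on_le) (auto intro: finite_PiE)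
  also have "\<dots> = n ^ card M" using fM by (simp add: card_funcsetE)
  finally show ?thesis .
qed

text \<open>At most n^|M| permutations have support M, so the sum is at most the sum of n^(-3|M|)
  over nonempty M. This equals (1 + n^-3)^n - 1 \<le> exp(1/n^2) - 1, which is at most 1/2 for n
  \<ge> 2.\<close>

lemma sum_supp_decay:
  assumes n: "n \<ge> 2"
  shows "(\<Sum>g\<in>perms n - {id}. real n powr (- 4 * real (card (supp g)))) < 1"
proof -
  define y where "y = 1 / real n ^ 3"
  have y0: "y \<ge> 0" by (simp add: y_def)
  let ?w = "\<lambda>M. 1 / real n ^ (4 * card M)"
  have pw: "real n powr (- 4 * real k) = 1 / real n ^ (4 * k)" for k
  proof -
    have "real n powr (- 4 * real k) = inverse (real n powr real (4 * k))" by (simp add: powr_minus[symmetric])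
    also have "\<dots> = 1 / real n ^ (4 * k)" using n by (subst powr_realpow) (simp_all add: divide_inverse)
    finally show ?thesis .
  qed
  have sub: "supp ` (perms n - {id}) \<subseteq> Pow {1..n} - {{}}"
  proof (rule image_subsetI)
    fix g assume g: "g \<in> perms n - {id}"
    then have "supp g \<noteq> {}" by (auto simp: supp_def fun_eq_iff)
    then show "supp g \<in> Pow {1..n} - {{}}" using supp_subset[of g n] g by blast
  qed
  have "(\<Sum>g\<in>perms n - {id}. real n powr (- 4 * real (card (supp g)))) =
    (\<Sum>M\<in>supp ` (perms n - {id}). \<Sum>g\<in>{g\<in>perms n - {id}. supp g = M}. real n powr (- 4 * real (card (supp g))))"
    by (rule sum.image_gen) (simp add: finite_perms)
  also have "\<dots> \<le> (\<Sum>M\<in>supp ` (perms n - {id}). y ^ card M)"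
  proof (rule sum_mono)
    fix M assume "M \<in> supp ` (perms n - {id})"
    then have M: "M \<subseteq> {1..n}" using sub by blast
    have "(\<Sum>g\<in>{g\<in>perms n - {id}. supp g = M}. real n powr (- 4 * real (card (supp g)))) =
      (\<Sum>g\<in>{g\<in>perms n - {id}. supp g = M}. ?w M)" by (intro sum.cong refl) (simp only: pw mem_Collect_eq)
    also have "\<dots> = real (card {g\<in>perms n - {id}. supp g = M}) * ?w M" by simp
    also have "\<dots> \<le> real (n ^ card M) * ?w M"
    proof (intro mult_right_mono)
      have "card {g\<in>perms n - {id}. supp g = M} \<le> card {g\<in>perms n. supp g = M}"
        by (rule card_mono) (use finite_perms[of n] in auto)
      then show "real (card {g\<in>perms n - {id}. supp g = M}) \<le> real (n ^ card M)"
        using card_supp_eq_le[OF M] by linarith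
    qed simp
    also have "\<dots> = y ^ card M"
    proof -
      have "real n ^ (4 * card M) = real n ^ card M * (real n ^ 3) ^ card M"
        by (simp add: power_mult[symmetric] power_add[symmetric])
      then show ?thesis using n by (simp add: y_def power_one_over)
    qed
    finally show "(\<Sum>g\<in>{g\<in>perms n - {id}. supp g = M}. real n powr (- 4 * real (card (supp g)))) \<le> y ^ card M" .
  qed
  also have "\<dots> \<le> (\<Sum>M\<in>Pow {1..n} - {{}}. y ^ card M)"
    by (rule sum_mono2[OF _ sub]) (use y0 in auto)
  also have "\<dots> = (\<Sum>M\<in>Pow {1..n}. y ^ card M) - 1" by (subst sum_diff1) auto
  also have "(\<Sum>M\<in>Pow {1..n}. y ^ card M) = (\<Sum>M\<in>Pow {1..n}. (\<Prod>i\<in>M. y) * (\<Prod>i\<in>{1..n} - M. 1))" by simp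
  also have "\<dots> = (\<Prod>i\<in>{1..n}. y + 1)" by (rule prod_add[symmetric]) simp
  also have "\<dots> = (1 + y) ^ n" by (simp add: add.commute)
  also have "(1 + y) ^ n \<le> exp (real n * y)"
    using exp_ge_add_one_self[of y] y0 by (simp add: exp_of_nat_mult power_mono)
  also have "real n * y = 1 / real n ^ 2" using n by (simp add: y_def power2_eq_square power3_eq_cube)
  also have "exp (1 / real n ^ 2) \<le> exp (1 / 4)"
  proof -
    have "2 ^ 2 \<le> real n ^ 2" using n by (intro power_mono) auto
    then show ?thesis by (simp add: divide_simps)
  qed
  also have "exp (1 / 4 :: real) \<le> 1 + 2 * (1 / 4)" by (rule real_exp_bound_lemma) auto
  finally show ?thesis by linarith
qed

lemma prod_list_power_bound:
  assumes "\<And>\<mu>. \<mu> \<in> set ls \<Longrightarrow> \<bar>f \<mu>\<bar> \<le> (b::real)" and "b \<ge> 0"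
  shows "\<bar>\<Prod>\<mu>\<leftarrow>ls. f \<mu>\<bar> \<le> b ^ length ls"
  using assms(1)
proof (induction ls)
  case (Cons a ls)
  then have "\<bar>f a\<bar> * \<bar>\<Prod>\<mu>\<leftarrow>ls. f \<mu>\<bar> \<le> b * b ^ length ls" using assms(2) by (intro mult_mono) auto
  then show ?case by (simp add: abs_mult)
qed simp

lemma prod_list_chi: "(\<Prod>\<mu>\<leftarrow>ls. chi \<mu> g) = real (\<Prod>\<mu>\<leftarrow>ls. specht_dim \<mu>) * (\<Prod>\<mu>\<leftarrow>ls. psi \<mu> g)"
  by (induction ls) (simp_all add: chi_def)

lemma prod_list_pos: "\<forall>x\<in>set xs. f x > 0 \<Longrightarrow> (\<Prod>x\<leftarrow>xs. f x) > (0 :: nat)"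
  by (induction xs) auto

text \<open>The trace of the tensor product is its degree times the product of the normalized
  characters. After division by the degree, the condition of \<open>irreducible_occurs_in\<close>
  becomes the estimate \<open>sum_supp_decay\<close>.\<close>

lemma covers_of_decay:
  assumes n: "n \<ge> 2" and len: "length ls = 400" and dec: "\<And>\<mu>. \<mu> \<in> set ls \<Longrightarrow> \<mu> \<in> partitions n \<and> decays n \<mu>"
  shows "covers_Irrep n (tensor_rep (map specht_rep ls))"
  unfolding covers_Irrep_def
proof (intro allI impI)
  fix \<sigma> assume sig: "irreducible_rep n \<sigma>"
  let ?\<rho> = "tensor_rep (map specht_rep ls)" and ?D = "\<Prod>\<mu>\<leftarrow>ls. specht_dim \<mu>"
  have T: "matrix_rep n ?D ?\<rho>" "\<And>g. g permutes {1..n} \<Longrightarrow> mtrace (?\<rho> g) = of_real (\<Prod>\<mu>\<leftarrow>ls. chi \<mu> g)"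
    using tensor_rep_matrix_rep[of ls n] dec by auto
  have "\<forall>\<mu>\<in>set ls. specht_dim \<mu> > 0" using dec specht_dim_pos by blast
  then have D: "?D > 0" by (rule prod_list_pos)
  have "(\<Sum>g\<in>perms n - {id}. cmod (mtrace (?\<rho> g))) \<le> (\<Sum>g\<in>perms n - {id}. real ?D * real n powr (- 4 * real (card (supp g))))"
  proof (rule sum_mono)
    fix g assume "g \<in> perms n - {id}"
    then have g: "g permutes {1..n}" by blast
    have "\<bar>\<Prod>\<mu>\<leftarrow>ls. psi \<mu> g\<bar> \<le> (real n powr (- real (card (supp g)) / 100)) ^ length ls"
      by (rule prod_list_power_bound) (use dec g in \<open>auto simp: decays_def\<close>)
    also have "\<dots> = real n powr (- 4 * real (card (supp g)))"
      using n len by (simp add: powr_realpow[symmetric] powr_powr)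
    finally have "real ?D * \<bar>\<Prod>\<mu>\<leftarrow>ls. psi \<mu> g\<bar> \<le> real ?D * real n powr (- 4 * real (card (supp g)))"
      by (rule mult_left_mono) simp
    then show "cmod (mtrace (?\<rho> g)) \<le> real ?D * real n powr (- 4 * real (card (supp g)))"
      by (simp only: T(2)[OF g] norm_of_real prod_list_chi abs_mult abs_of_nat)
  qed
  also have "\<dots> = real ?D * (\<Sum>g\<in>perms n - {id}. real n powr (- 4 * real (card (supp g))))" by (rule sum_distrib_left[symmetric])
  also have "\<dots> < real ?D * 1" using D by (intro mult_strict_left_mono sum_supp_decay n) simp
  finally show "occurs_in n \<sigma> ?\<rho>" by (intro irreducible_occurs_in[OF T(1) sig]) simp
qed

section \<open>Decay of typical characters\<close>

text \<open>The conjugate acts on an initial segment of size m without fixed points there, so it can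
  be treated as an element of the symmetric group of degree m.\<close>

lemma conj_to_initial:
  assumes g: "g permutes {1..n}"
  obtains h where "h permutes {1..n}" "(h \<circ> g \<circ> inv' h) permutes {1..card (supp g)}" "supp (h \<circ> g \<circ> inv' h) = {1..card (supp g)}"
proof -
  let ?M = "supp g" and ?m = "card (supp g)"
  have M: "?M \<subseteq> {1..n}" by (rule supp_subset[OF g])
  have fM: "finite ?M" by (rule finite_supp[OF g])
  have mn: "?m \<le> n" using card_mono[OF _ M] by simp
  obtain f where f: "bij_betw f ?M {1..?m}" using fM by (metis finite_same_card_bij finite_atLeastAtMost card_atLeastAtMost diff_Suc_1 One_nat_def)
  have "card ({1..n} - ?M) = card ({1..n} - {1..?m})"
    using M mn fM by (simp add: card_Diff_subset)
  then obtain f' where f': "bij_betw f' ({1..n} - ?M) ({1..n} - {1..?m})"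
    by (metis finite_same_card_bij finite_Diff finite_atLeastAtMost)
  define h where "h x = (if x \<in> ?M then f x else if x \<in> {1..n} then f' x else x)" for x
  have "bij_betw h (?M \<union> ({1..n} - ?M)) ({1..?m} \<union> ({1..n} - {1..?m}))"
  proof (rule bij_betw_combine)
    show "bij_betw h ?M {1..?m}" using f by (rule bij_betw_cong[THEN iffD1, rotated]) (simp add: h_def)
    show "bij_betw h ({1..n} - ?M) ({1..n} - {1..?m})" using f' by (rule bij_betw_cong[THEN iffD1, rotated]) (simp add: h_def)
  qed blast
  moreover have "?M \<union> ({1..n} - ?M) = {1..n}" "{1..?m} \<union> ({1..n} - {1..?m}) = {1..n}" using M mn by auto
  ultimately have hb: "bij_betw h {1..n} {1..n}" by simp
  have hp: "h permutes {1..n}" by (rule bij_imp_permutes[OF hb]) (use M in \<open>auto simp: h_def\<close>)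
  have sup: "supp (h \<circ> g \<circ> inv' h) = {1..?m}"
  proof -
    have "h ` ?M = f ` ?M" by (rule image_cong) (simp_all add: h_def)
    then show ?thesis unfolding supp_conj[OF hp] using f by (simp add: bij_betw_def)
  qed
  have "(h \<circ> g \<circ> inv' h) permutes {1..n}" by (intro permutes_compose permutes_inv hp g)
  then have "(h \<circ> g \<circ> inv' h) permutes {1..?m}"
  proof (rule permutes_superset)
    fix x assume "x \<in> {1..n} - {1..?m}"
    then have "x \<notin> supp (h \<circ> g \<circ> inv' h)" unfolding sup by blast
    then show "(h \<circ> g \<circ> inv' h) x = x" unfolding supp_def by blast
  qed
  then show ?thesis by (rule that[OF hp _ sup])
qed

lemma card_supp_le: "g permutes {1..n} \<Longrightarrow> card (supp g) \<le> n"
  using card_mono[OF _ supp_subset, of n g] by simp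

lemma nat_power_le_powr:
  assumes "3 * j \<le> 2 * m" "m \<le> n" "m > 0"
  shows "real (m ^ j) \<le> real n powr (2 * real m / 3)"
proof -
  have "real (m ^ j) = real m powr real j" using assms(3) by (simp add: powr_realpow)
  also have "\<dots> \<le> real m powr (2 * real m / 3)" using assms by (intro powr_mono) auto
  also have "\<dots> \<le> real n powr (2 * real m / 3)" using assms by (intro powr_mono2) auto
  finally show ?thesis .
qed

lemma psi_large_support:
  assumes nu: "\<nu> \<in> partitions n" and f: "fits n L \<nu>" and L: "L > 0" and g: "g permutes {1..n}" and m0: "card (supp g) > 0"
  shows "\<bar>psi \<nu> g\<bar> \<le> (2 * exp 1 * real L * real (card (supp g)) powr (- 2 / 3)) ^ card (supp g)"
proof -
  let ?m = "card (supp g)"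
  obtain h where h: "h permutes {1..n}" and s: "(h \<circ> g \<circ> inv' h) permutes {1..?m}" and sup: "supp (h \<circ> g \<circ> inv' h) = {1..?m}"
    by (rule conj_to_initial[OF g])
  let ?s = "h \<circ> g \<circ> inv' h"
  \<comment> \<open>The quotient of the bound m^(m/3) for the character by the bound (m / (2 e L))^m
    for the dimension; this is the identity \<open>e\<close> below.\<close>
  define B where "B = (2 * exp 1 * real L * real ?m powr (- 2 / 3)) ^ ?m"
  obtain j where j: "3 * j \<le> 2 * ?m" and cs: "fact ?m \<le> card (conj_class ?m ?s) * ?m ^ j"
    using conj_class_size[OF s] unfolding sup by auto
  have "\<bar>psi \<nu> ?s\<bar> \<le> B"
  proof (rule psi_restrict_bound[OF nu card_supp_le[OF g] f s])
    fix \<mu> assume mu: "\<mu> \<in> partitions ?m" and fm: "fits ?m L \<mu>"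
    let ?d = "real (specht_dim \<mu>)"
    have fin: "finite (partitions ?m)" using finite_nonempty_partitions by blast
    have "(chi \<mu> ?s)\<^sup>2 \<le> (\<Sum>\<mu>\<in>partitions ?m. (chi \<mu> ?s)\<^sup>2)" by (rule member_le_sum[OF mu _ fin]) simp
    also have "\<dots> = fact ?m / real (card (conj_class ?m ?s))" by (rule chi_square_sum[OF s])
    also have "\<dots> \<le> real (?m ^ j)"
    proof -
      have "real (fact ?m) \<le> real (card (conj_class ?m ?s) * ?m ^ j)" using cs by (simp only: of_nat_le_iff)
      then show ?thesis using card_conj_class_pos[of ?m ?s] by (simp add: divide_le_eq mult.commute)
    qed
    also have "\<dots> \<le> real ?m powr (2 * real ?m / 3)" by (rule nat_power_le_powr[OF j order_refl m0])
    also have "\<dots> = (real ?m powr (real ?m / 3))\<^sup>2" by (simp add: power2_eq_square powr_add[symmetric])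
    finally have 1: "\<bar>chi \<mu> ?s\<bar> \<le> real ?m powr (real ?m / 3)" by (simp add: abs_le_square_iff[symmetric])
    have 2: "(real ?m / (2 * real L)) ^ ?m \<le> ?d * exp (real ?m)" by (rule specht_dim_ge[OF mu fm L])
    have e: "B * ((real ?m / (2 * real L)) ^ ?m * exp (- real ?m)) = real ?m powr (real ?m / 3)"
    proof -
      have "exp (- real ?m) = exp (- 1) ^ ?m" by (simp add: exp_of_nat_mult[symmetric])
      then have "B * ((real ?m / (2 * real L)) ^ ?m * exp (- real ?m)) =
        ((2 * exp 1 * real L * real ?m powr (- 2 / 3)) * ((real ?m / (2 * real L)) * exp (- 1))) ^ ?m"
        unfolding B_def by (simp only: power_mult_distrib)
      also have "(2 * exp 1 * real L * real ?m powr (- 2 / 3)) * ((real ?m / (2 * real L)) * exp (- 1)) = real ?m powr (- 2 / 3) * real ?m"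
        using L by (simp add: exp_minus field_simps)
      also have "\<dots> = real ?m powr (1 / 3)"
        using m0 powr_add[of "real ?m" "- 2 / 3" 1] by simp
      also have "\<dots> ^ ?m = real ?m powr (real ?m / 3)" using m0 by (simp add: powr_realpow[symmetric] powr_powr)
      finally show ?thesis .
    qed
    have "(real ?m / (2 * real L)) ^ ?m * exp (- real ?m) \<le> ?d * exp (real ?m) * exp (- real ?m)"
      by (rule mult_right_mono[OF 2]) simp
    also have "\<dots> = ?d" by (simp add: exp_minus)
    finally have "(real ?m / (2 * real L)) ^ ?m * exp (- real ?m) \<le> ?d" .
    then have "B * ((real ?m / (2 * real L)) ^ ?m * exp (- real ?m)) \<le> B * ?d"
      by (rule mult_left_mono) (simp add: B_def)
    then show "\<bar>chi \<mu> ?s\<bar> \<le> B * ?d" using 1 e by linarith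
  qed
  then show ?thesis by (simp only: psi_conj[OF nu h] B_def)
qed

lemma power_mult_fact_le: "k ^ m * fact k \<le> (fact (k + m) :: nat)"
proof (induction m)
  case (Suc m)
  have "k ^ Suc m * fact k = k * (k ^ m * fact k)" by simp
  also have "\<dots> \<le> (k + Suc m) * fact (k + m)" using Suc by (intro mult_mono) auto
  finally show ?case by simp
qed simp

text \<open>For m \<le> n/2 one has n \<le> 2 (n - m), so the factor n^m (n - m)! / n! is at most
  2^m. From m \<le> 6 k and \<tau> \<le> 1 the k-th power of \<theta> is at most
  \<tau>^(m/6).\<close>

lemma psi_small_support':
  assumes nu: "\<nu> \<in> partitions n" and f: "fits n L \<nu>" and L: "L > 0" and g: "g permutes {1..n}" and n: "n > 0"
    and m: "2 * card (supp g) \<le> n"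
    and t: "2 * real L / real n + real (card (supp g)) * (real L ^ 2 / real n ^ 2 + 1 / real n) \<le> \<tau>" and t1: "\<tau> \<le> 1"
  shows "\<bar>psi \<nu> g\<bar> \<le> (2 * \<tau> powr (1 / 6)) ^ card (supp g)"
proof -
  let ?m = "card (supp g)"
  let ?\<theta> = "2 * real L / real n + real ?m * (real L ^ 2 / real n ^ 2 + 1 / real n)"
  obtain k where k: "?m \<le> 6 * k" and b: "\<bar>psi \<nu> g\<bar> \<le> ?\<theta> ^ k * real n ^ ?m * fact (n - ?m) / fact n"
    using psi_small_support[OF nu f g n] by blast
  have \<theta>0: "?\<theta> > 0" using L n by (intro add_pos_nonneg) auto
  then have tp: "\<tau> > 0" using t by linarith
  have "?\<theta> ^ k \<le> \<tau> ^ k" using t \<theta>0 by (intro power_mono) auto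
  also have "\<dots> = \<tau> powr real k" using tp by (simp add: powr_realpow)
  also have "\<dots> \<le> \<tau> powr (real ?m / 6)" using tp t1 k by (intro powr_mono') auto
  also have "\<dots> = (\<tau> powr (1 / 6)) ^ ?m" using tp by (simp add: powr_realpow[symmetric] powr_powr)
  finally have 1: "?\<theta> ^ k \<le> (\<tau> powr (1 / 6)) ^ ?m" .
  have 2: "real n ^ ?m * fact (n - ?m) / fact n \<le> 2 ^ ?m"
  proof -
    have "real n ^ ?m \<le> (2 * real (n - ?m)) ^ ?m" using m by (intro power_mono) auto
    then have "real n ^ ?m * fact (n - ?m) \<le> 2 ^ ?m * (real (n - ?m) ^ ?m * fact (n - ?m))"
      by (simp add: power_mult_distrib mult_right_mono)
    also have "real (n - ?m) ^ ?m * fact (n - ?m) = real ((n - ?m) ^ ?m * fact (n - ?m))" by simp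
    also have "\<dots> \<le> real (fact n)"
      using power_mult_fact_le[of "n - ?m" ?m] m by (simp only: of_nat_le_iff) simp
    finally show ?thesis by (simp add: divide_le_eq)
  qed
  have "?\<theta> ^ k * real n ^ ?m * fact (n - ?m) / fact n = ?\<theta> ^ k * (real n ^ ?m * fact (n - ?m) / fact n)" by simp
  also have "\<dots> \<le> (\<tau> powr (1 / 6)) ^ ?m * 2 ^ ?m" using \<theta>0 by (intro mult_mono 1 2) auto
  also have "\<dots> = (2 * \<tau> powr (1 / 6)) ^ ?m" by (simp add: power_mult_distrib mult.commute)
  finally show ?thesis using b by linarith
qed

text \<open>The bounds for small and large support overlap if rows and columns are at most \<open>n\<^sup>a\<close> and the
  threshold is \<open>n\<^sup>b\<close> with \<open>3a/2 < b < 2 - 2a\<close>; here \<open>a = 13/25\<close> and \<open>b = 17/20\<close>.\<close>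

definition row_bound :: "nat \<Rightarrow> nat" where
  "row_bound n = nat \<lceil>real n powr (13 / 25)\<rceil>"

lemma row_bound:
  assumes "n > 0"
  shows "row_bound n > 0" "real (row_bound n) \<le> 2 * real n powr (13 / 25)" "real n powr (13 / 25) \<le> real (row_bound n)"
proof -
  have p: "real n powr (13 / 25) \<ge> 1" using assms by (intro ge_one_powr_ge_zero) auto
  show "real n powr (13 / 25) \<le> real (row_bound n)" unfolding row_bound_def by linarith
  then show "row_bound n > 0" using p by (cases "row_bound n") auto
  have "real (row_bound n) \<le> real n powr (13 / 25) + 1" unfolding row_bound_def using p by linarith
  then show "real (row_bound n) \<le> 2 * real n powr (13 / 25)" using p by linarith
qed

lemma eventually_decays:
  "\<forall>\<^sub>F n in sequentially. \<forall>\<nu>\<in>partitions n. fits n (row_bound n) \<nu> \<longrightarrow> decays n \<nu>"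
proof -
  \<comment> \<open>The coincidence parameter for m \<le> n^(17/20) and L \<le> 2 n^(13/25). Its
    dominant term has exponent 17/20 + 26/25 - 2 = -11/100, and the sixth root still decays faster
    than n^(-1/100).\<close>
  define \<tau> where "\<tau> n = 4 * real n powr (13 / 25) / real n + real n powr (17 / 20) * (4 * real n powr (26 / 25) / real n ^ 2 + 1 / real n)" for n :: nat
  have 1: "\<forall>\<^sub>F n in sequentially. 2 * real n powr (17 / 20) \<le> real n" by real_asymp
  have 2: "\<forall>\<^sub>F n in sequentially. \<tau> n \<le> 1" unfolding \<tau>_def by real_asymp
  have 3: "\<forall>\<^sub>F n in sequentially. 2 * \<tau> n powr (1 / 6) \<le> real n powr (- 1 / 100)" unfolding \<tau>_def by real_asymp
  \<comment> \<open>The exponent on the left is 13/25 - (2/3) (17/20) = -7/150.\<close>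
  have 4: "\<forall>\<^sub>F n in sequentially. 2 * exp 1 * (2 * real n powr (13 / 25)) * (real n powr (17 / 20)) powr (- 2 / 3) \<le> real n powr (- 1 / 100)"
    by real_asymp
  show ?thesis using 1 2 3 4 eventually_gt_at_top[of 0]
  proof eventually_elim
    fix n :: nat
    assume a1: "2 * real n powr (17 / 20) \<le> real n" and a2: "\<tau> n \<le> 1" and a3: "2 * \<tau> n powr (1 / 6) \<le> real n powr (- 1 / 100)"
      and a4: "2 * exp 1 * (2 * real n powr (13 / 25)) * (real n powr (17 / 20)) powr (- 2 / 3) \<le> real n powr (- 1 / 100)" and n: "n > 0"
    note L = row_bound[OF n]
    let ?L = "row_bound n"
    have target: "(real n powr (- 1 / 100)) ^ m = real n powr (- real m / 100)" for m
      using n by (simp add: powr_realpow[symmetric] powr_powr)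
    show "\<forall>\<nu>\<in>partitions n. fits n ?L \<nu> \<longrightarrow> decays n \<nu>"
      unfolding decays_def
    proof (intro ballI impI allI)
      fix \<nu> g assume nu: "\<nu> \<in> partitions n" and f: "fits n ?L \<nu>" and g: "g permutes {1..n}"
      let ?m = "card (supp g)"
      show "\<bar>psi \<nu> g\<bar> \<le> real n powr (- real ?m / 100)"
      proof (cases "real ?m \<le> real n powr (17 / 20)")
        case True
        have "real ?L ^ 2 \<le> (2 * real n powr (13 / 25)) ^ 2" using L by (intro power_mono) auto
        also have "\<dots> = 4 * real n powr (26 / 25)" by (simp add: power2_eq_square powr_add[symmetric])
        finally have L2: "real ?L ^ 2 \<le> 4 * real n powr (26 / 25)" .
        have t: "2 * real ?L / real n + real ?m * (real ?L ^ 2 / real n ^ 2 + 1 / real n) \<le> \<tau> n"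
          unfolding \<tau>_def
        proof (rule add_mono)
          show "2 * real ?L / real n \<le> 4 * real n powr (13 / 25) / real n"
            by (rule divide_right_mono) (use L in linarith, simp)
          have "real ?L ^ 2 / real n ^ 2 + 1 / real n \<le> 4 * real n powr (26 / 25) / real n ^ 2 + 1 / real n"
            using L2 by (simp add: divide_right_mono)
          then show "real ?m * (real ?L ^ 2 / real n ^ 2 + 1 / real n) \<le>
            real n powr (17 / 20) * (4 * real n powr (26 / 25) / real n ^ 2 + 1 / real n)"
            by (intro mult_mono True) simp_all
        qed
        have "2 * ?m \<le> n" using True a1 by linarith
        then have "\<bar>psi \<nu> g\<bar> \<le> (2 * \<tau> n powr (1 / 6)) ^ ?m"
          by (rule psi_small_support'[OF nu f L(1) g n _ t a2])
        also have "\<dots> \<le> (real n powr (- 1 / 100)) ^ ?m" using a3 by (intro power_mono) auto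
        finally show ?thesis by (simp only: target)
      next
        case False
        then have m: "real ?m > real n powr (17 / 20)" by simp
        then have m0: "?m > 0" by (metis of_nat_0_less_iff order.strict_trans1 powr_ge_zero)
        have "real ?m powr (- 2 / 3) \<le> (real n powr (17 / 20)) powr (- 2 / 3)"
          using m n by (intro powr_mono2') auto
        then have "2 * exp 1 * real ?L * real ?m powr (- 2 / 3) \<le> 2 * exp 1 * (2 * real n powr (13 / 25)) * (real n powr (17 / 20)) powr (- 2 / 3)"
          using L by (intro mult_mono) auto
        then have le: "2 * exp 1 * real ?L * real ?m powr (- 2 / 3) \<le> real n powr (- 1 / 100)" using a4 by linarith
        have "\<bar>psi \<nu> g\<bar> \<le> (2 * exp 1 * real ?L * real ?m powr (- 2 / 3)) ^ ?m"
          by (rule psi_large_support[OF nu f L(1) g m0])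
        also have "\<dots> \<le> (real n powr (- 1 / 100)) ^ ?m" using le by (intro power_mono) auto
        finally show ?thesis by (simp only: target)
      qed
    qed
  qed
qed

section \<open>Second moments and the Plancherel law\<close>

lemma compositions_card:
  "finite {xs :: nat list. 0 \<notin> set xs \<and> sum_list xs = m} \<and> card {xs :: nat list. 0 \<notin> set xs \<and> sum_list xs = m} \<le> 2 ^ m"
proof (induction m rule: less_induct)
  case (less m)
  let ?C = "\<lambda>m. {xs :: nat list. 0 \<notin> set xs \<and> sum_list xs = m}"
  show ?case
  proof (cases "m = 0")
    case True
    have "?C m = {[]}"
    proof -
      have "xs = []" if "0 \<notin> set xs" "sum_list xs = 0" for xs :: "nat list" using that by (cases xs) auto
      then show ?thesis using True by auto
    qed
    then show ?thesis by simp
  next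
    case False
    have sub: "?C m \<subseteq> (\<Union>j\<in>{1..m}. (#) j ` ?C (m - j))"
    proof
      fix xs assume xs: "xs \<in> ?C m"
      then obtain j ys where e: "xs = j # ys" using False by (cases xs) auto
      then have "j \<in> {1..m}" "ys \<in> ?C (m - j)" using xs by (auto simp: Suc_le_eq One_nat_def)
      then show "xs \<in> (\<Union>j\<in>{1..m}. (#) j ` ?C (m - j))" using e by blast
    qed
    have IH: "finite (?C (m - j))" "card (?C (m - j)) \<le> 2 ^ (m - j)" if "j \<in> {1..m}" for j
      using less.IH[of "m - j"] that False by auto
    have fin: "finite (\<Union>j\<in>{1..m}. (#) j ` ?C (m - j))" using IH(1) by blast
    have "card (?C m) \<le> card (\<Union>j\<in>{1..m}. (#) j ` ?C (m - j))" by (rule card_mono[OF fin sub])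
    also have "\<dots> \<le> (\<Sum>j\<in>{1..m}. card ((#) j ` ?C (m - j)))" by (rule card_UN_le) simp
    also have "\<dots> \<le> (\<Sum>j\<in>{1..m}. 2 ^ (m - j))"
    proof (rule sum_mono)
      fix j assume j: "j \<in> {1..m}"
      show "card ((#) j ` ?C (m - j)) \<le> 2 ^ (m - j)" using card_image_le[OF IH(1)[OF j], of "(#) j"] IH(2)[OF j] by linarith
    qed
    also have "\<dots> = (\<Sum>i\<in>{..<m}. 2 ^ i)"
      by (rule sum.reindex_bij_witness[of _ "\<lambda>i. m - i" "\<lambda>j. m - j"]) auto
    also have "\<dots> \<le> 2 ^ m" by (simp add: sum_power2 lessThan_atLeast0)
    finally show ?thesis using finite_subset[OF sub fin] by blast
  qed
qed

text \<open>An exponential bound in m is enough, since in the union over classes it is multiplied by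
  a negative power of n raised to the m.\<close>

lemma card_partitions_le: "card (partitions m) \<le> 2 ^ m"
proof -
  have "card (partitions m) \<le> card {xs :: nat list. 0 \<notin> set xs \<and> sum_list xs = m}"
    by (rule card_mono) (use compositions_card[of m] in \<open>auto simp: partitions_def\<close>)
  then show ?thesis using compositions_card[of m] by linarith
qed

text \<open>A permutation with support of size m is conjugate to one moving exactly 1, ..., m, and
  conjugation inside the group of degree m leaves at most 2^m of these. The representatives depend
  on m alone, so checking decay on the whole group costs a union over 2^m elements for each
  m.\<close>

lemma conj_class_representatives:
  obtains R where "card R \<le> 2 ^ m" "finite R" "\<And>r. r \<in> R \<Longrightarrow> r permutes {1..m} \<and> supp r = {1..m}"
    "\<And>g n. g permutes {1..n} \<Longrightarrow> card (supp g) = m \<Longrightarrow> \<exists>r\<in>R. \<forall>\<mu>\<in>partitions n. psi \<mu> r = psi \<mu> g"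
proof -
  let ?S = "{s. s permutes {1..m} \<and> supp s = {1..m}}"
  define rep where "rep C = (SOME s. s \<in> C \<and> s \<in> ?S)" for C
  define R where "R = rep ` conj_class m ` ?S"
  have rep: "rep (conj_class m s) \<in> conj_class m s \<and> rep (conj_class m s) \<in> ?S" if "s \<in> ?S" for s
    unfolding rep_def by (rule someI[of _ s]) (use that conj_class_self in blast)
  have finS: "finite ?S" by (rule finite_subset[OF _ finite_perms[of m]]) blast
  have "card R \<le> card (conj_class m ` ?S)" unfolding R_def by (rule card_image_le) (simp add: finS)
  also have "\<dots> \<le> card (conj_class m ` perms m)" by (rule card_mono) (auto simp: finite_perms)
  also have "\<dots> \<le> 2 ^ m" using card_conj_classes[of m] card_partitions_le[of m] by linarith
  finally have c: "card R \<le> 2 ^ m" .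
  have f: "finite R" unfolding R_def using finS by simp
  have p: "r permutes {1..m} \<and> supp r = {1..m}" if "r \<in> R" for r using that rep unfolding R_def by blast
  have q: "\<exists>r\<in>R. \<forall>\<mu>\<in>partitions n. psi \<mu> r = psi \<mu> g" if g: "g permutes {1..n}" and m: "card (supp g) = m" for g n
  proof -
    obtain h where h: "h permutes {1..n}" "(h \<circ> g \<circ> inv' h) permutes {1..m}" "supp (h \<circ> g \<circ> inv' h) = {1..m}"
      using conj_to_initial[OF g] m by metis
    let ?s = "h \<circ> g \<circ> inv' h"
    have sS: "?s \<in> ?S" using h by blast
    obtain k where k: "k permutes {1..m}" "rep (conj_class m ?s) = k \<circ> ?s \<circ> inv' k"
      using rep[OF sS] unfolding conj_class_def by blast
    have kn: "k permutes {1..n}" using perms_mono[OF _ k(1)] card_supp_le[OF g] m by blast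
    have "psi \<mu> (rep (conj_class m ?s)) = psi \<mu> g" if "\<mu> \<in> partitions n" for \<mu>
      unfolding k(2) psi_conj[OF that kn] by (rule psi_conj[OF that h(1)])
    then show ?thesis using sS unfolding R_def by blast
  qed
  show ?thesis by (rule that[OF c f p q])
qed

text \<open>Combines (n/m)^m \<le> binomial(n, m) with m^m \<le> m! e^m. The loss of e per moved
  point is uniform up to m = n.\<close>

lemma power_fact_ratio:
  assumes m: "m \<le> n"
  shows "real n ^ m * fact (n - m) \<le> fact n * exp (real m)"
proof (cases "m = 0")
  case False
  have "real n ^ m = (real n / real m) ^ m * real m ^ m" using False by (simp add: power_divide)
  also have "\<dots> \<le> real (n choose m) * (fact m * exp (real m))"
    using binomial_ge_n_over_k_pow_k[OF m, where 'a = real] power_le_fact_exp[of "real m" m] by (intro mult_mono) auto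
  finally have "real n ^ m * fact (n - m) \<le> real (n choose m) * (fact m * exp (real m)) * fact (n - m)"
    by (rule mult_right_mono) simp
  also have "\<dots> = real (fact m * fact (n - m) * (n choose m)) * exp (real m)" by simp
  also have "\<dots> = fact n * exp (real m)" by (simp only: binomial_fact_lemma[OF m] of_nat_fact)
  finally show ?thesis .
qed simp

text \<open>The size of the class C is at least n! / (m^j (n - m)!) with j \<le> 2m/3, and n! / (n -
  m)! is at least n^m e^-m. Bounding m^j by n^(2m/3) leaves (n^(1/3) / e)^m.\<close>

lemma inverse_conj_class_size:
  assumes g: "g permutes {1..n}" and m0: "card (supp g) > 0"
  shows "1 / real (card (conj_class n g)) \<le> (exp 1 * real n powr (- 1 / 3)) ^ card (supp g)"
proof -
  let ?m = "card (supp g)" and ?k = "real (card (conj_class n g))"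
  have mn: "?m \<le> n" by (rule card_supp_le[OF g])
  have n: "n > 0" using mn m0 by simp
  have k: "?k > 0" using card_conj_class_pos by simp
  obtain j where j: "3 * j \<le> 2 * ?m" and c: "fact n \<le> card (conj_class n g) * (?m ^ j * fact (n - ?m))"
    using conj_class_size[OF g] by blast
  have "real (fact n) \<le> real (card (conj_class n g) * (?m ^ j * fact (n - ?m)))" using c by (simp only: of_nat_le_iff)
  then have c': "fact n \<le> ?k * (real (?m ^ j) * fact (n - ?m))" by simp
  have "real n ^ ?m * fact (n - ?m) \<le> fact n * exp (real ?m)" by (rule power_fact_ratio[OF mn])
  also have "\<dots> \<le> (?k * (real (?m ^ j) * fact (n - ?m))) * exp (real ?m)" using c' by (rule mult_right_mono) simp
  finally have "real n ^ ?m \<le> ?k * real (?m ^ j) * exp (real ?m)" by simp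
  also have "\<dots> \<le> ?k * real n powr (2 * real ?m / 3) * exp (real ?m)"
    using nat_power_le_powr[OF j mn m0] k by (intro mult_right_mono mult_left_mono) auto
  finally have "real n ^ ?m / (?k * real n powr (2 * real ?m / 3)) \<le> exp (real ?m)"
    using k n by (simp add: divide_le_eq mult_ac)
  moreover have "1 / ?k * (real n powr real ?m * real n powr (- (2 * real ?m / 3))) = real n ^ ?m / (?k * real n powr (2 * real ?m / 3))"
    using n by (simp only: powr_minus divide_inverse inverse_mult_distrib powr_realpow of_nat_0_less_iff mult_1_left mult_ac)
  ultimately have "1 / ?k * (real n powr real ?m * real n powr (- (2 * real ?m / 3))) \<le> exp (real ?m)" by linarith
  then have 1: "1 / ?k * real n powr (real ?m / 3) \<le> exp (real ?m)" by (simp add: powr_add[symmetric])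
  have "1 / ?k = (1 / ?k * real n powr (real ?m / 3)) * real n powr (- (real ?m / 3))"
    using n by (simp add: powr_minus)
  also have "\<dots> \<le> exp (real ?m) * real n powr (- (real ?m / 3))" using 1 by (rule mult_right_mono) simp
  also have "\<dots> = (exp 1 * real n powr (- 1 / 3)) ^ ?m"
    using n by (simp add: power_mult_distrib powr_realpow[symmetric] powr_powr exp_of_nat_mult[symmetric])
  finally show ?thesis .
qed

lemma plancherel_not_decays:
  assumes n: "n > 0"
  shows "(\<Sum>\<mu>\<in>{\<mu>\<in>partitions n. \<not> decays n \<mu>}. real (specht_dim \<mu>) ^ 2 / fact n)
    \<le> (\<Sum>m\<in>{1..n}. (2 * exp 1 * real n powr (1 / 50 - 1 / 3)) ^ m)"
proof -
  let ?w = "\<lambda>\<mu>. real (specht_dim \<mu>) ^ 2 / fact n"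
  have "\<exists>R. \<forall>m. card (R m) \<le> 2 ^ m \<and> finite (R m) \<and> (\<forall>r\<in>R m. r permutes {1..m} \<and> supp r = {1..m}) \<and>
    (\<forall>g n. g permutes {1..n} \<longrightarrow> card (supp g) = m \<longrightarrow> (\<exists>r\<in>R m. \<forall>\<mu>\<in>partitions n. psi \<mu> r = psi \<mu> g))"
    by (rule choice, rule allI, rule conj_class_representatives) blast
  then obtain R where R: "\<And>m. card (R m) \<le> 2 ^ m" "\<And>m. finite (R m)" "\<And>m r. r \<in> R m \<Longrightarrow> r permutes {1..m} \<and> supp r = {1..m}"
    "\<And>m g n. g permutes {1..n} \<Longrightarrow> card (supp g) = m \<Longrightarrow> \<exists>r\<in>R m. \<forall>\<mu>\<in>partitions n. psi \<mu> r = psi \<mu> g" by metis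
  let ?B = "{\<mu>\<in>partitions n. \<not> decays n \<mu>}"
  have fin: "finite (partitions n)" using finite_nonempty_partitions by blast
  \<comment> \<open>The weight n^(m/50) is the inverse square of the decay n^(-m/100), so a single
    class on which decay fails already makes T at least 1, and Markov's inequality applies to
    T.\<close>
  define T where "T \<mu> = (\<Sum>m\<in>{1..n}. \<Sum>r\<in>R m. real n powr (real m / 50) * (psi \<mu> r)\<^sup>2)" for \<mu>
  have T0: "T \<mu> \<ge> 0" for \<mu> unfolding T_def by (intro sum_nonneg mult_nonneg_nonneg) auto
  have T1: "T \<mu> \<ge> 1" if mu: "\<mu> \<in> ?B" for \<mu>
  proof -
    obtain g where g: "g permutes {1..n}" and gt: "\<bar>psi \<mu> g\<bar> > real n powr (- real (card (supp g)) / 100)"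
      using mu by (auto simp: decays_def not_le)
    let ?m = "card (supp g)"
    have "?m \<noteq> 0"
    proof
      assume 0: "?m = 0"
      then have "supp g = {}" using finite_supp[OF g] by simp
      then have "g = id" by (auto simp: supp_def fun_eq_iff)
      then show False using gt 0 n mu psi_id[of \<mu> n] by simp
    qed
    then have m: "?m \<in> {1..n}" using card_supp_le[OF g] by (simp add: Suc_le_eq One_nat_def)
    obtain r where r: "r \<in> R ?m" "psi \<mu> r = psi \<mu> g" using R(4)[OF g refl] mu by blast
    have "1 = real n powr (real ?m / 50) * (real n powr (- real ?m / 100))\<^sup>2"
      using n by (simp add: power2_eq_square powr_add[symmetric])
    also have "\<dots> \<le> real n powr (real ?m / 50) * (psi \<mu> r)\<^sup>2"
    proof (intro mult_left_mono)
      have "(real n powr (- real ?m / 100))\<^sup>2 \<le> \<bar>psi \<mu> g\<bar>\<^sup>2" using gt by (intro power_mono) auto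
      then show "(real n powr (- real ?m / 100))\<^sup>2 \<le> (psi \<mu> r)\<^sup>2" using r by simp
    qed simp
    also have "\<dots> \<le> (\<Sum>r\<in>R ?m. real n powr (real ?m / 50) * (psi \<mu> r)\<^sup>2)"
      by (rule member_le_sum[OF r(1) _ R(2)]) simp
    also have "\<dots> \<le> T \<mu>" unfolding T_def
      by (rule member_le_sum[OF m, of "\<lambda>m. \<Sum>r\<in>R m. real n powr (real m / 50) * (psi \<mu> r)\<^sup>2"]) (auto intro: sum_nonneg)
    finally show ?thesis .
  qed
  have "(\<Sum>\<mu>\<in>?B. ?w \<mu>) \<le> (\<Sum>\<mu>\<in>?B. ?w \<mu> * T \<mu>)"
  proof (rule sum_mono)
    fix \<mu> assume "\<mu> \<in> ?B"
    from mult_left_mono[OF T1[OF this], of "?w \<mu>"] show "?w \<mu> \<le> ?w \<mu> * T \<mu>" by simp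
  qed
  also have "\<dots> \<le> (\<Sum>\<mu>\<in>partitions n. ?w \<mu> * T \<mu>)" by (rule sum_mono2[OF fin]) (auto simp: T0)
  also have "\<dots> = (\<Sum>\<mu>\<in>partitions n. \<Sum>m\<in>{1..n}. \<Sum>r\<in>R m. real n powr (real m / 50) / fact n * (chi \<mu> r)\<^sup>2)"
    by (simp add: T_def sum_distrib_left chi_def power_mult_distrib mult_ac)
  also have "\<dots> = (\<Sum>m\<in>{1..n}. \<Sum>r\<in>R m. \<Sum>\<mu>\<in>partitions n. real n powr (real m / 50) / fact n * (chi \<mu> r)\<^sup>2)"
    by (subst sum.swap, rule sum.cong[OF refl], rule sum.swap)
  also have "\<dots> \<le> (\<Sum>m\<in>{1..n}. \<Sum>r\<in>R m. real n powr (real m / 50) * (exp 1 * real n powr (- 1 / 3)) ^ m)"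
  proof (intro sum_mono)
    fix m r assume m: "m \<in> {1..n}" and r: "r \<in> R m"
    have rp: "r permutes {1..n}" using R(3)[OF r] perms_mono[of m n r] m by auto
    have cm: "card (supp r) = m" using R(3)[OF r] by simp
    have "(\<Sum>\<mu>\<in>partitions n. real n powr (real m / 50) / fact n * (chi \<mu> r)\<^sup>2) =
      real n powr (real m / 50) / fact n * (fact n / real (card (conj_class n r)))"
      by (simp only: sum_distrib_left[symmetric] chi_square_sum[OF rp])
    also have "\<dots> = real n powr (real m / 50) * (1 / real (card (conj_class n r)))" by simp
    also have "\<dots> \<le> real n powr (real m / 50) * (exp 1 * real n powr (- 1 / 3)) ^ m"
      using inverse_conj_class_size[OF rp] m unfolding cm by (intro mult_left_mono) auto
    finally show "(\<Sum>\<mu>\<in>partitions n. real n powr (real m / 50) / fact n * (chi \<mu> r)\<^sup>2) \<le> 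
      real n powr (real m / 50) * (exp 1 * real n powr (- 1 / 3)) ^ m" .
  qed
  also have "\<dots> \<le> (\<Sum>m\<in>{1..n}. (2 * exp 1 * real n powr (1 / 50 - 1 / 3)) ^ m)"
  proof (rule sum_mono)
    fix m
    have "real (card (R m)) \<le> 2 ^ m" using R(1)[of m] by (metis of_nat_le_iff of_nat_numeral of_nat_power)
    then have "(\<Sum>r\<in>R m. real n powr (real m / 50) * (exp 1 * real n powr (- 1 / 3)) ^ m) \<le>
      2 ^ m * (real n powr (real m / 50) * (exp 1 * real n powr (- 1 / 3)) ^ m)"
      by (simp add: mult_right_mono)
    also have "\<dots> = (2 * exp 1 * (real n powr (1 / 50) * real n powr (- 1 / 3))) ^ m"
    proof -
      have "real n powr (real m / 50) = (real n powr (1 / 50)) ^ m" using n by (simp add: powr_realpow[symmetric] powr_powr)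
      then show ?thesis by (simp add: power_mult_distrib mult_ac)
    qed
    also have "real n powr (1 / 50) * real n powr (- 1 / 3) = real n powr (1 / 50 - 1 / 3)" by (simp add: powr_add[symmetric])
    finally show "(\<Sum>r\<in>R m. real n powr (real m / 50) * (exp 1 * real n powr (- 1 / 3)) ^ m) \<le> (2 * exp 1 * real n powr (1 / 50 - 1 / 3)) ^ m" .
  qed
  finally show ?thesis .
qed

section \<open>Counting partitions\<close>

lemma finite_partitions: "finite (partitions n)" using finite_nonempty_partitions by blast

lemma card_partitions_pos: "card (partitions n) > 0"
  using finite_nonempty_partitions card_gt_0_iff by blast

lemma card_partitions_mono:
  assumes "a \<le> b" shows "card (partitions a) \<le> card (partitions b)"
proof (rule card_inj_on_le[OF _ _ finite_partitions])
  show "inj_on (\<lambda>t. t @ replicate (b - a) 1) (partitions a)" by (auto simp: inj_on_def)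
  show "(\<lambda>t. t @ replicate (b - a) 1) ` partitions a \<subseteq> partitions b"
  proof (rule image_subsetI)
    fix t assume t: "t \<in> partitions a"
    then have "\<forall>x\<in>set t. 1 \<le> x" by (auto simp: partitions_def Suc_le_eq One_nat_def intro: gr0I)
    then show "t @ replicate (b - a) 1 \<in> partitions b"
      using t assms by (auto simp: partitions_def sorted_wrt_append sum_list_replicate sorted_wrt_iff_nth_less[of _ "replicate _ _"])
  qed
qed

lemma sum_list_insort: "sum_list (insort j xs) = j + sum_list xs" for j :: nat
  by (induction xs) auto

text \<open>Inserting a part j can be undone by removing one copy of it. The reversals are there
  because \<open>insort\<close> works on increasing lists.\<close>

lemma card_partitions_containing:
  assumes j: "0 < j" "j \<le> n"
  shows "card (partitions (n - j)) \<le> card {\<mu>\<in>partitions n. j \<in> set \<mu>}"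
proof (rule card_inj_on_le[of "\<lambda>t. rev (insort j (rev t))"])
  show "inj_on (\<lambda>t. rev (insort j (rev t))) (partitions (n - j))"
  proof (rule inj_onI)
    fix s t :: "nat list" assume "rev (insort j (rev s)) = rev (insort j (rev t))"
    then have "remove1 j (insort j (rev s)) = remove1 j (insort j (rev t))" by simp
    then show "s = t" by simp
  qed
  show "(\<lambda>t. rev (insort j (rev t))) ` partitions (n - j) \<subseteq> {\<mu>\<in>partitions n. j \<in> set \<mu>}"
  proof (rule image_subsetI)
    fix t assume t: "t \<in> partitions (n - j)"
    then have s: "sorted (rev t)" "0 \<notin> set t" "sum_list t = n - j" by (auto simp: partitions_def sorted_wrt_rev)
    have "sorted_wrt (\<ge>) (rev (insort j (rev t)))" using s(1) by (simp only: sorted_wrt_rev sorted_insort)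
    moreover have "set (rev (insort j (rev t))) = insert j (set t)" by (simp add: set_insort_key)
    moreover have "sum_list (rev (insort j (rev t))) = n"
      using s(3) j by (simp add: sum_list_insort)
    ultimately show "rev (insort j (rev t)) \<in> {\<mu>\<in>partitions n. j \<in> set \<mu>}" using s(2) j by (simp add: partitions_def)
  qed
qed (simp add: finite_partitions)

lemma sum_set_le_sum_list: "\<Sum>(set xs) \<le> sum_list xs" for xs :: "nat list"
proof (induction xs)
  case (Cons a xs)
  then show ?case by (cases "a \<in> set xs") (auto simp: insert_absorb)
qed simp

text \<open>Double counting of the pairs of a partition of \<open>n\<close> and a part of size \<open>j\<close>.\<close>

lemma card_partitions_drop:
  assumes J: "J \<le> n"
  shows "J ^ 2 * card (partitions (n - J)) \<le> 2 * n * card (partitions n)"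
proof -
  have "J ^ 2 \<le> J * (J + 1)" by (simp add: power2_eq_square)
  also have "\<dots> = 2 * \<Sum>{1..J}" using gauss_sum_from_Suc_0[of J, where 'a = nat] by (simp add: One_nat_def)
  finally have "J ^ 2 * card (partitions (n - J)) \<le> 2 * (\<Sum>j\<in>{1..J}. j * card (partitions (n - J)))"
    by (simp add: sum_distrib_right[symmetric] mult_right_mono mult.assoc[symmetric])
  also have "(\<Sum>j\<in>{1..J}. j * card (partitions (n - J))) \<le> (\<Sum>j\<in>{1..J}. j * card {\<mu>\<in>partitions n. j \<in> set \<mu>})"
  proof (intro sum_mono mult_left_mono)
    fix j assume j: "j \<in> {1..J}"
    have "card (partitions (n - J)) \<le> card (partitions (n - j))" using j by (intro card_partitions_mono) auto
    also have "\<dots> \<le> card {\<mu>\<in>partitions n. j \<in> set \<mu>}" using j J by (intro card_partitions_containing) auto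
    finally show "card (partitions (n - J)) \<le> card {\<mu>\<in>partitions n. j \<in> set \<mu>}" .
  qed simp
  also have "\<dots> = (\<Sum>j\<in>{1..J}. \<Sum>\<mu>\<in>partitions n. if j \<in> set \<mu> then j else 0)"
  proof (rule sum.cong[OF refl])
    fix j
    have "(\<Sum>\<mu>\<in>partitions n. if j \<in> set \<mu> then j else 0) = (\<Sum>\<mu>\<in>{\<mu>\<in>partitions n. j \<in> set \<mu>}. j)"
      by (rule sum.inter_filter[symmetric, OF finite_partitions])
    then show "j * card {\<mu>\<in>partitions n. j \<in> set \<mu>} = (\<Sum>\<mu>\<in>partitions n. if j \<in> set \<mu> then j else 0)" by simp
  qed
  also have "\<dots> = (\<Sum>\<mu>\<in>partitions n. \<Sum>j\<in>{1..J}. if j \<in> set \<mu> then j else 0)" by (rule sum.swap)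
  also have "\<dots> \<le> (\<Sum>\<mu>\<in>partitions n. n)"
  proof (rule sum_mono)
    fix \<mu> assume mu: "\<mu> \<in> partitions n"
    have "(\<Sum>j\<in>{1..J}. if j \<in> set \<mu> then j else 0) = \<Sum>({1..J} \<inter> set \<mu>)" by (rule sum.inter_restrict[symmetric]) simp
    also have "\<dots> \<le> \<Sum>(set \<mu>)" by (rule sum_mono2) auto
    also have "\<dots> \<le> n" using sum_set_le_sum_list[of \<mu>] mu by (simp add: partitions_def)
    finally show "(\<Sum>j\<in>{1..J}. if j \<in> set \<mu> then j else 0) \<le> n" .
  qed
  finally show ?thesis by (simp add: mult_ac)
qed

text \<open>One removal of J gains only the factor J^2 / (2n), a small power of n in the
  application; several removals of total size within the row bound multiply these gains.\<close>

lemma card_partitions_drop_iterate: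
  assumes "i * J \<le> n"
  shows "(J ^ 2) ^ i * card (partitions (n - i * J)) \<le> (2 * n) ^ i * card (partitions n)"
  using assms
proof (induction i)
  case (Suc i)
  have "(J ^ 2) ^ Suc i * card (partitions (n - Suc i * J)) = (J ^ 2) ^ i * (J ^ 2 * card (partitions ((n - i * J) - J)))"
    by (simp add: mult_ac diff_diff_left add.commute)
  also have "\<dots> \<le> (J ^ 2) ^ i * (2 * (n - i * J) * card (partitions (n - i * J)))"
    using Suc.prems by (intro mult_left_mono card_partitions_drop) auto
  also have "\<dots> \<le> (2 * n) * ((J ^ 2) ^ i * card (partitions (n - i * J)))" by (simp add: mult_ac mult_left_mono)
  also have "\<dots> \<le> (2 * n) * ((2 * n) ^ i * card (partitions n))" using Suc by (intro mult_left_mono) auto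
  finally show ?case by (simp add: mult_ac)
qed simp

lemma partition_split_ones:
  assumes "sorted_wrt (\<ge>) \<mu>" "0 \<notin> set \<mu>"
  shows "\<exists>t k. \<mu> = map Suc t @ replicate k 1 \<and> sorted_wrt (\<ge>) t \<and> 0 \<notin> set t"
  using assms
proof (induction \<mu>)
  case Nil
  have "[] = map Suc [] @ replicate 0 1" by simp
  then show ?case by (metis list.set(1) empty_iff sorted_wrt.simps(1))
next
  case (Cons a \<mu>)
  then obtain t k where t: "\<mu> = map Suc t @ replicate k 1" "sorted_wrt (\<ge>) t" "0 \<notin> set t" by auto
  show ?case
  proof (cases "a = 1")
    case True
    have "\<forall>x\<in>set \<mu>. x = 1" using Cons.prems True by (auto simp: One_nat_def le_Suc_eq)
    then have "a # \<mu> = map Suc [] @ replicate (Suc (length \<mu>)) 1" using True by (simp add: replicate_length_same[symmetric])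
    then show ?thesis by (metis list.set(1) empty_iff sorted_wrt.simps(1))
  next
    case False
    then obtain b where b: "a = Suc b" "b \<noteq> 0" using Cons.prems(2) by (cases a) (auto simp: One_nat_def)
    have "\<forall>x\<in>set t. x \<le> b" using Cons.prems(1) t(1) b(1) by auto
    then have "sorted_wrt (\<ge>) (b # t)" "0 \<notin> set (b # t)" using t b(2) by auto
    moreover have "a # \<mu> = map Suc (b # t) @ replicate k 1" using t(1) b(1) by simp
    ultimately show ?thesis by blast
  qed
qed

text \<open>Deleting the first column of the diagram leaves a partition of n - l. The original is
  recovered by adding 1 to every part and filling up with ones to length l.\<close>

lemma card_long_partitions: "card {\<mu>\<in>partitions n. length \<mu> = l} \<le> card (partitions (n - l))"
proof -
  have sub: "{\<mu>\<in>partitions n. length \<mu> = l} \<subseteq> (\<lambda>t. map Suc t @ replicate (l - length t) 1) ` partitions (n - l)"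
  proof
    fix \<mu> assume mu: "\<mu> \<in> {\<mu>\<in>partitions n. length \<mu> = l}"
    then have m: "sorted_wrt (\<ge>) \<mu>" "0 \<notin> set \<mu>" "sum_list \<mu> = n" "length \<mu> = l" by (auto simp: partitions_def)
    obtain t k where t: "\<mu> = map Suc t @ replicate k 1" "sorted_wrt (\<ge>) t" "0 \<notin> set t"
      using partition_split_ones[OF m(1,2)] by blast
    have k: "k = l - length t" "length t \<le> l" using m(4) t(1) by auto
    have "sum_list \<mu> = sum_list t + length t + k" unfolding t(1) by (simp add: sum_list_Suc sum_list_replicate)
    then have "t \<in> partitions (n - l)" using m(3) t(2,3) k by (simp add: partitions_def)
    then show "\<mu> \<in> (\<lambda>t. map Suc t @ replicate (l - length t) 1) ` partitions (n - l)" using t(1) k(1) by blast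
  qed
  then show ?thesis by (rule surj_card_le[OF finite_partitions])
qed

lemma card_wide_partitions: 
  assumes "0 < j" shows "card {\<mu>\<in>partitions n. \<mu> \<noteq> [] \<and> hd \<mu> = j} \<le> card (partitions (n - j))"
proof -
  have "{\<mu>\<in>partitions n. \<mu> \<noteq> [] \<and> hd \<mu> = j} \<subseteq> (#) j ` partitions (n - j)"
  proof
    fix \<mu> assume mu: "\<mu> \<in> {\<mu>\<in>partitions n. \<mu> \<noteq> [] \<and> hd \<mu> = j}"
    then obtain t where t: "\<mu> = j # t" by (cases \<mu>) auto
    then have "t \<in> partitions (n - j)" using mu by (auto simp: partitions_def)
    then show "\<mu> \<in> (#) j ` partitions (n - j)" using t by blast
  qed
  then show ?thesis by (rule surj_card_le[OF finite_partitions])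
qed

lemma fitsI:
  assumes mu: "\<mu> \<in> partitions n" and l: "length \<mu> \<le> L" and h: "\<mu> \<noteq> [] \<Longrightarrow> hd \<mu> \<le> L"
  shows "fits n L \<mu>"
  unfolding fits_def
proof (intro ballI conjI)
  fix x assume "x \<in> {1..n}"
  then have x: "row_of \<mu> x < length \<mu>" "col_of \<mu> x < \<mu> ! row_of \<mu> x"
    using pos_tab_entry[of x \<mu>] sum_list_partition[OF mu] by (simp_all del: atLeastAtMost_iff)
  show "row_of \<mu> x < L" using x l by simp
  have "\<mu> ! row_of \<mu> x \<le> hd \<mu>"
  proof (cases "row_of \<mu> x = 0")
    case True then show ?thesis using x by (cases \<mu>) auto
  next
    case False
    then have "\<mu> ! row_of \<mu> x \<le> \<mu> ! 0" using sorted_wrt_nth_less[of "(\<ge>)" \<mu> 0 "row_of \<mu> x"] mu x by (simp add: partitions_def)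
    then show ?thesis using x by (cases \<mu>) auto
  qed
  then show "col_of \<mu> x < L" using x h by (cases "\<mu> = []") auto
qed

text \<open>A shape leaves the box by having l > L rows or a first row of length l > L. Deleting the
  first column or the first row leaves a partition of n - l, and there are at most n values of l for
  either kind.\<close>

lemma card_not_fits:
  assumes L: "i * J \<le> L" "i * J \<le> n"
  shows "card {\<mu>\<in>partitions n. \<not> fits n L \<mu>} \<le> 2 * n * card (partitions (n - i * J))"
proof -
  let ?A = "\<lambda>l. {\<mu>\<in>partitions n. length \<mu> = l}" and ?B = "\<lambda>j. {\<mu>\<in>partitions n. \<mu> \<noteq> [] \<and> hd \<mu> = j}"
  have sub: "{\<mu>\<in>partitions n. \<not> fits n L \<mu>} \<subseteq> (\<Union>l\<in>{L<..n}. ?A l) \<union> (\<Union>l\<in>{L<..n}. ?B l)"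
  proof
    fix \<mu> assume mu: "\<mu> \<in> {\<mu>\<in>partitions n. \<not> fits n L \<mu>}"
    then have s: "sum_list \<mu> = n" "0 \<notin> set \<mu>" by (auto simp: partitions_def)
    have len: "length \<mu> \<le> n"
    proof -
      have "length xs \<le> sum_list xs" if "0 \<notin> set xs" for xs :: "nat list" using that by (induction xs) auto
      then show ?thesis using s by blast
    qed
    have hd: "\<mu> \<noteq> [] \<Longrightarrow> hd \<mu> \<le> n" using s(1) by (cases \<mu>) auto
    have "fits n L \<mu>" if "\<not> (length \<mu> > L \<or> (\<mu> \<noteq> [] \<and> hd \<mu> > L))" using that mu by (intro fitsI) auto
    then have "length \<mu> > L \<or> (\<mu> \<noteq> [] \<and> hd \<mu> > L)" using mu by blast
    then show "\<mu> \<in> (\<Union>l\<in>{L<..n}. ?A l) \<union> (\<Union>l\<in>{L<..n}. ?B l)" using mu len hd by auto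
  qed
  have a: "card (\<Union>l\<in>{L<..n}. F l) \<le> n * card (partitions (n - i * J))"
    if F: "\<And>l. 0 < l \<Longrightarrow> card (F l) \<le> card (partitions (n - l))" for F :: "nat \<Rightarrow> nat list set"
  proof -
    have "card (\<Union>l\<in>{L<..n}. F l) \<le> (\<Sum>l\<in>{L<..n}. card (F l))" by (rule card_UN_le) simp
    also have "\<dots> \<le> (\<Sum>l\<in>{L<..n}. card (partitions (n - i * J)))"
    proof (rule sum_mono)
      fix l assume l: "l \<in> {L<..n}"
      then have "card (F l) \<le> card (partitions (n - l))" by (intro F) auto
      also have "\<dots> \<le> card (partitions (n - i * J))" using l L by (intro card_partitions_mono) auto
      finally show "card (F l) \<le> card (partitions (n - i * J))" .
    qed
    also have "\<dots> \<le> n * card (partitions (n - i * J))" by (simp add: mult_right_mono)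
    finally show ?thesis .
  qed
  have "card {\<mu>\<in>partitions n. \<not> fits n L \<mu>} \<le> card ((\<Union>l\<in>{L<..n}. ?A l) \<union> (\<Union>l\<in>{L<..n}. ?B l))"
    by (rule card_mono[OF _ sub]) (simp add: finite_partitions)
  also have "\<dots> \<le> card (\<Union>l\<in>{L<..n}. ?A l) + card (\<Union>l\<in>{L<..n}. ?B l)" by (rule card_Un_le)
  also have "\<dots> \<le> n * card (partitions (n - i * J)) + n * card (partitions (n - i * J))"
    by (intro add_mono a card_long_partitions card_wide_partitions)
  finally show ?thesis by simp
qed

lemma uniform_not_fits:
  "(\<lambda>n. real (card {\<mu>\<in>partitions n. \<not> fits n (row_bound n) \<mu>}) / real (card (partitions n))) \<longlonglongrightarrow> 0"
proof (rule real_tendsto_sandwich[OF _ _ tendsto_const])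
  \<comment> \<open>With J of order n^(13/25) the ratio J^2 / n has order n^(1/25). Forty removals
    gain n^(8/5), which beats the factor 2n from the count of possible lengths.\<close>
  let ?b = "\<lambda>n::nat. 2 * real n * (2 * real n / (real n powr (13 / 25) / 80) ^ 2) ^ 40"
  show "?b \<longlonglongrightarrow> 0" by real_asymp
  show "\<forall>\<^sub>F n in sequentially. 0 \<le> real (card {\<mu>\<in>partitions n. \<not> fits n (row_bound n) \<mu>}) / real (card (partitions n))" by simp
  have "\<forall>\<^sub>F n in sequentially. real n powr (13 / 25) / 80 \<le> real n powr (13 / 25) / 40 - 1" by real_asymp
  moreover have "\<forall>\<^sub>F n in sequentially. real n powr (13 / 25) \<le> real n" by real_asymp
  ultimately show "\<forall>\<^sub>F n in sequentially. real (card {\<mu>\<in>partitions n. \<not> fits n (row_bound n) \<mu>}) / real (card (partitions n)) \<le> ?b n"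
    using eventually_gt_at_top[of 0]
  proof eventually_elim
    fix n :: nat assume a: "real n powr (13 / 25) / 80 \<le> real n powr (13 / 25) / 40 - 1" and b: "real n powr (13 / 25) \<le> real n" and n: "n > 0"
    \<comment> \<open>A fortieth of the row bound, rounded down; for large n the rounding costs at
      most a factor 2, hence the 80 in the lower bound \<open>Jge\<close>.\<close>
    define J where "J = nat \<lfloor>real n powr (13 / 25) / 40\<rfloor>"
    have p: "real n powr (13 / 25) > 0" using n by simp
    have Jle: "real J \<le> real n powr (13 / 25) / 40" unfolding J_def by (rule of_nat_floor) (use p in simp)
    have Jge: "real n powr (13 / 25) / 80 \<le> real J" using a unfolding J_def by linarith
    have "real (40 * J) \<le> real n powr (13 / 25)" using Jle by simp
    then have "real (40 * J) \<le> real (row_bound n)" "real (40 * J) \<le> real n" using row_bound(3)[OF n] b by linarith+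
    then have J: "40 * J \<le> row_bound n" "40 * J \<le> n" by (simp_all only: of_nat_le_iff)
    have J0: "real J > 0" using Jge p by linarith
    let ?P = "real (card (partitions n))" and ?Q = "real (card (partitions (n - 40 * J)))"
    have P: "?P > 0" using card_partitions_pos by simp
    have "real ((J ^ 2) ^ 40 * card (partitions (n - 40 * J))) \<le> real ((2 * n) ^ 40 * card (partitions n))"
      using card_partitions_drop_iterate[OF J(2)] by (simp only: of_nat_le_iff)
    then have "(real J ^ 2) ^ 40 * ?Q \<le> (2 * real n) ^ 40 * ?P" by (simp only: of_nat_mult of_nat_power of_nat_numeral)
    then have "?Q / ?P \<le> (2 * real n) ^ 40 / (real J ^ 2) ^ 40"
      using P J0 by (simp add: divide_le_eq le_divide_eq mult.commute)
    also have "\<dots> = (2 * real n / real J ^ 2) ^ 40" by (simp only: power_divide)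
    also have "\<dots> \<le> (2 * real n / (real n powr (13 / 25) / 80) ^ 2) ^ 40"
    proof (rule power_mono, rule frac_le)
      show "(real n powr (13 / 25) / 80) ^ 2 \<le> real J ^ 2" using Jge by (intro power_mono) auto
    qed (use p in auto)
    finally have QP: "?Q / ?P \<le> (2 * real n / (real n powr (13 / 25) / 80) ^ 2) ^ 40" .
    have "real (card {\<mu>\<in>partitions n. \<not> fits n (row_bound n) \<mu>}) \<le> real (2 * n * card (partitions (n - 40 * J)))"
      using card_not_fits[OF J] by (simp only: of_nat_le_iff)
    also have "\<dots> = 2 * real n * ?Q" by simp
    finally have "real (card {\<mu>\<in>partitions n. \<not> fits n (row_bound n) \<mu>}) / ?P \<le> 2 * real n * (?Q / ?P)"
      using P by (simp add: divide_right_mono)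
    also have "\<dots> \<le> ?b n" using QP by (intro mult_left_mono) auto
    finally show "real (card {\<mu>\<in>partitions n. \<not> fits n (row_bound n) \<mu>}) / ?P \<le> ?b n" .
  qed
qed

lemma geometric_sum_le:
  assumes q: "0 \<le> q" "q \<le> (1 / 2 :: real)"
  shows "(\<Sum>m\<in>{1..n}. q ^ m) \<le> 2 * q"
proof -
  \<comment> \<open>The extra term pays for the next summand: q \<le> 1/2 gives 2 q^(n+2) \<le>
    q^(n+1).\<close>
  have "(\<Sum>m\<in>{1..n}. q ^ m) + 2 * q ^ (n + 1) \<le> 2 * q"
  proof (induction n)
    case (Suc n)
    have "(2 * q) * q ^ (n + 1) \<le> 1 * q ^ (n + 1)" using q by (intro mult_right_mono) auto
    then have "2 * q ^ (Suc n + 1) \<le> q ^ (n + 1)" by simp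
    moreover have "(\<Sum>m\<in>{1..Suc n}. q ^ m) = (\<Sum>m\<in>{1..n}. q ^ m) + q ^ (n + 1)" by (simp add: One_nat_def)
    ultimately show ?case using Suc by linarith
  qed simp
  moreover have "q ^ (n + 1) \<ge> 0" using q by simp
  ultimately show ?thesis by linarith
qed

lemma plancherel_marginal:
  assumes P: "plancherel_law n P"
  shows "measure_pmf.prob P {\<mu>. \<not> (\<mu> \<in> partitions n \<and> decays n \<mu>)} =
    (\<Sum>\<mu>\<in>{\<mu>\<in>partitions n. \<not> decays n \<mu>}. real (specht_dim \<mu>) ^ 2 / fact n)"
proof -
  let ?B = "{\<mu>\<in>partitions n. \<not> decays n \<mu>}"
  have pm: "pmf P \<mu> = (if \<mu> \<in> partitions n then real (specht_dim \<mu>) ^ 2 / fact n else 0)" for \<mu>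
    using P by (simp add: plancherel_law_def)
  have "set_pmf P \<subseteq> partitions n"
  proof
    fix \<mu> assume "\<mu> \<in> set_pmf P"
    then have "pmf P \<mu> \<noteq> 0" by (simp add: set_pmf_iff)
    then show "\<mu> \<in> partitions n" unfolding pm by (simp split: if_splits)
  qed
  then have e: "{\<mu>. \<not> (\<mu> \<in> partitions n \<and> decays n \<mu>)} \<inter> set_pmf P = ?B \<inter> set_pmf P" by blast
  have "measure_pmf.prob P {\<mu>. \<not> (\<mu> \<in> partitions n \<and> decays n \<mu>)} = measure_pmf.prob P ?B"
    using arg_cong[OF e, of "measure_pmf.prob P"] by (simp only: measure_Int_set_pmf)
  also have "\<dots> = (\<Sum>\<mu>\<in>?B. pmf P \<mu>)" by (rule measure_measure_pmf_finite) (simp add: finite_partitions)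
  also have "\<dots> = (\<Sum>\<mu>\<in>?B. real (specht_dim \<mu>) ^ 2 / fact n)" by (intro sum.cong refl) (simp add: pm)
  finally show ?thesis .
qed

lemma uniform_marginal:
  assumes P: "uniform_law n P"
  shows "measure_pmf.prob P {\<mu>. \<not> (\<mu> \<in> partitions n \<and> decays n \<mu>)} =
    real (card {\<mu>\<in>partitions n. \<not> decays n \<mu>}) / real (card (partitions n))"
proof -
  have "partitions n \<inter> {\<mu>. \<not> (\<mu> \<in> partitions n \<and> decays n \<mu>)} = {\<mu>\<in>partitions n. \<not> decays n \<mu>}" by blast
  then show ?thesis using P finite_nonempty_partitions[of n] by (simp add: uniform_law_def measure_pmf_of_set)
qed

lemma coupling_covers_prob:
  assumes c: "coupling 400 law J" and n: "n \<ge> 2"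
    and b: "\<And>P. law P \<Longrightarrow> measure_pmf.prob P {\<mu>. \<not> (\<mu> \<in> partitions n \<and> decays n \<mu>)} \<le> b"
  shows "measure_pmf.prob J {ls. covers_Irrep n (tensor_rep (map specht_rep ls))} \<ge> 1 - 400 * b"
proof -
  let ?G = "{ls. covers_Irrep n (tensor_rep (map specht_rep ls))}"
  let ?B = "{\<mu>. \<not> (\<mu> \<in> partitions n \<and> decays n \<mu>)}"
  let ?U = "\<Union>i\<in>{..<400}. (\<lambda>ls. ls ! i) -` ?B"
  have len: "\<And>ls. ls \<in> set_pmf J \<Longrightarrow> length ls = 400" and law: "\<And>i. i < 400 \<Longrightarrow> law (map_pmf (\<lambda>ls. ls ! i) J)"
    using c by (auto simp: coupling_def)
  \<comment> \<open>Intersecting with the support of J ensures that the list has length 400, so that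
    its entries are exactly the coordinates appearing in \<open>?U\<close>.\<close>
  have sub: "(- ?G) \<inter> set_pmf J \<subseteq> ?U"
  proof
    fix ls assume ls: "ls \<in> (- ?G) \<inter> set_pmf J"
    show "ls \<in> ?U"
    proof (rule ccontr)
      assume "ls \<notin> ?U"
      then have "\<mu> \<in> partitions n \<and> decays n \<mu>" if "\<mu> \<in> set ls" for \<mu>
        using that len[of ls] ls by (auto simp: in_set_conv_nth)
      then have "ls \<in> ?G" using covers_of_decay[OF n len] ls by blast
      then show False using ls by blast
    qed
  qed
  have "measure_pmf.prob J (- ?G) = measure_pmf.prob J ((- ?G) \<inter> set_pmf J)" by (simp add: measure_Int_set_pmf)
  also have "\<dots> \<le> measure_pmf.prob J ?U" by (rule measure_pmf.finite_measure_mono[OF sub]) simp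
  also have "\<dots> \<le> (\<Sum>i\<in>{..<400}. measure_pmf.prob J ((\<lambda>ls. ls ! i) -` ?B))"
    by (rule measure_pmf.finite_measure_subadditive_finite) auto
  also have "\<dots> = (\<Sum>i\<in>{..<400::nat}. measure_pmf.prob (map_pmf (\<lambda>ls. ls ! i) J) ?B)" by (simp only: measure_map_pmf)
  also have "\<dots> \<le> (\<Sum>i\<in>{..<400::nat}. b)" by (intro sum_mono b law) simp
  also have "\<dots> = 400 * b" by simp
  finally have "measure_pmf.prob J (- ?G) \<le> 400 * b" .
  moreover have "measure_pmf.prob J (- ?G) = 1 - measure_pmf.prob J ?G"
    using measure_pmf.prob_compl[of ?G J] by (simp add: Compl_eq_Diff_UNIV)
  ultimately show ?thesis by linarith
qed

theorem theorem1p3: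
  shows "\<exists>k>0. \<forall>J :: nat \<Rightarrow> nat list list pmf.
    (\<forall>n. coupling k (plancherel_law n) (J n) \<or> coupling k (uniform_law n) (J n)) \<longrightarrow>
    (\<lambda>n. measure_pmf.prob (J n) {ls. covers_Irrep n (tensor_rep (map specht_rep ls))})
      \<longlonglongrightarrow> 1"
proof (intro exI[of _ 400] conjI allI impI)
  fix J :: "nat \<Rightarrow> nat list list pmf"
  assume J: "\<forall>n. coupling 400 (plancherel_law n) (J n) \<or> coupling 400 (uniform_law n) (J n)"
  define q where "q n = 2 * exp 1 * real n powr (1 / 50 - 1 / 3)" for n :: nat
  define u where "u n = real (card {\<mu>\<in>partitions n. \<not> fits n (row_bound n) \<mu>}) / real (card (partitions n))" for n
  have q0: "q n \<ge> 0" for n by (simp add: q_def)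
  have u0: "u n \<ge> 0" for n by (simp add: u_def)
  have "q \<longlonglongrightarrow> 0" unfolding q_def by real_asymp
  then have lim: "(\<lambda>n. 1 - 400 * (2 * q n + u n)) \<longlonglongrightarrow> 1 - 400 * (2 * 0 + 0)"
    unfolding u_def by (intro tendsto_intros uniform_not_fits)
  have half: "\<forall>\<^sub>F n in sequentially. q n \<le> 1 / 2" unfolding q_def by real_asymp
  have lower: "\<forall>\<^sub>F n in sequentially. 1 - 400 * (2 * q n + u n) \<le>
      measure_pmf.prob (J n) {ls. covers_Irrep n (tensor_rep (map specht_rep ls))}"
    using half eventually_decays eventually_ge_at_top[of 2]
  proof eventually_elim
    fix n :: nat
    assume h: "q n \<le> 1 / 2" and d: "\<forall>\<nu>\<in>partitions n. fits n (row_bound n) \<nu> \<longrightarrow> decays n \<nu>" and n: "2 \<le> n"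
    \<comment> \<open>One bound, 2 q + u, is proved for both laws, since the hypothesis may choose
      the law anew for each n.\<close>
    have 1: "measure_pmf.prob P {\<mu>. \<not> (\<mu> \<in> partitions n \<and> decays n \<mu>)} \<le> 2 * q n + u n" if P: "plancherel_law n P" for P
    proof -
      have "measure_pmf.prob P {\<mu>. \<not> (\<mu> \<in> partitions n \<and> decays n \<mu>)} \<le> (\<Sum>m\<in>{1..n}. q n ^ m)"
        unfolding plancherel_marginal[OF P] q_def by (rule plancherel_not_decays) (use n in simp)
      also have "\<dots> \<le> 2 * q n" by (rule geometric_sum_le[OF q0 h])
      finally show ?thesis using u0[of n] by linarith
    qed
    have 2: "measure_pmf.prob P {\<mu>. \<not> (\<mu> \<in> partitions n \<and> decays n \<mu>)} \<le> 2 * q n + u n" if P: "uniform_law n P" for P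
    proof -
      have "card {\<mu>\<in>partitions n. \<not> decays n \<mu>} \<le> card {\<mu>\<in>partitions n. \<not> fits n (row_bound n) \<mu>}"
        by (rule card_mono) (use d in \<open>auto simp: finite_partitions\<close>)
      then have "measure_pmf.prob P {\<mu>. \<not> (\<mu> \<in> partitions n \<and> decays n \<mu>)} \<le> u n"
        unfolding uniform_marginal[OF P] u_def by (intro divide_right_mono) auto
      then show ?thesis using q0[of n] by linarith
    qed
    show "1 - 400 * (2 * q n + u n) \<le> measure_pmf.prob (J n) {ls. covers_Irrep n (tensor_rep (map specht_rep ls))}"
      using J coupling_covers_prob[where J = "J n", OF _ n 1] coupling_covers_prob[where J = "J n", OF _ n 2] by blast
  qed
  show "(\<lambda>n. measure_pmf.prob (J n) {ls. covers_Irrep n (tensor_rep (map specht_rep ls))}) \<longlonglongrightarrow> 1"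
    by (rule real_tendsto_sandwich[OF lower _ _ tendsto_const]) (use lim in \<open>auto simp: measure_pmf.prob_le_1\<close>)
qed simp

end
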